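(* The $\Sigma_1$-provability logic of $\mathsf{HA}$, i.e. the theory $\mathsf{H}_\sigma$, is decidable: there is an algorithm which, given a modal proposition $A$, decides whether $\mathsf{H}_\sigma\vdash A$.
   Context: Modal language: propositional variables, $\bot$, $\wedge,\vee,\to$, $\Box$; atomic = variables and $\bot$; $\boxdot A:=A\wedge\Box A$. $\mathsf{iK4}$: intuitionistic propositional logic in the modal language plus $\Box(A\to B)\to(\Box A\to\Box B)$ and $\Box A\to\Box\Box A$, closed under modus ponens and necessitation; $\mathsf{iGL}$: $\mathsf{iK4}$ plus $\Box(\Box A\to A)\to\Box A$. $\mathsf{NOI}$: propositions in which every $\to$ is in the scope of a $\Box$. Leivant's translation: $A^l=A$ for atomic/boxed $A$; $(A\wedge B)^l=A^l\wedge B^l$; $(A\vee B)^l=\boxdot A^l\vee\boxdot B^l$; $(A\to B)^l=A\to B^l$ if $A\in\mathsf{NOI}$, else $A\to B$. $\mathsf{LLe}^+:=\mathsf{iGL}+\{\Box A\to\Box A^l\}+\{p\to\Box p: p\text{ atomic}\}$. $[A]B$: $[A]B=B$ for atomic/boxed $B$, $[A]$ commutes with $\wedge,\vee$, $[A](B_1\to B_2)=A\to(B_1\to B_2)$, $[A]Z:=\bigvee_{E\in Z}[A]E$. $\blacktriangleright$ is the smallest relation such that: (A1) $\mathsf{iK4}\vdash A\to B\Rightarrow A\blacktriangleright B$; (A2) transitive; (A3) $C\blacktriangleright A, C\blacktriangleright B\Rightarrow C\blacktriangleright A\wedge B$; (A4) $A\blacktriangleright B\Rightarrow\Box A\blacktriangleright\Box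 B$; (B1) $A\blacktriangleright C,B\blacktriangleright C\Rightarrow A\vee B\blacktriangleright C$; (B2) for a set $X$ of implications, $B=\bigwedge X$, $Z=\{E\mid E\to F\in X\}\cup\{C\}$: $(B\to C)\blacktriangleright[B]Z$; (B3) $A\blacktriangleright B\Rightarrow (C\to A)\blacktriangleright(C\to B)$ for atomic or boxed $C$. $\mathsf{H}_\sigma:=\mathsf{LLe}^++\{\Box A\to\Box B\mid A\blacktriangleright B\}$. (The paper shows $\mathsf{H}_\sigma$ is exactly the set of modal $A$ such that $\mathsf{HA}\vdash\sigma_{\mathsf{HA}}(A)$ for all substitutions of $\Sigma_1$-sentences for variables, with $\Box$ read as provability in $\mathsf{HA}$.) *)

theory Defs
  imports Main "HOL-Library.Nat_Bijection"
begin

datatype form = Var nat | Bot | And form form | Or form form | Imp form form | Box form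

definition Top :: form where "Top = Imp Bot Bot"

definition boxdot :: "form \<Rightarrow> form" where "boxdot A = And A (Box A)"

fun atomic :: "form \<Rightarrow> bool" where
  "atomic (Var _) = True" | "atomic Bot = True" | "atomic _ = False"

fun boxed :: "form \<Rightarrow> bool" where
  "boxed (Box _) = True" | "boxed _ = False"

fun bigand :: "form list \<Rightarrow> form" where
  "bigand [] = Top" | "bigand [A] = A" | "bigand (A # As) = And A (bigand As)"

fun bigor :: "form list \<Rightarrow> form" where
  "bigor [] = Bot" | "bigor [A] = A" | "bigor (A # As) = Or A (bigor As)"

fun noi :: "form \<Rightarrow> bool" where
  "noi (Var _) = True" | "noi Bot = True"
| "noi (And A B) = (noi A \<and> noi B)" | "noi (Or A B) = (noi A \<and> noi B)"
| "noi (Imp _ _) = False" | "noi (Box _) = True"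

fun lt :: "form \<Rightarrow> form" where
  "lt (Var p) = Var p" | "lt Bot = Bot" | "lt (Box A) = Box A"
| "lt (And A B) = And (lt A) (lt B)"
| "lt (Or A B) = Or (boxdot (lt A)) (boxdot (lt B))"
| "lt (Imp A B) = (if noi A then Imp A (lt B) else Imp A B)"

fun brk :: "form \<Rightarrow> form \<Rightarrow> form" where
  "brk A (Var p) = Var p" | "brk A Bot = Bot" | "brk A (Box B) = Box B"
| "brk A (And B C) = And (brk A B) (brk A C)"
| "brk A (Or B C) = Or (brk A B) (brk A C)"
| "brk A (Imp B C) = Imp A (Imp B C)"

inductive deriv :: "(form \<Rightarrow> bool) \<Rightarrow> form \<Rightarrow> bool" for Ax where
  ax_extra: "Ax A \<Longrightarrow> deriv Ax A"
| ax_k1: "deriv Ax (Imp A (Imp B A))"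
| ax_s: "deriv Ax (Imp (Imp A (Imp B C)) (Imp (Imp A B) (Imp A C)))"
| ax_and1: "deriv Ax (Imp (And A B) A)"
| ax_and2: "deriv Ax (Imp (And A B) B)"
| ax_andI: "deriv Ax (Imp A (Imp B (And A B)))"
| ax_or1: "deriv Ax (Imp A (Or A B))"
| ax_or2: "deriv Ax (Imp B (Or A B))"
| ax_orE: "deriv Ax (Imp (Imp A C) (Imp (Imp B C) (Imp (Or A B) C)))"
| ax_bot: "deriv Ax (Imp Bot A)"
| ax_K: "deriv Ax (Imp (Box (Imp A B)) (Imp (Box A) (Box B)))"
| ax_4: "deriv Ax (Imp (Box A) (Box (Box A)))"
| mp: "deriv Ax (Imp A B) \<Longrightarrow> deriv Ax A \<Longrightarrow> deriv Ax B"
| nec: "deriv Ax A \<Longrightarrow> deriv Ax (Box A)"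

abbreviation iK4 :: "form \<Rightarrow> bool" where "iK4 \<equiv> deriv (\<lambda>_. False)"

inductive tri :: "form \<Rightarrow> form \<Rightarrow> bool" where
  A1: "iK4 (Imp A B) \<Longrightarrow> tri A B"
| A2: "tri A B \<Longrightarrow> tri B C \<Longrightarrow> tri A C"
| A3: "tri C A \<Longrightarrow> tri C B \<Longrightarrow> tri C (And A B)"
| A4: "tri A B \<Longrightarrow> tri (Box A) (Box B)"
| B1: "tri A C \<Longrightarrow> tri B C \<Longrightarrow> tri (Or A B) C"
| B2: "tri (Imp (bigand (map (\<lambda>(E, F). Imp E F) X)) C)
           (bigor (map (brk (bigand (map (\<lambda>(E, F). Imp E F) X))) (map fst X @ [C])))"
| B3: "tri A B \<Longrightarrow> atomic C \<or> boxed C \<Longrightarrow> tri (Imp C A) (Imp C B)"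

definition Hsigma_ax :: "form \<Rightarrow> bool" where
  "Hsigma_ax D \<longleftrightarrow>
     (\<exists>A. D = Imp (Box (Imp (Box A) A)) (Box A))
   \<or> (\<exists>A. D = Imp (Box A) (Box (lt A)))
   \<or> (\<exists>p. atomic p \<and> D = Imp p (Box p))
   \<or> (\<exists>A B. tri A B \<and> D = Imp (Box A) (Box B))"

definition Hsigma :: "form \<Rightarrow> bool" where "Hsigma = deriv Hsigma_ax"

datatype recf = Zero | Succ | Proj nat | Comp recf "recf list" | Prim recf recf | Mn recf

inductive ev :: "recf \<Rightarrow> nat list \<Rightarrow> nat \<Rightarrow> bool" where
  ev_zero: "ev Zero xs 0"
| ev_succ: "ev Succ (x # xs) (Suc x)"
| ev_proj: "i < length xs \<Longrightarrow> ev (Proj i) xs (xs ! i)"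
| ev_comp: "list_all2 (\<lambda>g y. ev g xs y) gs ys \<Longrightarrow> ev f ys y \<Longrightarrow> ev (Comp f gs) xs y"
| ev_prim0: "ev g xs y \<Longrightarrow> ev (Prim g h) (0 # xs) y"
| ev_primS: "ev (Prim g h) (n # xs) z \<Longrightarrow> ev h (z # n # xs) y \<Longrightarrow> ev (Prim g h) (Suc n # xs) y"
| ev_mn: "ev f (n # xs) 0 \<Longrightarrow> (\<forall>m<n. \<exists>k. k \<noteq> 0 \<and> ev f (m # xs) k) \<Longrightarrow> ev (Mn f) xs n"

fun code :: "form \<Rightarrow> nat" where
  "code (Var n) = prod_encode (0, n)"
| "code Bot = prod_encode (1, 0)"
| "code (And A B) = prod_encode (2, prod_encode (code A, code B))"
| "code (Or A B) = prod_encode (3, prod_encode (code A, code B))"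
| "code (Imp A B) = prod_encode (4, prod_encode (code A, code B))"
| "code (Box A) = prod_encode (5, code A)"

end

theory Submission
  imports Defs
begin

text \<open>Only the boxed formulas matter, since all axioms of \<open>Hsigma\<close> are Horn clauses over atomic and
  boxed formulas. Visser's rule B2, used as a rewrite rule on sequents, gives every formula \<open>G\<close> a
  weakest NNIL approximation \<open>star G\<close> from below with \<open>tri G (star G)\<close>. Hence \<open>Hsigma\<close> proves
  \<open>A \<leftrightarrow> tau A\<close>, where \<open>tau\<close> replaces hereditarily the formulas under boxes by their
  approximations. On formulas in which all boxes are NNIL, \<open>Hsigma\<close> agrees with the logic \<open>M\<close>,
  which has Loeb's axiom, \<open>p \<rightarrow> \<box>p\<close> for atomic \<open>p\<close> and \<open>\<box>(A \<rightarrow> \<box>A)\<close>. For one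
  inclusion, read \<open>star A\<close> at a prime theory \<open>w\<close> of \<open>M\<close> as truth of \<open>A\<close> at the root of every tree
  of prime theories with root \<open>w\<close>; this reading validates all rules of \<open>tri\<close>.
  For the other, the box translation \<open>A \<rightarrow> B \<mapsto> \<boxdot>(A \<rightarrow> B)\<close>
  interprets \<open>M\<close>, and Leivant's axiom makes \<open>\<box>A\<close> equivalent to its translation for NNIL
  formulas \<open>A\<close>. Finally \<open>M\<close> has the finite model property, so that \<open>A\<close> is not provable iff
  some \<open>B\<close> of the restricted form has a finite countermodel and \<open>A \<rightarrow> B\<close> is provable. Both
  provability and unprovability are thus semidecidable.\<close>

section \<open>Computable functions and semidecidable predicates\<close>

text \<open>\<open>star\<close> is obtained by choice, so \<open>tau A\<close> is never computed.
  The search for a witness of unprovability ranges over all formulas \<open>B\<close> with NNIL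
  boxes, and \<open>tau A\<close> only guarantees that one exists. Rule A4 is kept apart from the
  approximation: \<open>tri0\<close> treats boxed formulas as atoms, and the recursion of
  \<open>tau\<close> through boxes accounts for A4. The gap between what holds at a world and what
  holds under a box shapes the rest. \<open>M\<close> has \<open>A \<rightarrow> \<box>A\<close>
  only inside boxes; an auxiliary logic \<open>C\<close> has it everywhere, and \<open>M\<close>
  proves \<open>\<box>A\<close> for each theorem \<open>A\<close> of \<open>C\<close>. This is why
  Leivant's axiom is checked at prime theories of \<open>C\<close>, why the box translation must
  spare the outermost layer of a formula, and why worlds of finite models carry a flag. Finite trees
  are used instead of the inclusion order on prime theories because they can be glued under a common
  root, which yields the disjunction clause, and pruned, which yields Visser's rule.\<close>

definition computable_n :: "nat \<Rightarrow> (nat list \<Rightarrow> nat) \<Rightarrow> bool" where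
  "computable_n k F \<longleftrightarrow> (\<exists>r. \<forall>xs. length xs = k \<longrightarrow> ev r xs (F xs))"

lemma computable_n_cong:
  assumes "computable_n k F" "\<And>xs. length xs = k \<Longrightarrow> F xs = G xs"
  shows "computable_n k G"
proof -
  obtain r where "\<And>xs. length xs = k \<Longrightarrow> ev r xs (F xs)"
    using assms(1) by (auto simp: computable_n_def)
  then have "\<forall>xs. length xs = k \<longrightarrow> ev r xs (G xs)" using assms(2) by metis
  then show ?thesis unfolding computable_n_def by blast
qed

lemma computable_n_proj: "i < k \<Longrightarrow> computable_n k (\<lambda>xs. xs ! i)"
  unfolding computable_n_def by (metis ev_proj)

lemma computable_n_comp1:
  assumes "computable_n 1 F" "computable_n k G" shows "computable_n k (\<lambda>xs. F [G xs])"
proof -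
  obtain r where r: "\<And>xs. length xs = 1 \<Longrightarrow> ev r xs (F xs)" using assms(1) by (auto simp: computable_n_def)
  obtain s where s: "\<And>xs. length xs = k \<Longrightarrow> ev s xs (G xs)" using assms(2) by (auto simp: computable_n_def)
  have "ev (Comp r [s]) xs (F [G xs])" if "length xs = k" for xs
    by (rule ev_comp[where ys = "[G xs]"]) (auto intro: r s that)
  then show ?thesis unfolding computable_n_def by blast
qed

lemma computable_n_comp2:
  assumes "computable_n 2 F" "computable_n k G" "computable_n k H" shows "computable_n k (\<lambda>xs. F [G xs, H xs])"
proof -
  obtain r where r: "\<And>xs. length xs = 2 \<Longrightarrow> ev r xs (F xs)" using assms(1) by (auto simp: computable_n_def)
  obtain s where s: "\<And>xs. length xs = k \<Longrightarrow> ev s xs (G xs)" using assms(2) by (auto simp: computable_n_def)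
  obtain t where t: "\<And>xs. length xs = k \<Longrightarrow> ev t xs (H xs)" using assms(3) by (auto simp: computable_n_def)
  have "ev (Comp r [s, t]) xs (F [G xs, H xs])" if "length xs = k" for xs
    by (rule ev_comp[where ys = "[G xs, H xs]"]) (auto intro: r s t that)
  then show ?thesis unfolding computable_n_def by blast
qed

lemma computable_n_Suc: "computable_n k G \<Longrightarrow> computable_n k (\<lambda>xs. Suc (G xs))"
proof -
  have "ev Succ xs (Suc (xs ! 0))" if "length xs = 1" for xs
    using that by (cases xs) (auto intro: ev_succ)
  then have "computable_n 1 (\<lambda>xs. Suc (xs ! 0))" unfolding computable_n_def by blast
  then show "computable_n k G \<Longrightarrow> computable_n k (\<lambda>xs. Suc (G xs))"
    using computable_n_comp1[of "\<lambda>xs. Suc (xs ! 0)" k G] by simp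
qed

lemma computable_n_const: "computable_n k (\<lambda>xs. c)"
proof (induction c)
  case 0
  then show ?case unfolding computable_n_def using ev_zero by blast
next
  case (Suc c)
  then show ?case by (rule computable_n_Suc)
qed

lemma computable_n_prim:
  assumes "computable_n k G" "computable_n (Suc (Suc k)) H"
  shows "computable_n (Suc k) (\<lambda>xs. rec_nat (G (tl xs)) (\<lambda>n z. H (z # n # tl xs)) (hd xs))"
proof -
  obtain r where r: "\<And>xs. length xs = k \<Longrightarrow> ev r xs (G xs)" using assms(1) by (auto simp: computable_n_def)
  obtain s where s: "\<And>xs. length xs = Suc (Suc k) \<Longrightarrow> ev s xs (H xs)" using assms(2) by (auto simp: computable_n_def)
  have *: "ev (Prim r s) (n # ys) (rec_nat (G ys) (\<lambda>n z. H (z # n # ys)) n)" if "length ys = k" for n ys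
  proof (induction n)
    case 0
    then show ?case using that by (auto intro: ev_prim0 r)
  next
    case (Suc n)
    show ?case using ev_primS[OF Suc s] that by simp
  qed
  have "ev (Prim r s) xs (rec_nat (G (tl xs)) (\<lambda>n z. H (z # n # tl xs)) (hd xs))" if "length xs = Suc k" for xs
    using that *[of "tl xs" "hd xs"] by (cases xs) auto
  then show ?thesis unfolding computable_n_def by blast
qed

lemma ev_mn_Least:
  assumes "\<And>n. ev r (n # xs) (f n)" "f m = (0::nat)"
  shows "ev (Mn r) xs (LEAST n. f n = 0)"
proof (rule ev_mn)
  have "f (LEAST n. f n = 0) = 0" using assms(2) by (rule LeastI)
  then show "ev r ((LEAST n. f n = 0) # xs) 0" using assms(1) by metis
  show "\<forall>m<LEAST n. f n = 0. \<exists>k. k \<noteq> 0 \<and> ev r (m # xs) k"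
    using assms(1) not_less_Least by blast
qed

lemma computable_n_op2:
  assumes "computable_n 2 (\<lambda>xs. f (xs ! 0) (xs ! 1))" "computable_n k G" "computable_n k H"
  shows "computable_n k (\<lambda>xs. f (G xs) (H xs))"
  using computable_n_comp2[OF assms] by simp

lemma list2E: assumes "length xs = 2" obtains a b where "xs = [a, b]"
  using assms by (auto simp: length_Suc_conv eval_nat_numeral)

lemma computable_n_rec2:
  assumes "computable_n 1 (\<lambda>xs. g (xs ! 0))" "computable_n 3 (\<lambda>xs. h (xs ! 0) (xs ! 1) (xs ! 2))"
    and "\<And>x. f 0 x = g x" "\<And>n x. f (Suc n) x = h (f n x) n x"
  shows "computable_n 2 (\<lambda>xs. f (xs ! 0) (xs ! 1))"
proof -
  have *: "rec_nat (g x) (\<lambda>n z. h z n x) n = f n x" for n x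
    by (induction n) (auto simp: assms(3,4))
  show ?thesis
    using computable_n_prim[of 1 "\<lambda>xs. g (xs ! 0)" "\<lambda>xs. h (xs ! 0) (xs ! 1) (xs ! 2)"] assms(1,2)
    by (auto simp: numeral_2_eq_2 numeral_3_eq_3 * elim!: computable_n_cong elim: list2E[unfolded numeral_2_eq_2])
qed

lemma computable_n_add2: "computable_n 2 (\<lambda>xs. xs ! 0 + xs ! 1)"
  by (rule computable_n_rec2[where g = "\<lambda>x. x" and h = "\<lambda>z n x. Suc z"], (intro computable_n_Suc computable_n_proj; simp)+, simp_all)
lemmas computable_n_add = computable_n_op2[OF computable_n_add2]

lemma computable_n_mult2: "computable_n 2 (\<lambda>xs. xs ! 0 * xs ! 1)"
  by (rule computable_n_rec2[where g = "\<lambda>x. 0" and h = "\<lambda>z n x. x + z"], (intro computable_n_add computable_n_const computable_n_proj; simp)+, simp_all)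
lemmas computable_n_mult = computable_n_op2[OF computable_n_mult2]

text \<open>Unary functions enter the binary recursion scheme with a dummy second argument; uses of
  \<open>computable_n_pred\<close>, \<open>computable_n_pow\<close> and
  \<open>computable_n_triangle\<close> fill it with a constant.\<close>

lemma computable_n_pred2: "computable_n 2 (\<lambda>xs. xs ! 0 - 1)"
  by (rule computable_n_rec2[where g = "\<lambda>x. 0" and h = "\<lambda>z n x. n" and f = "\<lambda>x y. x - 1"])
    (auto intro: computable_n_proj computable_n_const)
lemmas computable_n_pred = computable_n_op2[where f = "\<lambda>x y. x - 1", OF computable_n_pred2]

lemma computable_n_sub2: "computable_n 2 (\<lambda>xs. xs ! 0 - xs ! 1)"
proof -
  \<comment> \<open>Recursion runs on the first argument, while subtraction iterates the predecessor
    along the subtrahend; the arguments are swapped here and swapped back below.\<close>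
  have "computable_n 2 (\<lambda>xs. xs ! 1 - xs ! 0)"
    by (rule computable_n_rec2[where g = "\<lambda>x. x" and h = "\<lambda>z n x. z - 1" and f = "\<lambda>x y. y - x"], (intro computable_n_pred[where H = "\<lambda>_. 0"] computable_n_const computable_n_proj; simp)+, simp_all)
  then show ?thesis by (rule computable_n_op2[where f = "\<lambda>x y. y - x"]) (auto intro: computable_n_proj)
qed
lemmas computable_n_sub = computable_n_op2[OF computable_n_sub2]

lemma computable_n_pow2: "computable_n 2 (\<lambda>xs. 2 ^ (xs ! 0))"
  by (rule computable_n_rec2[where g = "\<lambda>x. 1" and h = "\<lambda>z n x. z + z" and f = "\<lambda>x y. 2 ^ x"], (intro computable_n_add computable_n_const computable_n_proj; simp)+, simp_all)
lemmas computable_n_pow = computable_n_op2[where f = "\<lambda>x y. 2 ^ x", OF computable_n_pow2]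

lemma computable_n_triangle2: "computable_n 2 (\<lambda>xs. triangle (xs ! 0))"
  by (rule computable_n_rec2[where g = "\<lambda>x. 0" and h = "\<lambda>z n x. z + Suc n" and f = "\<lambda>x y. triangle x"], (intro computable_n_add computable_n_const computable_n_Suc computable_n_proj; simp)+, simp_all)
lemmas computable_n_triangle = computable_n_op2[where f = "\<lambda>x y. triangle x", OF computable_n_triangle2]

lemma computable_n_prod_encode: "computable_n k F \<Longrightarrow> computable_n k G \<Longrightarrow> computable_n k (\<lambda>xs. prod_encode (F xs, G xs))"
  unfolding prod_encode_def by (auto intro!: computable_n_add computable_n_triangle[where H = "\<lambda>_. 0"] computable_n_const)

section \<open>Computability of the projections of the Cantor pairing\<close>

definition p1 :: "nat \<Rightarrow> nat" where "p1 n = fst (prod_decode n)"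
definition p2 :: "nat \<Rightarrow> nat" where "p2 n = snd (prod_decode n)"

lemma p1_encode [simp]: "p1 (prod_encode (a, b)) = a" by (simp add: p1_def)
lemma p2_encode [simp]: "p2 (prod_encode (a, b)) = b" by (simp add: p2_def)
lemma encode_p [simp]: "prod_encode (p1 n, p2 n) = n" by (simp add: p1_def p2_def)

text \<open>The antidiagonal on which \<open>z\<close> lies, that is, \<open>p1 z + p2 z\<close>. As
  a least zero it is computed by \<open>Mn\<close>, and both projections then follow by
  subtraction.\<close>

definition diag :: "nat \<Rightarrow> nat" where "diag z = (LEAST t. Suc z - triangle (Suc t) = 0)"

lemma diag_encode: "diag (prod_encode (m, n)) = m + n"
  unfolding diag_def prod_encode_def
proof (rule Least_equality)
  fix y assume *: "Suc ((case (m, n) of (m, n) \<Rightarrow> triangle (m + n) + m)) - triangle (Suc y) = 0"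
  have mono: "triangle a \<le> triangle b" if "a \<le> b" for a b
    using that by (induction rule: dec_induct) auto
  show "m + n \<le> y"
  proof (rule ccontr)
    assume "\<not> m + n \<le> y"
    then have "triangle (Suc y) \<le> triangle (m + n)" by (intro mono) auto
    with * show False by auto
  qed
qed auto

lemma computable_n_diag1: "computable_n 1 (\<lambda>xs. diag (xs ! 0))"
proof -
  have "computable_n 2 (\<lambda>xs. Suc (xs ! 1) - triangle (Suc (xs ! 0)))"
    by (intro computable_n_sub computable_n_Suc computable_n_triangle[where H = "\<lambda>_. 0"] computable_n_proj computable_n_const) auto
  then obtain r where r: "\<And>xs. length xs = 2 \<Longrightarrow> ev r xs (Suc (xs ! 1) - triangle (Suc (xs ! 0)))"
    by (auto simp: computable_n_def)
  have "ev (Mn r) xs (diag (xs ! 0))" if l: "length xs = 1" for xs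
  proof -
    obtain z where xs: "xs = [z]" using l by (auto simp: length_Suc_conv)
    have "z < triangle (Suc z)" by (induction z) auto
    then have "Suc z - triangle (Suc z) = 0" by simp
    moreover have "ev r (n # [z]) (Suc z - triangle (Suc n))" for n using r[of "[n, z]"] by simp
    ultimately have "ev (Mn r) [z] (LEAST t. Suc z - triangle (Suc t) = 0)" by (rule ev_mn_Least[where f = "\<lambda>t. Suc z - triangle (Suc t)", rotated])
    then show ?thesis by (simp only: diag_def xs nth_Cons_0)
  qed
  then show ?thesis unfolding computable_n_def by blast
qed

lemma p1_diag: "p1 z = z - triangle (diag z)" and p2_diag: "p2 z = diag z - p1 z"
proof -
  have "prod_encode (p1 z, p2 z) = triangle (p1 z + p2 z) + p1 z"
    by (simp only: prod_encode_def case_prod_conv)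
  with diag_encode[of "p1 z" "p2 z"] have "diag z = p1 z + p2 z" "z = triangle (p1 z + p2 z) + p1 z"
    by simp_all
  then show "p1 z = z - triangle (diag z)" "p2 z = diag z - p1 z" by simp_all
qed

section \<open>Unary computable functions and decidable predicates\<close>

definition computable :: "(nat \<Rightarrow> nat) \<Rightarrow> bool" where
  "computable f \<longleftrightarrow> computable_n 1 (\<lambda>xs. f (xs ! 0))"

lemma computable_cmpn: "computable f \<Longrightarrow> computable_n k G \<Longrightarrow> computable_n k (\<lambda>xs. f (G xs))"
  unfolding computable_def using computable_n_comp1[of "\<lambda>xs. f (xs ! 0)" k G] by simp

lemma computable_comp: "computable f \<Longrightarrow> computable g \<Longrightarrow> computable (\<lambda>x. f (g x))"
  using computable_cmpn unfolding computable_def by blast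

lemma computable_id: "computable (\<lambda>x. x)" unfolding computable_def by (rule computable_n_proj) simp
lemma computable_const: "computable (\<lambda>x. c)" unfolding computable_def by (rule computable_n_const)
lemma computable_Suc: "computable f \<Longrightarrow> computable (\<lambda>x. Suc (f x))" unfolding computable_def by (rule computable_n_Suc)
lemma computable_add: "computable f \<Longrightarrow> computable g \<Longrightarrow> computable (\<lambda>x. f x + g x)" unfolding computable_def by (rule computable_n_add)
lemma computable_mult: "computable f \<Longrightarrow> computable g \<Longrightarrow> computable (\<lambda>x. f x * g x)" unfolding computable_def by (rule computable_n_mult)
lemma computable_sub: "computable f \<Longrightarrow> computable g \<Longrightarrow> computable (\<lambda>x. f x - g x)" unfolding computable_def by (rule computable_n_sub)
lemma computable_pow: "computable f \<Longrightarrow> computable (\<lambda>x. 2 ^ f x)"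
  unfolding computable_def by (rule computable_n_pow[where H = "\<lambda>_. 0"]) (auto intro: computable_n_const)
lemma computable_encode: "computable f \<Longrightarrow> computable g \<Longrightarrow> computable (\<lambda>x. prod_encode (f x, g x))"
  unfolding computable_def by (rule computable_n_prod_encode)
lemma computable_p1: assumes "computable f" shows "computable (\<lambda>x. p1 (f x))"
proof -
  have "computable_n 1 (\<lambda>xs. xs ! 0 - triangle (diag (xs ! 0)))"
    by (intro computable_n_sub computable_n_triangle[where H = "\<lambda>_. 0"] computable_n_diag1 computable_n_proj computable_n_const) simp
  then have "computable p1" unfolding computable_def p1_diag .
  then show ?thesis using assms by (rule computable_comp)
qed

lemma computable_p2: assumes "computable f" shows "computable (\<lambda>x. p2 (f x))"
proof -
  have "computable_n 1 (\<lambda>xs. diag (xs ! 0) - p1 (xs ! 0))"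
    using computable_p1[OF computable_id] unfolding computable_def by (intro computable_n_sub computable_n_diag1)
  then have "computable p2" unfolding computable_def p2_diag .
  then show ?thesis using assms by (rule computable_comp)
qed

lemma computable_rec:
  assumes "computable b" "computable g" "computable h"
  shows "computable (\<lambda>x. rec_nat (g x) (\<lambda>n z. h (prod_encode (z, prod_encode (n, x)))) (b x))"
proof -
  have "computable_n 2 (\<lambda>xs. rec_nat (g (xs ! 1)) (\<lambda>n z. h (prod_encode (z, prod_encode (n, xs ! 1)))) (xs ! 0))"
  proof (rule computable_n_rec2[where g = g and h = "\<lambda>z n x. h (prod_encode (z, prod_encode (n, x)))"])
    show "computable_n 1 (\<lambda>xs. g (xs ! 0))" using assms(2) by (simp only: computable_def)
    show "computable_n 3 (\<lambda>xs. h (prod_encode (xs ! 0, prod_encode (xs ! 1, xs ! 2))))"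
      by (intro computable_cmpn[OF assms(3)] computable_n_prod_encode computable_n_proj) simp_all
  qed simp_all
  then have "computable_n 1 (\<lambda>xs. rec_nat (g (xs ! 0)) (\<lambda>n z. h (prod_encode (z, prod_encode (n, xs ! 0)))) (b (xs ! 0)))"
    by (rule computable_n_op2[where f = "\<lambda>b x. rec_nat (g x) (\<lambda>n z. h (prod_encode (z, prod_encode (n, x)))) b"])
      (use assms in \<open>auto simp: computable_def[symmetric] intro: computable_cmpn computable_n_proj\<close>)
  then show ?thesis by (simp add: computable_def)
qed

definition decidable :: "(nat \<Rightarrow> bool) \<Rightarrow> bool" where
  "decidable P \<longleftrightarrow> computable (\<lambda>x. if P x then 1 else 0)"

lemma decidable_not: "decidable P \<Longrightarrow> decidable (\<lambda>x. \<not> P x)"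
proof -
  assume "decidable P"
  then have "computable (\<lambda>x. 1 - (if P x then 1 else 0))" unfolding decidable_def by (intro computable_sub computable_const)
  moreover have "(\<lambda>x. 1 - (if P x then 1 else (0::nat))) = (\<lambda>x. if \<not> P x then 1 else 0)" by auto
  ultimately show ?thesis unfolding decidable_def by simp
qed

lemma decidable_conj: "decidable P \<Longrightarrow> decidable Q \<Longrightarrow> decidable (\<lambda>x. P x \<and> Q x)"
proof -
  assume "decidable P" "decidable Q"
  then have "computable (\<lambda>x. (if P x then 1 else 0) * (if Q x then 1 else 0))" unfolding decidable_def by (rule computable_mult)
  moreover have "(\<lambda>x. (if P x then 1 else 0) * (if Q x then 1 else (0::nat))) = (\<lambda>x. if P x \<and> Q x then 1 else 0)"
    by auto
  ultimately show ?thesis unfolding decidable_def by simp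
qed

lemma decidable_disj: assumes "decidable P" "decidable Q" shows "decidable (\<lambda>x. P x \<or> Q x)"
  using decidable_not[OF decidable_conj[OF assms[THEN decidable_not]]] by simp

lemma decidable_imp: assumes "decidable P" "decidable Q" shows "decidable (\<lambda>x. P x \<longrightarrow> Q x)"
  unfolding imp_conv_disj using assms by (intro decidable_disj decidable_not)

lemma decidable_iff: assumes "decidable P" "decidable Q" shows "decidable (\<lambda>x. P x \<longleftrightarrow> Q x)"
  unfolding iff_conv_conj_imp using assms by (intro decidable_conj decidable_imp)

lemma decidable_le: "computable f \<Longrightarrow> computable g \<Longrightarrow> decidable (\<lambda>x. f x \<le> g x)"
proof -
  assume "computable f" "computable g"
  then have "computable (\<lambda>x. 1 - (f x - g x))" by (intro computable_sub computable_const)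
  moreover have "(\<lambda>x. 1 - (f x - g x)) = (\<lambda>x. if f x \<le> g x then 1 else 0)" by auto
  ultimately show ?thesis unfolding decidable_def by simp
qed

lemma decidable_less: assumes "computable f" "computable g" shows "decidable (\<lambda>x. f x < g x)"
  unfolding Suc_le_eq[symmetric] using assms by (intro decidable_le computable_Suc)

lemma decidable_eq: assumes "computable f" "computable g" shows "decidable (\<lambda>x. f x = g x)"
  unfolding eq_iff using assms by (intro decidable_conj decidable_le)

lemma decidable_sub: "decidable P \<Longrightarrow> computable f \<Longrightarrow> decidable (\<lambda>x. P (f x))"
  unfolding decidable_def by (rule computable_comp)

lemma decidable_ball:
  assumes "computable b" "decidable (\<lambda>z. P (p2 z) (p1 z))"
  shows "decidable (\<lambda>x. \<forall>y<b x. P x y)"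
proof -
  let ?c = "\<lambda>z. if P (p2 z) (p1 z) then 1 else 0"
  have "computable (\<lambda>u. p1 u * ?c (p2 u))"
    by (intro computable_mult computable_p1 computable_id computable_p2 computable_comp[OF assms(2)[unfolded decidable_def]])
  from computable_rec[OF assms(1) computable_const[of 1] this]
  have "computable (\<lambda>x. rec_nat 1 (\<lambda>n z. z * (if P x n then 1 else 0)) (b x))" by simp
  moreover have "rec_nat 1 (\<lambda>n z. z * (if P x n then 1 else 0)) m = (if \<forall>y<m. P x y then 1 else (0::nat))" for x m
    by (induction m) (auto simp: less_Suc_eq)
  ultimately show ?thesis unfolding decidable_def by simp
qed

lemma decidable_bex:
  assumes "computable b" "decidable (\<lambda>z. P (p2 z) (p1 z))" shows "decidable (\<lambda>x. \<exists>y<b x. P x y)"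
  using decidable_not[OF decidable_ball[OF assms(1) decidable_not[OF assms(2)]]] by simp

text \<open>Bit \<open>x\<close> of \<open>n\<close> is set iff \<open>n div 2 ^ x\<close> is odd.
  With quotient and remainder as bounded witnesses, membership in a coded finite set falls under
  \<open>decidable_bex\<close>.\<close>

lemma set_decode_iff: "x \<in> set_decode n \<longleftrightarrow> (\<exists>q<Suc n. \<exists>r<2 ^ x. n = (2 * q + 1) * 2 ^ x + r)"
proof
  assume "x \<in> set_decode n"
  then have "odd (n div 2 ^ x)" by (simp add: set_decode_def)
  then obtain q where q: "n div 2 ^ x = 2 * q + 1" by (elim oddE)
  have "n = (2 * q + 1) * 2 ^ x + n mod 2 ^ x" using q by (metis div_mult_mod_eq)
  moreover have "q < Suc n" using q div_le_dividend[of n "2 ^ x"] by linarith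
  ultimately show "\<exists>q<Suc n. \<exists>r<2 ^ x. n = (2 * q + 1) * 2 ^ x + r"
    by (metis mod_less_divisor zero_less_numeral zero_less_power)
next
  assume "\<exists>q<Suc n. \<exists>r<2 ^ x. n = (2 * q + 1) * 2 ^ x + r"
  then obtain q r where r: "r < 2 ^ x" "n = (2 * q + 1) * 2 ^ x + r" by blast
  then have "n div 2 ^ x = 2 * q + 1" by (simp only: div_mult_self3) simp
  then show "x \<in> set_decode n" by (simp add: set_decode_def)
qed

lemma decidable_mem: assumes "computable f" "computable g" shows "decidable (\<lambda>x. f x \<in> set_decode (g x))"
  unfolding set_decode_iff
  by (intro decidable_bex decidable_eq computable_add computable_mult computable_const computable_pow computable_Suc computable_p1 computable_p2 computable_id
      computable_comp[OF assms(1)] computable_comp[OF assms(2)])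

lemma set_decode_less: "x \<in> set_decode n \<Longrightarrow> x < n"
proof -
  assume "x \<in> set_decode n"
  then have "n div 2 ^ x \<noteq> 0" by (auto simp: set_decode_def intro: gr0I)
  then have "2 ^ x \<le> n" by (metis div_less linorder_not_le)
  then show ?thesis by (meson less_exp less_le_trans)
qed

section \<open>Semidecidable predicates and Post's theorem\<close>

definition semidecidable :: "(nat \<Rightarrow> bool) \<Rightarrow> bool" where
  "semidecidable P \<longleftrightarrow> (\<exists>Q. decidable Q \<and> (\<forall>x. P x \<longleftrightarrow> (\<exists>y. Q (prod_encode (y, x)))))"

lemma reE:
  assumes "semidecidable P" obtains Q where "decidable Q" "\<And>x. P x \<longleftrightarrow> (\<exists>y. Q (prod_encode (y, x)))"
  using assms unfolding semidecidable_def by blast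

lemma reI: "decidable Q \<Longrightarrow> (\<And>x. P x \<longleftrightarrow> (\<exists>y. Q (prod_encode (y, x)))) \<Longrightarrow> semidecidable P"
  unfolding semidecidable_def by blast

lemma semidecidable_cdp: assumes "decidable P" shows "semidecidable P"
  by (rule reI[of "\<lambda>z. P (p2 z)"]) (simp_all add: decidable_sub[OF assms] computable_p2 computable_id)

lemma semidecidable_sub: "semidecidable P \<Longrightarrow> computable f \<Longrightarrow> semidecidable (\<lambda>x. P (f x))"
proof (elim reE)
  fix Q assume *: "computable f" "decidable Q" "\<And>x. P x = (\<exists>y. Q (prod_encode (y, x)))"
  show "semidecidable (\<lambda>x. P (f x))"
    by (rule reI[of "\<lambda>z. Q (prod_encode (p1 z, f (p2 z)))"])
      (auto simp: *(3) intro!: decidable_sub[OF *(2)] computable_encode computable_p1 computable_p2 computable_id computable_comp[OF *(1)])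
qed

lemma semidecidable_ex:
  assumes "semidecidable (\<lambda>z. P (p2 z) (p1 z))" shows "semidecidable (\<lambda>x. \<exists>y. P x y)"
  using assms
proof (elim reE)
  fix Q assume *: "decidable Q" "\<And>x. P (p2 x) (p1 x) = (\<exists>y. Q (prod_encode (y, x)))"
  have P: "P x y \<longleftrightarrow> (\<exists>u. Q (prod_encode (u, prod_encode (y, x))))" for x y
    using *(2)[of "prod_encode (y, x)"] by simp
  show ?thesis
    by (rule reI[of "\<lambda>z. Q (prod_encode (p1 (p1 z), prod_encode (p2 (p1 z), p2 z)))"])
      (auto simp: P intro!: decidable_sub[OF *(1)] computable_encode computable_p1 computable_p2 computable_id, metis p1_encode p2_encode)
qed

lemma semidecidable_disj: "semidecidable P \<Longrightarrow> semidecidable Q \<Longrightarrow> semidecidable (\<lambda>x. P x \<or> Q x)"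
proof (elim reE)
  fix P' Q' assume *: "decidable P'" "\<And>x. P x = (\<exists>y. P' (prod_encode (y, x)))"
    "decidable Q'" "\<And>x. Q x = (\<exists>y. Q' (prod_encode (y, x)))"
  show ?thesis
    by (rule reI[of "\<lambda>z. P' z \<or> Q' z"]) (auto simp: * intro!: decidable_disj)
qed

lemma semidecidable_conj: "semidecidable P \<Longrightarrow> semidecidable Q \<Longrightarrow> semidecidable (\<lambda>x. P x \<and> Q x)"
proof (elim reE)
  fix P' Q' assume *: "decidable P'" "\<And>x. P x = (\<exists>y. P' (prod_encode (y, x)))"
    "decidable Q'" "\<And>x. Q x = (\<exists>y. Q' (prod_encode (y, x)))"
  show ?thesis
    by (rule reI[of "\<lambda>z. P' (prod_encode (p1 (p1 z), p2 z)) \<and> Q' (prod_encode (p2 (p1 z), p2 z))"])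
      (auto simp: * intro!: decidable_conj decidable_sub[OF *(1)] decidable_sub[OF *(3)] computable_encode computable_p1 computable_p2 computable_id,
        metis p1_encode p2_encode)
qed

text \<open>Finitely many witnesses have a common bound, so the unbounded search can be moved in
  front of the bounded quantifier and becomes a search for that bound.\<close>

lemma semidecidable_ball:
  assumes "computable b" "semidecidable (\<lambda>z. P (p2 z) (p1 z))" shows "semidecidable (\<lambda>x. \<forall>y<b x. P x y)"
  using assms(2)
proof (elim reE)
  fix Q assume *: "decidable Q" "\<And>x. P (p2 x) (p1 x) = (\<exists>y. Q (prod_encode (y, x)))"
  have P: "P x y \<longleftrightarrow> (\<exists>u. Q (prod_encode (u, prod_encode (y, x))))" for x y
    using *(2)[of "prod_encode (y, x)"] by simp
  have collect: "(\<forall>y<m. \<exists>u. R y u) \<longleftrightarrow> (\<exists>b. \<forall>y<m. \<exists>u<b. R y u)" for m :: nat and R :: "nat \<Rightarrow> nat \<Rightarrow> bool"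
  proof (induction m)
    case (Suc m)
    show ?case
    proof
      assume *: "\<forall>y<Suc m. \<exists>u. R y u"
      then obtain b where b: "\<forall>y<m. \<exists>u<b. R y u" using Suc by auto
      obtain u where "R m u" using * by blast
      then have "\<forall>y<Suc m. \<exists>v<max b (Suc u). R y v"
        using b by (auto simp: less_Suc_eq less_max_iff_disj)
      then show "\<exists>b. \<forall>y<Suc m. \<exists>u<b. R y u" by blast
    qed blast
  qed simp
  show ?thesis
  proof (rule reI[of "\<lambda>z. \<forall>y<b (p2 z). \<exists>u<p1 z. Q (prod_encode (u, prod_encode (y, p2 z)))"])
    show "decidable (\<lambda>z. \<forall>y<b (p2 z). \<exists>u<p1 z. Q (prod_encode (u, prod_encode (y, p2 z))))"
      by (intro decidable_ball decidable_bex decidable_sub[OF *(1)] computable_encode computable_p1 computable_p2 computable_id computable_comp[OF assms(1)])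
    show "(\<forall>y<b x. P x y) \<longleftrightarrow> (\<exists>u. \<forall>y<b (p2 (prod_encode (u, x))). \<exists>v<p1 (prod_encode (u, x)).
        Q (prod_encode (v, prod_encode (y, p2 (prod_encode (u, x))))))" for x
      unfolding P p1_encode p2_encode by (rule collect)
  qed
qed

text \<open>Both searches run in parallel until one succeeds. The two predicates are complementary
  on \<open>X\<close> only; outside \<open>X\<close> the search may diverge.\<close>

lemma semidecidable_Post:
  assumes "semidecidable P" "semidecidable Q" "\<And>x. x \<in> X \<Longrightarrow> P x \<longleftrightarrow> \<not> Q x"
  shows "\<exists>r. \<forall>x\<in>X. ev r [x] (if P x then 1 else 0)"
proof -
  obtain P' where P: "decidable P'" "\<And>x. P x = (\<exists>y. P' (prod_encode (y, x)))" using assms(1) unfolding semidecidable_def by blast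
  obtain Q' where Q: "decidable Q'" "\<And>x. Q x = (\<exists>y. Q' (prod_encode (y, x)))" using assms(2) unfolding semidecidable_def by blast
  let ?f = "\<lambda>z. if \<not> (P' z \<or> Q' z) then 1 else (0::nat)"
  have "computable ?f" using decidable_not[OF decidable_disj[OF P(1) Q(1)]] by (simp add: decidable_def)
  then have "computable_n 2 (\<lambda>xs. ?f (prod_encode (xs ! 0, xs ! 1)))"
    by (rule computable_cmpn) (auto intro!: computable_n_prod_encode computable_n_proj)
  then obtain r where r: "\<And>xs. length xs = 2 \<Longrightarrow> ev r xs (?f (prod_encode (xs ! 0, xs ! 1)))"
    unfolding computable_n_def by blast
  have "computable_n 2 (\<lambda>xs. (\<lambda>z. if P' z then 1 else 0) (prod_encode (xs ! 0, xs ! 1)))"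
    by (rule computable_cmpn[OF P(1)[unfolded decidable_def]]) (auto intro!: computable_n_prod_encode computable_n_proj)
  then obtain s where s: "\<And>xs. length xs = 2 \<Longrightarrow> ev s xs (if P' (prod_encode (xs ! 0, xs ! 1)) then 1 else 0)"
    unfolding computable_n_def by blast
  \<comment> \<open>\<open>Mn r\<close> finds the least number that witnesses \<open>P\<close> or
    \<open>Q\<close>, and \<open>s\<close> tests whether it witnesses \<open>P\<close>.\<close>
  have "ev (Comp s [Mn r, Proj 0]) [x] (if P x then 1 else 0)" if x: "x \<in> X" for x
  proof -
    let ?m = "LEAST n. ?f (prod_encode (n, x)) = 0"
    obtain n where "P' (prod_encode (n, x)) \<or> Q' (prod_encode (n, x))"
      using assms(3)[OF x] P(2) Q(2) by blast
    then have n: "?f (prod_encode (n, x)) = 0" by simp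
    have "ev r (n # [x]) (?f (prod_encode (n, x)))" for n using r[of "[n, x]"] by simp
    then have m: "ev (Mn r) [x] ?m" using n by (rule ev_mn_Least)
    have "?f (prod_encode (?m, x)) = 0" using n by (rule LeastI)
    then have "P' (prod_encode (?m, x)) \<longleftrightarrow> P x"
      using assms(3)[OF x] P(2) Q(2) by (auto split: if_splits)
    then show ?thesis
      using s[of "[?m, x]"] m ev_proj[of 0 "[x]"] by (intro ev_comp[where ys = "[?m, x]"]) auto
  qed
  then show ?thesis by blast
qed

section \<open>Inductively generated sets of numbers\<close>

inductive lfpr :: "(nat \<Rightarrow> bool) \<Rightarrow> (nat \<Rightarrow> nat \<Rightarrow> nat \<Rightarrow> bool) \<Rightarrow> nat \<Rightarrow> bool" for A R where
  lfpr_ax: "A x \<Longrightarrow> lfpr A R x"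
| lfpr_rule: "R x y z \<Longrightarrow> lfpr A R y \<Longrightarrow> lfpr A R z \<Longrightarrow> lfpr A R x"

text \<open>A derivation is a finite set of pairs \<open>(i, x)\<close>, where the rank \<open>i\<close> bounds the height of a
  derivation of \<open>x\<close>.\<close>

definition justif :: "(nat \<Rightarrow> bool) \<Rightarrow> (nat \<Rightarrow> nat \<Rightarrow> nat \<Rightarrow> bool) \<Rightarrow> nat \<Rightarrow> nat \<Rightarrow> bool" where
  "justif A R s e \<longleftrightarrow> A (p2 e) \<or> (\<exists>y z. (y \<in> set_decode s \<and> p1 y < p1 e) \<and>
     (z \<in> set_decode s \<and> p1 z < p1 e) \<and> R (p2 e) (p2 y) (p2 z))"

text \<open>The right-hand side is a search for a coded set whose members are checked one by one.
  The bound \<open>e<s\<close> is harmless because members of a coded set lie below its code, and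
  \<open>justif\<close> is monotone in the set, so derivations of two premises can be merged by
  union.\<close>

lemma lfpr_iff:
  "lfpr A R x \<longleftrightarrow> (\<exists>s. \<exists>e. e \<in> set_decode s \<and> p2 e = x \<and> (\<forall>e<s. e \<notin> set_decode s \<or> justif A R s e))"
proof
  assume "lfpr A R x"
  then show "\<exists>s. \<exists>e. e \<in> set_decode s \<and> p2 e = x \<and> (\<forall>e<s. e \<notin> set_decode s \<or> justif A R s e)"
  proof induction
    case (lfpr_ax x)
    obtain s where s: "set_decode s = {prod_encode (0, x)}"
      using set_encode_inverse[of "{prod_encode (0, x)}"] by auto
    have "justif A R s (prod_encode (0, x))" using lfpr_ax unfolding justif_def by simp
    then have "prod_encode (0, x) \<in> set_decode s" "p2 (prod_encode (0, x)) = x"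
      "\<forall>e<s. e \<notin> set_decode s \<or> justif A R s e" unfolding s by simp_all
    then show ?case by blast
  next
    case (lfpr_rule x y z)
    obtain s d where s: "d \<in> set_decode s" "p2 d = y" "\<forall>e<s. e \<notin> set_decode s \<or> justif A R s e"
      using lfpr_rule.IH(1) by blast
    obtain t e where t: "e \<in> set_decode t" "p2 e = z" "\<forall>e<t. e \<notin> set_decode t \<or> justif A R t e"
      using lfpr_rule.IH(2) by blast
    \<comment> \<open>The rank of the conclusion exceeds the ranks of both premises, which rules out
      circular justification in the converse direction.\<close>
    obtain w where w: "p1 w = Suc (max (p1 d) (p1 e))" "p2 w = x"
      by (rule that[of "prod_encode (Suc (max (p1 d) (p1 e)), x)"]) simp_all
    obtain u where u: "set_decode u = insert w (set_decode s \<union> set_decode t)"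
      by (rule that[OF set_encode_inverse]) simp
    have "justif A R u g" if g: "g \<in> set_decode u" for g
    proof -
      consider "g = w" | "g \<in> set_decode s" | "g \<in> set_decode t" using g u by blast
      then show ?thesis
      proof cases
        case 1
        have "d \<in> set_decode u \<and> p1 d < p1 g" "e \<in> set_decode u \<and> p1 e < p1 g"
          using s(1) t(1) w(1) u 1 by simp_all
        moreover have "R (p2 g) (p2 d) (p2 e)" using lfpr_rule(1) s(2) t(2) w(2) 1 by simp
        ultimately show ?thesis unfolding justif_def by blast
      next
        case 2
        then have "justif A R s g" using s set_decode_less by blast
        then show ?thesis unfolding justif_def u by blast
      next
        case 3
        then have "justif A R t g" using t set_decode_less by blast
        then show ?thesis unfolding justif_def u by blast
      qed
    qed
    moreover have "w \<in> set_decode u" using u by simp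
    ultimately show ?case using w(2) by blast
  qed
next
  assume "\<exists>s. \<exists>e. e \<in> set_decode s \<and> p2 e = x \<and> (\<forall>e<s. e \<notin> set_decode s \<or> justif A R s e)"
  then obtain s e where e: "e \<in> set_decode s" "p2 e = x" "\<forall>e<s. e \<notin> set_decode s \<or> justif A R s e"
    by blast
  have "lfpr A R (p2 g)" if "g \<in> set_decode s" for g
    using that
  proof (induction "p1 g" arbitrary: g rule: less_induct)
    case less
    then have "justif A R s g" using e set_decode_less by blast
    then show ?case unfolding justif_def
    proof (elim disjE exE conjE)
      fix y z assume "y \<in> set_decode s" "p1 y < p1 g" "z \<in> set_decode s" "p1 z < p1 g"
        and r: "R (p2 g) (p2 y) (p2 z)"
      then have "lfpr A R (p2 y)" "lfpr A R (p2 z)" using less.hyps by blast+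
      with r show "lfpr A R (p2 g)" by (rule lfpr_rule)
    qed (rule lfpr_ax)
  qed
  then show "lfpr A R x" using e by blast
qed

lemmas computable_intros = computable_const computable_id computable_p1 computable_p2 computable_encode computable_Suc

lemma semidecidable_lfpr:
  assumes "semidecidable A" "semidecidable (\<lambda>z. R (p1 z) (p1 (p2 z)) (p2 (p2 z)))"
  shows "semidecidable (lfpr A R)"
proof -
  have R: "semidecidable (\<lambda>x. R (f x) (g x) (h x))" if "computable f" "computable g" "computable h" for f g h
    using semidecidable_sub[OF assms(2), of "\<lambda>x. prod_encode (f x, prod_encode (g x, h x))"] that
    by (simp add: computable_encode)
  have "lfpr A R = (\<lambda>x. \<exists>s. \<exists>e. e \<in> set_decode s \<and> p2 e = x \<and> (\<forall>e<s. e \<notin> set_decode s \<or> justif A R s e))"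
    by (rule ext) (rule lfpr_iff)
  then show ?thesis
    unfolding justif_def
    by (simp only:) (intro semidecidable_ex semidecidable_conj semidecidable_ball semidecidable_disj semidecidable_cdp[OF decidable_mem] semidecidable_cdp[OF decidable_not[OF decidable_mem]]
        semidecidable_cdp[OF decidable_eq] semidecidable_cdp[OF decidable_less] computable_intros R semidecidable_sub[OF assms(1)])
qed

section \<open>Prime theories\<close>

text \<open>Local consequence: necessitation acts on theorems only and never on members of
  \<open>\<Gamma>\<close>. This is what makes the deduction theorem hold.\<close>

inductive cons :: "(form \<Rightarrow> bool) \<Rightarrow> form set \<Rightarrow> form \<Rightarrow> bool" for Ax \<Gamma> where
  cons_ass: "A \<in> \<Gamma> \<Longrightarrow> cons Ax \<Gamma> A"
| cons_thm: "deriv Ax A \<Longrightarrow> cons Ax \<Gamma> A"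
| cons_mp: "cons Ax \<Gamma> (Imp A B) \<Longrightarrow> cons Ax \<Gamma> A \<Longrightarrow> cons Ax \<Gamma> B"

lemma cons_mono: "cons Ax \<Gamma> A \<Longrightarrow> \<Gamma> \<subseteq> \<Delta> \<Longrightarrow> cons Ax \<Delta> A"
proof (induction rule: cons.induct)
  case (cons_mp A B)
  then show ?case using cons.cons_mp by blast
qed (blast intro: cons_ass cons_thm)+

lemma deriv_id: "deriv Ax (Imp A A)"
  using mp[OF mp[OF ax_s[of Ax A "Imp A A" A] ax_k1] ax_k1] .

lemma cons_ded:
  assumes "cons Ax (insert A \<Gamma>) B" shows "cons Ax \<Gamma> (Imp A B)"
  using assms
proof induction
  case (cons_ass B)
  show ?case
  proof (cases "B = A")
    case True
    then show ?thesis by (simp add: cons_thm deriv_id)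
  next
    case False
    then have "cons Ax \<Gamma> B" using cons_ass by (auto intro: cons.cons_ass)
    then show ?thesis using cons_mp cons_thm ax_k1 by metis
  qed
next
  case (cons_thm B)
  then have "deriv Ax (Imp A B)" using mp ax_k1 by metis
  then show ?case by (rule cons.cons_thm)
next
  case (cons_mp B C)
  have "cons Ax \<Gamma> (Imp (Imp A B) (Imp A C))"
    using cons.cons_mp[OF cons.cons_thm[OF ax_s] cons_mp.IH(1)] .
  then show ?case using cons_mp.IH(2) by (rule cons.cons_mp)
qed

lemma cons_deduct: "cons Ax (insert A \<Gamma>) B \<longleftrightarrow> cons Ax \<Gamma> (Imp A B)"
proof
  assume "cons Ax \<Gamma> (Imp A B)"
  then have "cons Ax (insert A \<Gamma>) (Imp A B)" by (rule cons_mono) auto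
  then show "cons Ax (insert A \<Gamma>) B" by (rule cons_mp) (simp add: cons_ass)
qed (rule cons_ded)

lemma cons_empty: "cons Ax {} A \<longleftrightarrow> deriv Ax A"
proof
  show "cons Ax {} A \<Longrightarrow> deriv Ax A"
  proof (induction rule: cons.induct)
    case (cons_mp A B)
    then show ?case using mp by blast
  qed simp_all
qed (rule cons_thm)

lemma cons_Union_chain:
  assumes "cons Ax (\<Union>C) A" "C \<noteq> {}" "subset.chain S C"
  shows "\<exists>D\<in>C. cons Ax D A"
  using assms(1)
proof induction
  case (cons_mp A B)
  then obtain D E where DE: "D \<in> C" "cons Ax D (Imp A B)" "E \<in> C" "cons Ax E A" by blast
  then have "D \<subseteq> E \<or> E \<subseteq> D" using assms(3) by (auto simp: subset.chain_def)
  then show ?case using DE by (meson cons.cons_mp cons_mono)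
qed (use assms(2) in \<open>blast intro: cons_ass cons_thm\<close>)+

definition prime_th :: "(form \<Rightarrow> bool) \<Rightarrow> form set \<Rightarrow> bool" where
  "prime_th Ax w \<longleftrightarrow> (\<forall>A. cons Ax w A \<longrightarrow> A \<in> w) \<and> Bot \<notin> w \<and> (\<forall>A B. Or A B \<in> w \<longrightarrow> A \<in> w \<or> B \<in> w)"

lemma Lindenbaum:
  assumes "\<not> cons Ax \<Gamma> A"
  obtains w where "prime_th Ax w" "\<Gamma> \<subseteq> w" "A \<notin> w"
proof -
  define S where "S = {\<Delta>. \<Gamma> \<subseteq> \<Delta> \<and> \<not> cons Ax \<Delta> A}"
  have "\<exists>w\<in>S. \<forall>v\<in>S. w \<subseteq> v \<longrightarrow> v = w"
  proof (rule subset_Zorn_nonempty)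
    show "S \<noteq> {}" using assms by (auto simp: S_def)
    fix C assume C: "C \<noteq> {}" "subset.chain S C"
    then have D: "\<Gamma> \<subseteq> D" "\<not> cons Ax D A" if "D \<in> C" for D
      using that by (auto simp: subset.chain_def S_def)
    have "\<not> cons Ax (\<Union>C) A" using cons_Union_chain[OF _ C] D(2) by metis
    moreover have "\<Gamma> \<subseteq> \<Union>C" using C(1) D(1) by fast
    ultimately show "\<Union>C \<in> S" by (simp add: S_def)
  qed
  then obtain w where "w \<in> S" and max: "\<forall>v\<in>S. w \<subseteq> v \<longrightarrow> v = w" by (rule bexE)
  then have w: "\<Gamma> \<subseteq> w" "\<not> cons Ax w A" by (auto simp: S_def)
  \<comment> \<open>By maximality every formula outside \<open>w\<close> already implies
    \<open>A\<close> over \<open>w\<close>. Deductive closure and primeness both follow from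
    this.\<close>
  have in_w: "B \<in> w \<or> cons Ax w (Imp B A)" for B
  proof (cases "cons Ax (insert B w) A")
    case True
    then show ?thesis by (simp add: cons_ded)
  next
    case False
    then have "insert B w \<in> S" using w(1) by (auto simp: S_def)
    then have "insert B w = w" using max by (metis subset_insertI)
    then show ?thesis by blast
  qed
  have closed: "B \<in> w" if "cons Ax w B" for B
    using in_w[of B] cons_mp[OF _ that] w(2) by metis
  have "Bot \<notin> w" using cons_mp[OF cons_thm[OF ax_bot[of Ax A]] cons_ass] w(2) by metis
  moreover have "B \<in> w \<or> C \<in> w" if "Or B C \<in> w" for B C
  proof (rule ccontr)
    assume "\<not> (B \<in> w \<or> C \<in> w)"
    then have "cons Ax w (Imp B A)" "cons Ax w (Imp C A)" using in_w by metis+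
    then have "cons Ax w (Imp (Or B C) A)" by (rule cons_mp[OF cons_mp[OF cons_thm[OF ax_orE]]])
    then show False using w(2) cons_mp[OF _ cons_ass[OF that]] by metis
  qed
  moreover have "A \<notin> w" using w(2) cons_ass by metis
  ultimately show thesis using closed w(1) by (intro that[of w]) (simp_all add: prime_th_def)
qed

lemma prime_th_thm: "prime_th Ax w \<Longrightarrow> deriv Ax A \<Longrightarrow> A \<in> w"
  by (simp add: prime_th_def cons_thm)

lemma prime_th_mp: assumes "prime_th Ax w" "Imp A B \<in> w" "A \<in> w" shows "B \<in> w"
  using assms(1) cons_mp[OF cons_ass[OF assms(2)] cons_ass[OF assms(3)]] by (simp add: prime_th_def)

lemma prime_th_thm_mp: "prime_th Ax w \<Longrightarrow> deriv Ax (Imp A B) \<Longrightarrow> A \<in> w \<Longrightarrow> B \<in> w"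
  by (rule prime_th_mp[OF _ prime_th_thm])

lemma prime_th_cons: "prime_th Ax w \<Longrightarrow> cons Ax w A \<longleftrightarrow> A \<in> w"
  by (auto simp: prime_th_def cons_ass)

lemma prime_th_Bot: "prime_th Ax w \<Longrightarrow> Bot \<notin> w"
  by (simp add: prime_th_def)

lemma prime_th_And: assumes "prime_th Ax w" shows "And A B \<in> w \<longleftrightarrow> A \<in> w \<and> B \<in> w"
  using prime_th_thm_mp[OF assms ax_and1, of A B] prime_th_thm_mp[OF assms ax_and2, of A B]
    prime_th_mp[OF assms prime_th_thm_mp[OF assms ax_andI], of A B] by metis

lemma prime_th_Or: assumes "prime_th Ax w" shows "Or A B \<in> w \<longleftrightarrow> A \<in> w \<or> B \<in> w"
  using prime_th_thm_mp[OF assms ax_or1, of A B] prime_th_thm_mp[OF assms ax_or2, of B A] assms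
  by (auto simp: prime_th_def)

lemma prime_th_Imp: "prime_th Ax w \<Longrightarrow> Imp A B \<in> w \<longleftrightarrow> (\<forall>v. prime_th Ax v \<longrightarrow> w \<subseteq> v \<longrightarrow> A \<in> v \<longrightarrow> B \<in> v)"
proof
  assume w: "prime_th Ax w" and *: "\<forall>v. prime_th Ax v \<longrightarrow> w \<subseteq> v \<longrightarrow> A \<in> v \<longrightarrow> B \<in> v"
  have "cons Ax (insert A w) B"
  proof (rule ccontr)
    assume "\<not> cons Ax (insert A w) B"
    then obtain v where "prime_th Ax v" "insert A w \<subseteq> v" "B \<notin> v" by (rule Lindenbaum)
    with * show False by blast
  qed
  then show "Imp A B \<in> w" using w by (simp add: cons_deduct prime_th_cons)
next
  assume "Imp A B \<in> w"
  then show "\<forall>v. prime_th Ax v \<longrightarrow> w \<subseteq> v \<longrightarrow> A \<in> v \<longrightarrow> B \<in> v" by (auto dest: prime_th_mp)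
qed

text \<open>Together with the membership clauses this replaces Hilbert-style derivations by
  reasoning about prime theories, the method used in most of what follows.\<close>

lemma deriv_pt: "deriv Ax A \<longleftrightarrow> (\<forall>w. prime_th Ax w \<longrightarrow> A \<in> w)"
proof
  assume *: "\<forall>w. prime_th Ax w \<longrightarrow> A \<in> w"
  have "cons Ax {} A"
  proof (rule ccontr)
    assume "\<not> cons Ax {} A"
    then obtain v where "prime_th Ax v" "A \<notin> v" by (rule Lindenbaum)
    with * show False by blast
  qed
  then show "deriv Ax A" by (simp add: cons_empty)
qed (simp add: prime_th_thm)

lemma prime_th_Top: "prime_th Ax w \<Longrightarrow> Top \<in> w"
  by (rule prime_th_thm) (auto simp: Top_def deriv_id)

lemma prime_th_Box_thm: "prime_th Ax w \<Longrightarrow> deriv Ax (Imp A B) \<Longrightarrow> Box A \<in> w \<Longrightarrow> Box B \<in> w"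
  by (rule prime_th_thm_mp[OF _ mp[OF ax_K nec]])

lemma prime_th_Box4: "prime_th Ax w \<Longrightarrow> Box A \<in> w \<Longrightarrow> Box (Box A) \<in> w"
  by (rule prime_th_thm_mp[OF _ ax_4])

lemma prime_th_Box_mp: "prime_th Ax w \<Longrightarrow> Box (Imp A B) \<in> w \<Longrightarrow> Box A \<in> w \<Longrightarrow> Box B \<in> w"
  by (rule prime_th_mp[OF _ prime_th_thm_mp[OF _ ax_K]])

lemma deriv_Imp: "deriv Ax (Imp A B) \<longleftrightarrow> (\<forall>w. prime_th Ax w \<longrightarrow> A \<in> w \<longrightarrow> B \<in> w)"
  unfolding deriv_pt by (auto simp: prime_th_Imp)

lemma prime_th_Box_And: assumes "prime_th Ax w" shows "Box (And A B) \<in> w \<longleftrightarrow> Box A \<in> w \<and> Box B \<in> w"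
  using prime_th_Box_thm[OF assms ax_and1, of A B] prime_th_Box_thm[OF assms ax_and2, of A B]
    prime_th_Box_mp[OF assms prime_th_Box_thm[OF assms ax_andI], of A B] by metis

lemma deriv_mono:
  assumes "deriv Ax A" "\<And>A. Ax A \<Longrightarrow> deriv Ax' A" shows "deriv Ax' A"
  using assms(1)
proof (induction rule: deriv.induct)
  case (mp A B)
  show ?case using mp.IH by (rule deriv.mp)
qed (fact assms(2) | fact deriv.intros(2-12) | erule deriv.nec)+

lemma iK4_deriv: "iK4 A \<Longrightarrow> deriv Ax A"
  by (erule deriv_mono) simp

lemma prime_th_mono:
  assumes "prime_th Ax' w" "\<And>A. Ax A \<Longrightarrow> deriv Ax' A" shows "prime_th Ax w"
proof -
  have "cons Ax' w A" if "cons Ax w A" for A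
    using that
  proof (induction rule: cons.induct)
    case (cons_mp A B)
    then show ?case using cons.cons_mp by blast
  qed (blast intro: cons_ass cons_thm deriv_mono[OF _ assms(2)])+
  then show ?thesis using assms(1) unfolding prime_th_def by blast
qed

lemmas prime_th_simps = prime_th_Bot prime_th_And prime_th_Or prime_th_Top prime_th_Imp

section \<open>NNIL formulas (no nested implications on the left) with boxes as atoms, and the
  relation \<open>tri0\<close>\<close>

fun nnil :: "form \<Rightarrow> bool" where
  "nnil (And A B) \<longleftrightarrow> nnil A \<and> nnil B"
| "nnil (Or A B) \<longleftrightarrow> nnil A \<and> nnil B"
| "nnil (Imp A B) \<longleftrightarrow> noi A \<and> nnil B"
| "nnil A \<longleftrightarrow> True"

fun nnil_boxes :: "form \<Rightarrow> bool" where
  "nnil_boxes (And A B) \<longleftrightarrow> nnil_boxes A \<and> nnil_boxes B"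
| "nnil_boxes (Or A B) \<longleftrightarrow> nnil_boxes A \<and> nnil_boxes B"
| "nnil_boxes (Imp A B) \<longleftrightarrow> nnil_boxes A \<and> nnil_boxes B"
| "nnil_boxes (Box A) \<longleftrightarrow> nnil A \<and> nnil_boxes A"
| "nnil_boxes A \<longleftrightarrow> True"

abbreviation impl :: "form \<times> form \<Rightarrow> form" where "impl \<equiv> \<lambda>(E, F). Imp E F"

text \<open>\<open>tri\<close> without A4, so that boxed formulas are inert atoms. From
  \<open>pres A B\<close> alone nothing follows about \<open>Box A\<close> and \<open>Box B\<close>;
  A4 is recovered in \<open>tri_pres\<close>, after \<open>tau\<close> has put NNIL formulas under
  the boxes.\<close>

inductive tri0 :: "form \<Rightarrow> form \<Rightarrow> bool" where
  tri0_thm: "iK4 (Imp A B) \<Longrightarrow> tri0 A B"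
| tri0_trans: "tri0 A B \<Longrightarrow> tri0 B C \<Longrightarrow> tri0 A C"
| tri0_And: "tri0 C A \<Longrightarrow> tri0 C B \<Longrightarrow> tri0 C (And A B)"
| tri0_Or: "tri0 A C \<Longrightarrow> tri0 B C \<Longrightarrow> tri0 (Or A B) C"
| tri0_Visser: "tri0 (Imp (bigand (map impl X)) C)
    (bigor (map (brk (bigand (map impl X))) (map fst X @ [C])))"
| tri0_Imp: "tri0 A B \<Longrightarrow> atomic C \<or> boxed C \<Longrightarrow> tri0 (Imp C A) (Imp C B)"

lemma tri0_tri: "tri0 A B \<Longrightarrow> tri A B"
proof (induction rule: tri0.induct)
  case (tri0_trans A B C)
  show ?case using tri0_trans.IH by (rule A2)
next
  case (tri0_Visser X C)
  show ?case by (rule B2)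
qed (blast intro: tri.A1 tri.A3 tri.B1 tri.B3)+

text \<open>The clause on \<open>nnil_boxes\<close> is carried along so that \<open>tau\<close> can
  approximate again inside a box whose content has already been treated.\<close>

definition approx :: "form \<Rightarrow> form \<Rightarrow> bool" where
  "approx G D \<longleftrightarrow> nnil D \<and> (nnil_boxes G \<longrightarrow> nnil_boxes D) \<and> tri0 G D \<and> iK4 (Imp D G)"

section \<open>NNIL approximation\<close>

abbreviation prime_0 :: "form set \<Rightarrow> bool" where "prime_0 \<equiv> prime_th (\<lambda>_. False)"

lemma prime_th_bigand: "prime_th Ax w \<Longrightarrow> bigand As \<in> w \<longleftrightarrow> set As \<subseteq> w"
  by (induction As rule: bigand.induct) (auto simp: prime_th_Top prime_th_And)

lemma prime_th_bigor: "prime_th Ax w \<Longrightarrow> bigor As \<in> w \<longleftrightarrow> (\<exists>A\<in>set As. A \<in> w)"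
  by (induction As rule: bigor.induct) (auto simp: prime_th_Bot prime_th_Or)

lemma nnil_bigand: "\<forall>A\<in>set As. nnil A \<Longrightarrow> nnil (bigand As)"
  by (induction As rule: bigand.induct) (auto simp: Top_def)

lemma nnil_bigor: "\<forall>A\<in>set As. nnil A \<Longrightarrow> nnil (bigor As)"
  by (induction As rule: bigor.induct) auto

lemma nnil_boxes_bigand: "nnil_boxes (bigand As) \<longleftrightarrow> (\<forall>A\<in>set As. nnil_boxes A)"
  by (induction As rule: bigand.induct) (auto simp: Top_def)

lemma nnil_boxes_bigor: "nnil_boxes (bigor As) \<longleftrightarrow> (\<forall>A\<in>set As. nnil_boxes A)"
  by (induction As rule: bigor.induct) auto

lemma tri0_bigand: "\<forall>A\<in>set As. tri0 G A \<Longrightarrow> tri0 G (bigand As)"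
proof (induction As rule: bigand.induct)
  case 1
  have "iK4 (Imp G Top)" by (simp add: deriv_Imp prime_th_Top)
  then show ?case by (simp add: tri0_thm)
next
  case (3 A B As)
  then show ?case by (simp add: tri0_And)
qed simp

lemma tri0_bigor: "\<forall>A\<in>set As. tri0 A D \<Longrightarrow> tri0 (bigor As) D"
  by (induction As rule: bigor.induct) (auto simp: tri0_Or tri0_thm ax_bot)

section \<open>Existence of approximations, by induction on sequents\<close>

definition sequent :: "form list \<Rightarrow> form \<Rightarrow> form" where "sequent \<Gamma> C = Imp (bigand \<Gamma>) C"

lemma prime_th_sq: "prime_th Ax w \<Longrightarrow> sequent \<Gamma> C \<in> w \<longleftrightarrow> (\<forall>v. prime_th Ax v \<longrightarrow> w \<subseteq> v \<longrightarrow> set \<Gamma> \<subseteq> v \<longrightarrow> C \<in> v)"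
  by (simp add: sequent_def prime_th_Imp prime_th_bigand)

lemma nnil_boxes_sq: "nnil_boxes (sequent \<Gamma> C) \<longleftrightarrow> (\<forall>A\<in>set \<Gamma>. nnil_boxes A) \<and> nnil_boxes C"
  by (simp add: sequent_def nnil_boxes_bigand)

lemma approx_cong:
  assumes "approx H D" "nnil_boxes G \<Longrightarrow> nnil_boxes H" "\<And>w. prime_0 w \<Longrightarrow> G \<in> w \<longleftrightarrow> H \<in> w"
  shows "approx G D"
proof -
  have "iK4 (Imp G H)" "iK4 (Imp H G)" using assms(3) by (simp_all add: deriv_Imp)
  moreover have "iK4 (Imp D G)" using assms(1,3) by (simp add: approx_def deriv_Imp)
  ultimately show ?thesis using assms(1,2) unfolding approx_def
    by (blast intro: tri0_trans[OF tri0_thm])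
qed

lemma approx_conj:
  assumes "approx G1 D1" "approx G2 D2" "nnil_boxes G \<Longrightarrow> nnil_boxes G1 \<and> nnil_boxes G2"
    and "\<And>w. prime_0 w \<Longrightarrow> G \<in> w \<longleftrightarrow> G1 \<in> w \<and> G2 \<in> w"
  shows "approx G (And D1 D2)"
proof -
  have "iK4 (Imp G G1)" "iK4 (Imp G G2)" using assms(4) by (simp_all add: deriv_Imp)
  then have "tri0 G (And D1 D2)" using assms(1,2) unfolding approx_def
    by (blast intro: tri0_And tri0_trans[OF tri0_thm])
  moreover have "iK4 (Imp (And D1 D2) G)"
    using assms(1,2,4) by (simp add: approx_def deriv_Imp prime_th_And)
  ultimately show ?thesis using assms unfolding approx_def by auto
qed

text \<open>A conjunction costs 2 so that replacing \<open>Imp (And B C) F\<close> by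
  \<open>Imp B (Imp C F)\<close> lowers the weight; with cost 1 the two would weigh the
  same.\<close>

fun weight :: "form \<Rightarrow> nat" where
  "weight (And A B) = weight A + weight B + 2"
| "weight (Or A B) = weight A + weight B + 1"
| "weight (Imp A B) = weight A + weight B + 1"
| "weight A = 1"

lemma weight_pos: "0 < weight A"
  by (cases A) auto

text \<open>A reduction replaces one formula by at most three lighter ones, and three powers
  \<open>4 ^ m\<close> stay below \<open>4 ^ Suc m\<close>.\<close>

definition ms :: "form list \<Rightarrow> form \<Rightarrow> nat" where
  "ms \<Gamma> C = (\<Sum>A\<leftarrow>\<Gamma>. 4 ^ weight A) + 4 ^ weight C"

lemma ms_Cons: "ms (A # \<Gamma>) C = 4 ^ weight A + ms \<Gamma> C"
  by (simp add: ms_def)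

lemma ms_append: "ms (\<Delta> @ \<Gamma>) C = (\<Sum>A\<leftarrow>\<Delta>. 4 ^ weight A) + ms \<Gamma> C"
  by (simp add: ms_def)

lemma ms_remove1: "A \<in> set \<Gamma> \<Longrightarrow> ms \<Gamma> C = 4 ^ weight A + ms (remove1 A \<Gamma>) C"
  by (simp add: ms_def sum_list_map_remove1)

lemma insert_remove1: "A \<in> set \<Gamma> \<Longrightarrow> insert A (set (remove1 A \<Gamma>)) = set \<Gamma>"
  by (induction \<Gamma>) auto

lemma pow4_sum3: "a < n \<Longrightarrow> b < n \<Longrightarrow> c < n \<Longrightarrow> 4 ^ a + 4 ^ b + 4 ^ c < (4 :: nat) ^ n"
proof -
  assume *: "a < n" "b < n" "c < n"
  then obtain m where n: "n = Suc m" by (cases n) auto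
  have "(4 :: nat) ^ a \<le> 4 ^ m" "(4 :: nat) ^ b \<le> 4 ^ m" "(4 :: nat) ^ c \<le> 4 ^ m"
    using * n by (auto intro!: power_increasing)
  moreover have "(0 :: nat) < 4 ^ m" by simp
  ultimately show ?thesis unfolding n power_Suc by linarith
qed

lemma pow4_sum2: "a < n \<Longrightarrow> b < n \<Longrightarrow> 4 ^ a + 4 ^ b < (4 :: nat) ^ n"
  using pow4_sum3[of a n b b] by simp

lemma approx_sq_replace:
  assumes "A \<in> set \<Gamma>" "approx (sequent (\<Delta> @ remove1 A \<Gamma>) C) D" "nnil_boxes A \<Longrightarrow> \<forall>B\<in>set \<Delta>. nnil_boxes B"
    and "\<And>w. prime_0 w \<Longrightarrow> set \<Delta> \<subseteq> w \<longleftrightarrow> A \<in> w"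
  shows "approx (sequent \<Gamma> C) D"
proof (rule approx_cong[OF assms(2)])
  note set = insert_remove1[OF assms(1), symmetric]
  show "nnil_boxes (sequent \<Gamma> C) \<Longrightarrow> nnil_boxes (sequent (\<Delta> @ remove1 A \<Gamma>) C)"
    using assms(3) by (auto simp: nnil_boxes_sq set)
  show "sequent \<Gamma> C \<in> w \<longleftrightarrow> sequent (\<Delta> @ remove1 A \<Gamma>) C \<in> w" if "prime_0 w" for w
    using assms(4) by (simp add: prime_th_sq[OF that] set)
qed

text \<open>Sorts the formulas on the left of a sequent. All cases except \<open>imp\<close>
  simplify the sequent directly; what is left are implications whose premise is atomic, boxed or
  itself an implication, and for these Visser's rule is invoked.\<close>

lemma sequent_reduce_cases:
  obtains (replace) \<Delta> where "(\<Sum>B\<leftarrow>\<Delta>. 4 ^ weight B) < (4 :: nat) ^ weight A" "nnil_boxes A \<Longrightarrow> \<forall>B\<in>set \<Delta>. nnil_boxes B"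
      "\<And>w. prime_0 w \<Longrightarrow> set \<Delta> \<subseteq> w \<longleftrightarrow> A \<in> w"
  | (bot) "A = Bot"
  | (or) B C where "A = Or B C"
  | (prime) "atomic A \<or> boxed A" "A \<noteq> Bot"
  | (imp) E F where "A = Imp E F" "(atomic E \<or> boxed E) \<or> (\<exists>E1 E2. E = Imp E1 E2)"
proof (cases A)
  case (And B C)
  have "4 ^ weight B + 4 ^ weight C < (4 :: nat) ^ weight A" by (rule pow4_sum2) (simp_all add: And)
  then show thesis by (intro replace[of "[B, C]"]) (simp_all add: And prime_th_And)
next
  case (Imp E F)
  show thesis
  proof (cases E)
    case (And B C)
    have "Imp B (Imp C F) \<in> w \<longleftrightarrow> A \<in> w" if w: "prime_0 w" for w
    proof
      assume "A \<in> w"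
      then show "Imp B (Imp C F) \<in> w" unfolding Imp And using w
        by (simp add: prime_th_Imp prime_th_And) blast
    next
      assume "Imp B (Imp C F) \<in> w"
      then show "A \<in> w" unfolding Imp And using w
        by (simp add: prime_th_Imp prime_th_And)
    qed
    then show thesis by (intro replace[of "[Imp B (Imp C F)]"]) (simp_all add: Imp And add.assoc)
  next
    case (Or B C)
    have "4 ^ weight (Imp B F) + 4 ^ weight (Imp C F) < (4 :: nat) ^ weight A"
      by (rule pow4_sum2) (simp_all add: Imp Or weight_pos)
    then show thesis by (intro replace[of "[Imp B F, Imp C F]"]) (auto simp: Imp Or prime_th_Imp prime_th_Or)
  qed (use imp Imp in auto)
qed (use bot or prime in auto)

text \<open>In the irreducible case the approximation is \<open>And ?D1 ?D0\<close>. Each conjunct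
  of \<open>?D1\<close> treats the sequent with one implication weakened to its conclusion; this is
  implied, since the conclusion entails the implication. \<open>?D0\<close> is the disjunction
  supplied by Visser's rule. Conversely, a true disjunct of \<open>?D0\<close> yields
  \<open>C\<close> itself or the premise of some implication; in the latter case its conclusion
  follows and the matching conjunct of \<open>?D1\<close> gives \<open>C\<close>.\<close>

lemma approx_sq_ex: "\<exists>D. approx (sequent \<Gamma> C) D"
proof (induction "ms \<Gamma> C" arbitrary: \<Gamma> C rule: less_induct)
  case less
  have IH: "\<exists>D. approx (sequent \<Delta> E) D" if "ms \<Delta> E < ms \<Gamma> C" for \<Delta> E
    using less.hyps[OF that] .
  consider (ex) A where "A \<in> set \<Gamma>" "\<nexists>E F. A = Imp E F \<and> ((atomic E \<or> boxed E) \<or> (\<exists>E1 E2. E = Imp E1 E2))"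
    | (all) "\<forall>A\<in>set \<Gamma>. \<exists>E F. A = Imp E F \<and> ((atomic E \<or> boxed E) \<or> (\<exists>E1 E2. E = Imp E1 E2))"
    by blast
  then show ?case
  proof cases
    case ex
    note A = ex(1)
    note set = insert_remove1[OF A, symmetric]
    show ?thesis
    proof (cases A rule: sequent_reduce_cases)
      case (replace \<Delta>)
      then have "ms (\<Delta> @ remove1 A \<Gamma>) C < ms \<Gamma> C" by (simp add: ms_append ms_remove1[OF A])
      then show ?thesis using IH approx_sq_replace[OF A _ replace(2,3)] by blast
    next
      case bot
      have "approx (sequent \<Gamma> C) Top" unfolding approx_def
      proof (intro conjI)
        have "iK4 (sequent \<Gamma> C)" using A bot by (auto simp: deriv_pt prime_th_sq prime_th_Bot)
        then show "iK4 (Imp Top (sequent \<Gamma> C))" "tri0 (sequent \<Gamma> C) Top"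
          by (auto simp: deriv_Imp prime_th_Top prime_th_thm intro!: tri0_thm)
      qed (simp_all add: Top_def)
      then show ?thesis by blast
    next
      case (or B E)
      have "ms (B # remove1 A \<Gamma>) C < ms \<Gamma> C" "ms (E # remove1 A \<Gamma>) C < ms \<Gamma> C"
        using power_strict_increasing[of "weight B" "weight A" "4 :: nat"] power_strict_increasing[of "weight E" "weight A" "4 :: nat"]
        by (simp_all only: ms_Cons ms_remove1[OF A]) (simp_all add: or weight_pos)
      then obtain D1 D2 where D: "approx (sequent (B # remove1 A \<Gamma>) C) D1" "approx (sequent (E # remove1 A \<Gamma>) C) D2"
        using IH by blast
      have "approx (sequent \<Gamma> C) (And D1 D2)"
      proof (rule approx_conj[OF D])
        show "nnil_boxes (sequent \<Gamma> C) \<Longrightarrow> nnil_boxes (sequent (B # remove1 A \<Gamma>) C) \<and> nnil_boxes (sequent (E # remove1 A \<Gamma>) C)"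
          by (auto simp: nnil_boxes_sq set or)
        show "sequent \<Gamma> C \<in> w \<longleftrightarrow> sequent (B # remove1 A \<Gamma>) C \<in> w \<and> sequent (E # remove1 A \<Gamma>) C \<in> w" if "prime_0 w" for w
          by (auto simp: prime_th_sq[OF that] set or prime_th_Or)
      qed
      then show ?thesis by blast
    next
      case prime
      have "ms (remove1 A \<Gamma>) C < ms \<Gamma> C" by (simp add: ms_remove1[OF A])
      then obtain D where D: "approx (sequent (remove1 A \<Gamma>) C) D" using IH by blast
      have noi: "noi A" using prime by (cases A) auto
      \<comment> \<open>A variable or boxed formula is pulled out as the outermost premise, where
        \<open>tri0_Imp\<close> lets the approximation of the remaining sequent pass beneath
        it.\<close>
      have eq: "sequent \<Gamma> C \<in> w \<longleftrightarrow> Imp A (sequent (remove1 A \<Gamma>) C) \<in> w" if "prime_0 w" for w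
        using that by (simp add: prime_th_sq prime_th_Imp set) blast
      have "tri0 (sequent \<Gamma> C) (Imp A (sequent (remove1 A \<Gamma>) C))"
        using eq by (intro tri0_thm) (simp add: deriv_Imp)
      moreover have "tri0 (Imp A (sequent (remove1 A \<Gamma>) C)) (Imp A D)"
        using D prime by (intro tri0_Imp) (auto simp: approx_def)
      moreover have "iK4 (Imp (Imp A D) (sequent \<Gamma> C))"
        using eq D by (auto simp: deriv_Imp approx_def prime_th_Imp)
      moreover have "nnil_boxes (sequent \<Gamma> C) \<Longrightarrow> nnil_boxes (sequent (remove1 A \<Gamma>) C)" "nnil_boxes (sequent \<Gamma> C) \<Longrightarrow> nnil_boxes A"
        by (auto simp: nnil_boxes_sq set)
      ultimately have "approx (sequent \<Gamma> C) (Imp A D)"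
        using D noi unfolding approx_def by (auto intro: tri0_trans)
      then show ?thesis by blast
    next
      case (imp E F)
      then show ?thesis using ex by blast
    qed
  next
    case all
    then obtain X where X: "\<Gamma> = map impl X"
      using ex_map_conv[of \<Gamma> impl] by fastforce
    let ?B = "bigand \<Gamma>" and ?Ys = "map fst X @ [C]"
    \<comment> \<open>The upper bound is \<open>brk ?B Y\<close>, as produced by Visser's rule,
      while the lower bound is only the weaker \<open>Imp ?B Y\<close>; that suffices to recover
      \<open>C\<close> at the end.\<close>
    let ?P = "\<lambda>Y D. nnil D \<and> (nnil_boxes (sequent \<Gamma> C) \<longrightarrow> nnil_boxes D) \<and> tri0 (brk ?B Y) D \<and> iK4 (Imp D (Imp ?B Y))"
    have prime: "\<exists>D. ?P Y D" if "atomic Y \<or> boxed Y" "nnil_boxes (sequent \<Gamma> C) \<Longrightarrow> nnil_boxes Y" for Y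
    proof (rule exI[of _ Y])
      have "nnil Y" "brk ?B Y = Y" using that by (cases Y; simp)+
      then show "?P Y Y" using that by (auto intro!: tri0_thm simp: deriv_id ax_k1)
    qed
    \<comment> \<open>For an implication \<open>Imp Y1 Y2\<close> the premise joins the left side.
      The weight bound makes \<open>Y1\<close> and \<open>Y2\<close> together cheaper than
      \<open>C\<close>, so the outer induction hypothesis applies.\<close>
    have brk: "\<exists>D. ?P Y D" if "weight Y \<le> weight C" "nnil_boxes (sequent \<Gamma> C) \<Longrightarrow> nnil_boxes Y" for Y
      using that
    proof (induction Y)
      case (And Y1 Y2)
      then obtain D1 D2 where "?P Y1 D1" "?P Y2 D2" by auto
      then have "?P (And Y1 Y2) (And D1 D2)"
        by (auto simp: deriv_Imp prime_th_And prime_th_Imp intro!: tri0_And intro: tri0_trans[OF tri0_thm] ax_and1 ax_and2)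
      then show ?case by blast
    next
      case (Or Y1 Y2)
      then obtain D1 D2 where D: "?P Y1 D1" "?P Y2 D2" by auto
      then have "tri0 (brk ?B (Or Y1 Y2)) (Or D1 D2)"
        by (auto intro!: tri0_Or intro: tri0_trans[OF _ tri0_thm] ax_or1 ax_or2)
      with D have "?P (Or Y1 Y2) (Or D1 D2)"
        by (auto simp: deriv_Imp prime_th_Or prime_th_Imp)
      then show ?case by blast
    next
      case (Imp Y1 Y2)
      have "ms (Y1 # \<Gamma>) Y2 < ms \<Gamma> C"
      proof -
        have "4 ^ weight Y1 + 4 ^ weight Y2 < (4 :: nat) ^ weight C"
          using Imp.prems(1) by (intro pow4_sum2) auto
        then show ?thesis by (simp add: ms_def)
      qed
      then obtain D where D: "approx (sequent (Y1 # \<Gamma>) Y2) D" using IH by blast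
      have "approx (Imp ?B (Imp Y1 Y2)) D"
      proof (rule approx_cong[OF D])
        show "nnil_boxes (Imp ?B (Imp Y1 Y2)) \<Longrightarrow> nnil_boxes (sequent (Y1 # \<Gamma>) Y2)" by (auto simp: nnil_boxes_sq nnil_boxes_bigand)
        show "Imp ?B (Imp Y1 Y2) \<in> w \<longleftrightarrow> sequent (Y1 # \<Gamma>) Y2 \<in> w" if "prime_0 w" for w
          using that by (simp add: prime_th_sq prime_th_Imp prime_th_bigand) blast
      qed
      then have "?P (Imp Y1 Y2) D" using Imp.prems by (auto simp: approx_def nnil_boxes_sq nnil_boxes_bigand)
      then show ?case by blast
    qed (intro prime; simp)+
    have "\<exists>D. ?P Y D" if Y: "Y \<in> set ?Ys" for Y
    proof -
      consider "Y = C" | F where "Imp Y F \<in> set \<Gamma>"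
      proof (cases "Y = C")
        case False
        then obtain F where "(Y, F) \<in> set X" using Y by auto
        then have "impl (Y, F) \<in> set \<Gamma>" unfolding X set_map by (rule imageI)
        then show thesis by (intro that(2)) simp
      qed (rule that(1))
      then show ?thesis
      proof cases
        case 1
        then show ?thesis using brk by (simp add: nnil_boxes_sq)
      next
        case 2
        then have nnil_boxes: "nnil_boxes (sequent \<Gamma> C) \<Longrightarrow> nnil_boxes Y" by (force simp: nnil_boxes_sq)
        have "(atomic Y \<or> boxed Y) \<or> (\<exists>E1 E2. Y = Imp E1 E2)" using all 2 by blast
        then show ?thesis
        proof (elim disjE exE)
          fix E1 E2 assume Y: "Y = Imp E1 E2"
          let ?A = "Imp Y F"
          \<comment> \<open>Under \<open>E1\<close> the implication from \<open>Imp E1 E2\<close> to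
            \<open>F\<close> amounts to \<open>Imp E2 F\<close>. As in contraction-free sequent
            calculi, one heavy formula thus becomes three lighter ones, with \<open>E2\<close>
            replacing \<open>C\<close> on the right.\<close>
          let ?\<Delta> = "E1 # Imp E2 F # remove1 ?A \<Gamma>"
          note set = insert_remove1[OF 2, symmetric]
          have "4 ^ weight E1 + 4 ^ weight (Imp E2 F) + 4 ^ weight E2 < (4 :: nat) ^ weight ?A"
            by (intro pow4_sum3) (auto simp: Y weight_pos)
          then have "ms ?\<Delta> E2 < ms \<Gamma> C" by (simp add: ms_def sum_list_map_remove1[OF 2])
          then obtain D where D: "approx (sequent ?\<Delta> E2) D" using IH by blast
          have "approx (Imp ?B Y) D"
          proof (rule approx_cong[OF D])
            show "nnil_boxes (Imp ?B Y) \<Longrightarrow> nnil_boxes (sequent ?\<Delta> E2)" by (auto simp: nnil_boxes_sq nnil_boxes_bigand set Y)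
            show "Imp ?B Y \<in> w \<longleftrightarrow> sequent ?\<Delta> E2 \<in> w" if w: "prime_0 w" for w
            proof -
              have *: "Imp Y F \<in> v \<longleftrightarrow> Imp E2 F \<in> v" if "prime_0 v" "E1 \<in> v" for v
                using that by (simp add: prime_th_Imp Y) blast
              show ?thesis
              proof
                assume L: "Imp ?B Y \<in> w"
                have "E2 \<in> v" if v: "prime_0 v" "w \<subseteq> v" "set ?\<Delta> \<subseteq> v" for v
                proof -
                  have "set \<Gamma> \<subseteq> v" unfolding set using *[OF v(1)] v(3) by simp
                  then have "Imp E1 E2 \<in> v" using L v w unfolding Y by (simp add: prime_th_Imp prime_th_bigand)
                  then show ?thesis using prime_th_mp[OF v(1)] v(3) by simp
                qed
                then show "sequent ?\<Delta> E2 \<in> w" using w by (simp add: prime_th_sq)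
              next
                assume R: "sequent ?\<Delta> E2 \<in> w"
                have "E2 \<in> u" if v: "w \<subseteq> v" "set \<Gamma> \<subseteq> v" "prime_0 u" "v \<subseteq> u" "E1 \<in> u" for u v
                proof -
                  have "set ?\<Delta> \<subseteq> u" using *[OF v(3,5)] v unfolding set by auto
                  then show ?thesis using R w v by (simp add: prime_th_sq)
                qed
                then show "Imp ?B Y \<in> w" unfolding Y using w by (simp add: prime_th_Imp prime_th_bigand)
              qed
            qed
          qed
          then have "?P Y D" using Y nnil_boxes by (auto simp: approx_def nnil_boxes_sq nnil_boxes_bigand)
          then show ?thesis by blast
        qed (intro prime; use nnil_boxes in simp)+
      qed
    qed
    then obtain g where g: "\<forall>Y\<in>set ?Ys. ?P Y (g Y)" by metis
    have "\<exists>D. approx (sequent (snd x # remove1 (impl x) \<Gamma>) C) D" if "x \<in> set X" for x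
    proof (rule IH)
      have "impl x \<in> set \<Gamma>" using that X by auto
      moreover have "4 ^ weight (snd x) < (4 :: nat) ^ weight (impl x)"
        by (rule power_strict_increasing) (auto simp: case_prod_beta)
      ultimately show "ms (snd x # remove1 (impl x) \<Gamma>) C < ms \<Gamma> C"
        by (simp only: ms_remove1 ms_Cons)
    qed
    then obtain h where h: "\<forall>x\<in>set X. approx (sequent (snd x # remove1 (impl x) \<Gamma>) C) (h x)" by metis
    let ?D1 = "bigand (map h X)" and ?D0 = "bigor (map g ?Ys)"
    have "approx (sequent \<Gamma> C) (And ?D1 ?D0)" unfolding approx_def
    proof (intro conjI)
      show "nnil (And ?D1 ?D0)" using g h by (auto simp: approx_def intro!: nnil_bigand nnil_bigor)
      have "nnil_boxes (sequent (snd x # remove1 (impl x) \<Gamma>) C)" if "nnil_boxes (sequent \<Gamma> C)" "x \<in> set X" for x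
      proof -
        have "impl x \<in> set \<Gamma>" using that(2) X by auto
        then have "nnil_boxes (impl x)" using that(1) unfolding nnil_boxes_sq by blast
        then have "nnil_boxes (snd x)" by (cases x) simp
        then show ?thesis using that(1) set_remove1_subset[of "impl x" \<Gamma>] by (auto simp: nnil_boxes_sq)
      qed
      then show "nnil_boxes (sequent \<Gamma> C) \<longrightarrow> nnil_boxes (And ?D1 ?D0)"
        using g h by (auto simp: approx_def nnil_boxes_bigand nnil_boxes_bigor)
      have "tri0 (sequent \<Gamma> C) (h x)" if "x \<in> set X" for x
      proof -
        have A: "impl x \<in> set \<Gamma>" using that X by auto
        have "iK4 (Imp (sequent \<Gamma> C) (sequent (snd x # remove1 (impl x) \<Gamma>) C))"
        proof -
          have "Imp E F \<in> v" if "F \<in> v" "prime_0 v" for E F v using that by (auto simp: prime_th_Imp)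
          then show ?thesis
            by (cases x) (auto simp: deriv_Imp prime_th_sq insert_remove1[OF A, symmetric])
        qed
        then show ?thesis using h that by (auto simp: approx_def intro: tri0_trans tri0_thm)
      qed
      then have 1: "tri0 (sequent \<Gamma> C) ?D1" by (intro tri0_bigand) auto
      have "tri0 (brk ?B Y) ?D0" if "Y \<in> set ?Ys" for Y
      proof -
        have "iK4 (Imp (g Y) ?D0)" using that by (auto simp: deriv_Imp prime_th_bigor)
        then show ?thesis using g that by (blast intro: tri0_trans tri0_thm)
      qed
      then have "tri0 (bigor (map (brk ?B) ?Ys)) ?D0" by (intro tri0_bigor) auto
      then have 0: "tri0 (sequent \<Gamma> C) ?D0"
        using tri0_Visser[of X C] unfolding sequent_def X by (blast intro: tri0_trans)
      show "tri0 (sequent \<Gamma> C) (And ?D1 ?D0)" using 1 0 by (rule tri0_And)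
      \<comment> \<open>The disjunct of \<open>?D0\<close> true at \<open>w\<close> decides which
        conjunct of \<open>?D1\<close> is used.\<close>
      have "C \<in> v" if w: "prime_0 w" "?D1 \<in> w" "?D0 \<in> w" "prime_0 v" "w \<subseteq> v" "set \<Gamma> \<subseteq> v" for w v
      proof -
        obtain Y where Y: "Y \<in> set ?Ys" "g Y \<in> w" using w by (auto simp: prime_th_bigor)
        then have "Imp ?B Y \<in> w" using g w(1) by (meson deriv_Imp)
        then have "Y \<in> v" using w by (auto simp: prime_th_Imp prime_th_bigand)
        show ?thesis
        proof (cases "Y = C")
          case False
          then obtain x where x: "x \<in> set X" "fst x = Y" using Y by auto
          then have A: "impl x \<in> set \<Gamma>" using X by auto
          then have "Imp Y (snd x) \<in> v" using w(6) x(2) by (cases x) auto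
          then have "snd x \<in> v" using \<open>Y \<in> v\<close> w(4) by (blast intro: prime_th_mp)
          moreover have "h x \<in> w" using w x by (auto simp: prime_th_bigand)
          then have "sequent (snd x # remove1 (impl x) \<Gamma>) C \<in> w"
            using h x(1) w(1) by (auto simp: approx_def deriv_Imp)
          ultimately show ?thesis using w insert_remove1[OF A]
            by (auto simp: prime_th_sq)
        qed (use \<open>Y \<in> v\<close> in simp)
      qed
      then show "iK4 (Imp (And ?D1 ?D0) (sequent \<Gamma> C))" by (simp add: deriv_Imp prime_th_And prime_th_sq)
    qed
    then show ?thesis by blast
  qed
qed

lemma approx_ex: "\<exists>D. approx G D"
proof -
  obtain D where D: "approx (sequent [] G) D" using approx_sq_ex by blast
  have "approx G D"
  proof (rule approx_cong[OF D])
    show "G \<in> w \<longleftrightarrow> sequent [] G \<in> w" if "prime_0 w" for w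
      using that by (auto simp: prime_th_sq)
  qed (simp add: nnil_boxes_sq)
  then show ?thesis by blast
qed

section \<open>Tree models\<close>

definition M_ax :: "form \<Rightarrow> bool" where
  "M_ax D \<longleftrightarrow> (\<exists>A. D = Imp (Box (Imp (Box A) A)) (Box A))
    \<or> (\<exists>p. atomic p \<and> D = Imp p (Box p)) \<or> (\<exists>A. D = Box (Imp A (Box A)))"

text \<open>The logic of the worlds seen through a box: its theorems are provable in
  \<open>M\<close> once boxed, by \<open>C_imp_M_Box\<close>.\<close>

definition C_ax :: "form \<Rightarrow> bool" where
  "C_ax D \<longleftrightarrow> (\<exists>A. D = Imp (Box (Imp (Box A) A)) (Box A)) \<or> (\<exists>A. D = Imp A (Box A))"

lemma M_Loeb: "deriv M_ax (Imp (Box (Imp (Box A) A)) (Box A))"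
  and M_atomic: "atomic p \<Longrightarrow> deriv M_ax (Imp p (Box p))"
  and M_Box: "deriv M_ax (Box (Imp A (Box A)))"
  by (rule ax_extra, auto simp: M_ax_def)+

lemma C_Loeb: "deriv C_ax (Imp (Box (Imp (Box A) A)) (Box A))"
  and C_Box: "deriv C_ax (Imp A (Box A))"
  by (rule ax_extra, auto simp: C_ax_def)+

lemma M_C: "M_ax A \<Longrightarrow> deriv C_ax A"
  unfolding M_ax_def by (elim disjE exE conjE; simp only:) (rule C_Loeb C_Box nec[OF C_Box])+

lemma prime_th_C_M: "prime_th C_ax w \<Longrightarrow> prime_th M_ax w"
  by (erule prime_th_mono) (rule M_C)

lemma C_imp_M_Box: "deriv C_ax A \<Longrightarrow> deriv M_ax (Box A)"
proof (induction rule: deriv.induct)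
  case (ax_extra A)
  then show ?case unfolding C_ax_def
    by (elim disjE exE conjE; simp only:) (rule nec[OF M_Loeb] M_Box)+
next
  case (mp A B)
  show ?case using deriv.mp[OF deriv.mp[OF ax_K mp.IH(1)] mp.IH(2)] .
next
  case (nec A)
  show ?case using mp[OF ax_4 nec.IH] .
qed (rule nec, fact deriv.intros)+

definition star :: "form \<Rightarrow> form" where "star G = (SOME D. approx G D)"

lemma approx_star: "approx G (star G)"
  unfolding star_def using approx_ex by (rule someI_ex)

lemma nnil_star: "nnil (star G)"
  and nnil_boxes_star: "nnil_boxes G \<Longrightarrow> nnil_boxes (star G)"
  and tri0_star: "tri0 G (star G)"
  and star_imp: "iK4 (Imp (star G) G)"
  using approx_star[of G] by (auto simp: approx_def)

fun tau :: "form \<Rightarrow> form" where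
  "tau (Var p) = Var p"
| "tau Bot = Bot"
| "tau (And A B) = And (tau A) (tau B)"
| "tau (Or A B) = Or (tau A) (tau B)"
| "tau (Imp A B) = Imp (tau A) (tau B)"
| "tau (Box A) = Box (star (tau A))"

lemma nnil_boxes_tau: "nnil_boxes (tau A)"
  by (induction A) (auto simp: nnil_star nnil_boxes_star)

text \<open>Under a box, one direction is an instance of the axiom for \<open>tri\<close>, the other
  is \<open>star_imp\<close> and needs only \<open>iK4\<close>.\<close>

lemma Hsigma_tau: "prime_th Hsigma_ax w \<Longrightarrow> A \<in> w \<longleftrightarrow> tau A \<in> w"
proof (induction A arbitrary: w)
  case (Box A)
  have 1: "deriv Hsigma_ax (Imp A (tau A))" "deriv Hsigma_ax (Imp (tau A) A)"
    using Box.IH by (simp_all add: deriv_Imp)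
  have "tri (tau A) (star (tau A))" by (intro tri0_tri tri0_star)
  then have 2: "deriv Hsigma_ax (Imp (Box (tau A)) (Box (star (tau A))))"
    by (intro ax_extra) (auto simp: Hsigma_ax_def)
  have 3: "deriv Hsigma_ax (Imp (star (tau A)) (tau A))" by (rule iK4_deriv) (rule star_imp)
  note b = prime_th_Box_thm[OF Box.prems]
  show ?case
    using b[OF 1(1)] b[OF 1(2)] b[OF 3] prime_th_thm_mp[OF Box.prems 2] unfolding tau.simps by blast
qed (simp_all add: prime_th_simps)

section \<open>Finite trees labelled with prime theories\<close>

datatype tree = Node (lab: "form set") (kids: "tree list")

fun subs :: "tree \<Rightarrow> tree set" where
  "subs (Node l ts) = insert (Node l ts) (\<Union>t\<in>set ts. subs t)"

lemma subs_self: "t \<in> subs t"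
  by (cases t) simp

lemma finite_subs: "finite (subs t)"
  by (induction t) simp

lemma subs_trans: "u \<in> subs t \<Longrightarrow> v \<in> subs u \<Longrightarrow> v \<in> subs t"
  by (induction t) auto

definition good_tree :: "tree \<Rightarrow> bool" where
  "good_tree t \<longleftrightarrow> (\<forall>u\<in>subs t. prime_th M_ax (lab u) \<and> (\<forall>v\<in>subs u. lab u \<subseteq> lab v))"

lemma good_tree_subs: "good_tree t \<Longrightarrow> u \<in> subs t \<Longrightarrow> good_tree u"
  unfolding good_tree_def using subs_trans[of u t] by simp

lemma good_tree_pt: "good_tree t \<Longrightarrow> prime_th M_ax (lab t)"
  unfolding good_tree_def using subs_self[of t] by blast

lemma good_tree_lab: "good_tree t \<Longrightarrow> u \<in> subs t \<Longrightarrow> lab t \<subseteq> lab u"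
  unfolding good_tree_def using subs_self[of t] by blast

lemma good_tree_Node:
  assumes "prime_th M_ax w" "\<forall>t\<in>set ts. good_tree t \<and> w \<subseteq> lab t" shows "good_tree (Node w ts)"
proof -
  have "w \<subseteq> lab v" if v: "v \<in> subs (Node w ts)" for v
  proof (cases "v = Node w ts")
    case False
    then obtain t where "t \<in> set ts" "v \<in> subs t" using v by auto
    then show ?thesis using assms(2) good_tree_lab[of t v] by blast
  qed simp
  then show ?thesis using assms unfolding good_tree_def by auto
qed

text \<open>Variables and boxes are read off the label, but implications quantify over subtrees only
  and not over all prime extensions. Forcing may therefore differ from membership in the label, and
  agrees with it on NOI formulas.\<close>

fun forces :: "form \<Rightarrow> tree \<Rightarrow> bool" where
  "forces (Var p) t \<longleftrightarrow> Var p \<in> lab t"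
| "forces Bot t \<longleftrightarrow> False"
| "forces (Box A) t \<longleftrightarrow> Box A \<in> lab t"
| "forces (And A B) t \<longleftrightarrow> forces A t \<and> forces B t"
| "forces (Or A B) t \<longleftrightarrow> forces A t \<or> forces B t"
| "forces (Imp A B) t \<longleftrightarrow> (\<forall>u\<in>subs t. forces A u \<longrightarrow> forces B u)"

lemma forces_subs: "forces A t \<Longrightarrow> good_tree t \<Longrightarrow> u \<in> subs t \<Longrightarrow> forces A u"
proof (induction A)
  case (Imp A B)
  then show ?case using subs_trans[OF Imp.prems(3)] by simp
qed (use good_tree_lab[of t u] in auto)

lemma forces_noi: "noi A \<Longrightarrow> good_tree t \<Longrightarrow> forces A t \<longleftrightarrow> A \<in> lab t"
  by (induction A) (auto simp: good_tree_pt[THEN prime_th_And] good_tree_pt[THEN prime_th_Or] good_tree_pt[THEN prime_th_Bot])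

text \<open>Loeb's axiom, \<open>p \<rightarrow> \<box>p\<close> and transitivity relate NOI
  formulas, so their truth in trees reduces to membership in the labels.\<close>

lemma forces_Imp_noi:
  assumes "\<And>w. prime_th M_ax w \<Longrightarrow> A \<in> w \<Longrightarrow> B \<in> w" "noi A" "noi B" "good_tree t" shows "forces (Imp A B) t"
proof -
  have "forces B u" if "u \<in> subs t" "forces A u" for u
    using that assms good_tree_subs[OF assms(4) that(1)] by (simp add: forces_noi good_tree_pt)
  then show ?thesis by simp
qed

lemma forces_sound: "deriv M_ax A \<Longrightarrow> good_tree t \<Longrightarrow> forces A t"
proof (induction arbitrary: t rule: deriv.induct)
  case (ax_extra A)
  then consider B where "A = Imp (Box (Imp (Box B) B)) (Box B)"
    | p where "atomic p" "A = Imp p (Box p)" | B where "A = Box (Imp B (Box B))"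
    unfolding M_ax_def by blast
  then show ?case
  proof cases
    case 1
    show ?thesis unfolding 1
      by (rule forces_Imp_noi[OF prime_th_thm_mp[OF _ M_Loeb]]) (use ax_extra in simp_all)
  next
    case 2
    then have "noi p" by (cases p) auto
    show ?thesis unfolding 2(2)
      by (rule forces_Imp_noi[OF prime_th_thm_mp[OF _ M_atomic[OF 2(1)]]]) (use ax_extra \<open>noi p\<close> in simp_all)
  next
    case 3
    then show ?thesis using prime_th_thm[OF good_tree_pt[OF ax_extra(2)] M_Box] by simp
  qed
next
  case (ax_k1 A B)
  have "forces A v" if "u \<in> subs t" "forces A u" "v \<in> subs u" for u v
    using forces_subs[OF that(2) good_tree_subs[OF ax_k1 that(1)] that(3)] .
  then show ?case by simp
next
  case (ax_s A B C)
  have "forces C x" if "u \<in> subs t" "\<forall>v\<in>subs u. forces A v \<longrightarrow> (\<forall>x\<in>subs v. forces B x \<longrightarrow> forces C x)"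
    "v \<in> subs u" "\<forall>x\<in>subs v. forces A x \<longrightarrow> forces B x" "x \<in> subs v" "forces A x" for u v x
  proof -
    have "forces B x" using that(4-6) by simp
    then show ?thesis using that(2,6) subs_trans[OF that(3,5)] subs_self[of x] by simp
  qed
  then show ?case by simp
next
  case (ax_andI A B)
  have "forces A v" if "u \<in> subs t" "forces A u" "v \<in> subs u" for u v
    using forces_subs[OF that(2) good_tree_subs[OF ax_andI that(1)] that(3)] .
  then show ?case by simp
next
  case (ax_orE A C B)
  have "forces C x" if "\<forall>v\<in>subs u. forces A v \<longrightarrow> forces C v" "v \<in> subs u" "x \<in> subs v" "forces A x" for u v x A
    using that(1,4) subs_trans[OF that(2,3)] by simp
  then show ?case by simp
next
  case (ax_K A B)
  have "forces (Imp (Box A) (Box B)) u" if u: "u \<in> subs t" "Box (Imp A B) \<in> lab u" for u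
  proof -
    have "Box B \<in> lab v" if v: "v \<in> subs u" "Box A \<in> lab v" for v
    proof -
      have "good_tree u" using ax_K u(1) by (rule good_tree_subs)
      then have "Box (Imp A B) \<in> lab v" "good_tree v"
        using good_tree_lab[of u v] good_tree_subs[of u v] v u(2) by auto
      from prime_th_Box_mp[OF good_tree_pt[OF this(2)] this(1) v(2)] show ?thesis .
    qed
    then show ?thesis by simp
  qed
  then show ?case by simp
next
  case (ax_4 A)
  show ?case by (rule forces_Imp_noi[OF prime_th_Box4]) (use ax_4 in simp_all)
next
  case (mp A B)
  have "forces (Imp A B) t" "forces A t" using mp by simp_all
  then show ?case using subs_self[of t] by simp
next
  case (nec A)
  have "Box A \<in> lab t" by (rule prime_th_thm[OF good_tree_pt[OF nec.prems] deriv.nec[OF nec.hyps]])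
  then show ?case by simp
qed simp_all

section \<open>Truth at the root of all trees, and its preservation\<close>

definition robust :: "form set \<Rightarrow> form \<Rightarrow> bool" where
  "robust w A \<longleftrightarrow> (\<forall>t. good_tree t \<longrightarrow> lab t = w \<longrightarrow> forces A t)"

lemma robust_mp: "deriv M_ax (Imp A B) \<Longrightarrow> robust w A \<Longrightarrow> robust w B"
  unfolding robust_def using forces_sound[of "Imp A B"] subs_self by fastforce

lemma robust_thm: "deriv M_ax A \<Longrightarrow> robust w A"
  by (simp add: robust_def forces_sound)

lemma robust_And: "robust w (And A B) \<longleftrightarrow> robust w A \<and> robust w B"
  by (auto simp: robust_def)

text \<open>Trees refuting the two disjuncts are glued under a new root with the same label
  \<open>w\<close>; by persistence that root refutes both.\<close>

lemma robust_Or: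
  assumes "prime_th M_ax w" shows "robust w (Or A B) \<longleftrightarrow> robust w A \<or> robust w B"
proof
  assume *: "robust w (Or A B)"
  show "robust w A \<or> robust w B"
  proof (rule ccontr)
    assume "\<not> (robust w A \<or> robust w B)"
    then obtain s t where st: "good_tree s" "lab s = w" "\<not> forces A s" "good_tree t" "lab t = w" "\<not> forces B t"
      by (auto simp: robust_def)
    then have g: "good_tree (Node w [s, t])" using assms by (intro good_tree_Node) auto
    then have "forces (Or A B) (Node w [s, t])" using * by (simp add: robust_def)
    moreover have "s \<in> subs (Node w [s, t])" "t \<in> subs (Node w [s, t])" using subs_self by auto
    ultimately show False using forces_subs[OF _ g] st by auto
  qed
qed (auto simp: robust_def)

lemma robust_noi:
  assumes "noi A" "prime_th M_ax w" shows "robust w A \<longleftrightarrow> A \<in> w"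
proof -
  have "good_tree (Node w [])" using assms(2) by (intro good_tree_Node) auto
  then show ?thesis using forces_noi[OF assms(1)] unfolding robust_def by (metis tree.sel(1))
qed

text \<open>Whether a NOI premise is forced depends on the label alone, and any tree whose root
  label extends \<open>w\<close> can be hung below a root labelled \<open>w\<close>.\<close>

lemma robust_Imp:
  assumes "noi E" "prime_th M_ax w"
  shows "robust w (Imp E A) \<longleftrightarrow> (\<forall>v. prime_th M_ax v \<longrightarrow> w \<subseteq> v \<longrightarrow> E \<in> v \<longrightarrow> robust v A)"
proof
  assume *: "robust w (Imp E A)"
  have "forces A t" if "w \<subseteq> lab t" "E \<in> lab t" "good_tree t" for t
  proof -
    have "good_tree (Node w [t])" using assms(2) that by (intro good_tree_Node) auto
    then have "forces (Imp E A) (Node w [t])" using * by (simp add: robust_def)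
    then show ?thesis using that subs_self[of t] forces_noi[OF assms(1) that(3)] by simp
  qed
  then show "\<forall>v. prime_th M_ax v \<longrightarrow> w \<subseteq> v \<longrightarrow> E \<in> v \<longrightarrow> robust v A" by (auto simp: robust_def)
next
  assume *: "\<forall>v. prime_th M_ax v \<longrightarrow> w \<subseteq> v \<longrightarrow> E \<in> v \<longrightarrow> robust v A"
  have "forces A u" if "good_tree t" "lab t = w" "u \<in> subs t" "forces E u" for t u
  proof -
    have u: "good_tree u" using that(1,3) by (rule good_tree_subs)
    then have "E \<in> lab u" using that(4) forces_noi[OF assms(1)] by blast
    then have "robust (lab u) A" using * good_tree_pt[OF u] good_tree_lab that by blast
    then show ?thesis using u by (simp add: robust_def)
  qed
  then show "robust w (Imp E A)" by (auto simp: robust_def)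
qed

text \<open>On NNIL formulas robustness obeys the clauses of membership: disjunctions split by
  gluing, and premises of implications are NOI.\<close>

lemma robust_nn: "nnil A \<Longrightarrow> prime_th M_ax w \<Longrightarrow> robust w A \<longleftrightarrow> A \<in> w"
proof (induction A arbitrary: w)
  case (Imp A B)
  then show ?case by (simp add: robust_Imp prime_th_Imp)
qed (simp_all add: robust_And robust_Or prime_th_And prime_th_Or robust_noi)

lemma forces_bigand: "forces (bigand As) t \<longleftrightarrow> (\<forall>A\<in>set As. forces A t)"
  by (induction As rule: bigand.induct) (auto simp: Top_def)

lemma forces_bigor: "forces (bigor As) t \<longleftrightarrow> (\<exists>A\<in>set As. forces A t)"
  by (induction As rule: bigor.induct) auto

text \<open>Soundness of Visser's rule: below the root of a tree that refutes the conclusion, keep only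
  the subtrees that force the antecedent. The root of the pruned tree forces that antecedent
  vacuously.\<close>

lemma robust_Visser:
  assumes "prime_th M_ax w" "robust w (Imp (bigand (map impl X)) C)"
  shows "robust w (bigor (map (brk (bigand (map impl X))) (map fst X @ [C])))"
proof (rule ccontr)
  let ?B = "bigand (map impl X)" and ?Ys = "map fst X @ [C]"
  assume "\<not> robust w (bigor (map (brk ?B) ?Ys))"
  then obtain t where t: "good_tree t" "lab t = w" "\<not> forces (bigor (map (brk ?B) ?Ys)) t"
    by (auto simp: robust_def)
  then have no: "\<not> forces (brk ?B Y) t" if "Y \<in> set ?Ys" for Y
    using that by (auto simp: forces_bigor)
  obtain us where us: "set us = {u \<in> subs t. forces ?B u}"
    using finite_list[of "{u \<in> subs t. forces ?B u}"] finite_subs by auto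
  let ?r = "Node w us"
  have good_tree: "good_tree ?r" using t us by (intro good_tree_Node assms) (auto dest: good_tree_subs good_tree_lab)
  have subs: "u \<in> subs t \<and> forces ?B u" if "u \<in> subs ?r" "u \<noteq> ?r" for u
  proof -
    obtain v where v: "v \<in> set us" "u \<in> subs v" using \<open>u \<in> subs ?r\<close> \<open>u \<noteq> ?r\<close> by auto
    then have "v \<in> subs t" "forces ?B v" using us by auto
    then show ?thesis using subs_trans v(2) forces_subs good_tree_subs t(1) by blast
  qed
  \<comment> \<open>The clauses of \<open>brk\<close> match the pruning: atoms and boxes depend only
    on the label, which both roots share, and an implication holding at the pruned root holds at all
    subtrees of \<open>t\<close> that force \<open>?B\<close>.\<close>
  have brk: "forces (brk ?B Y) t" if "forces Y ?r" for Y
    using that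
  proof (induction Y)
    case (Imp Y1 Y2)
    have "forces (Imp Y1 Y2) u" if "u \<in> subs t" "forces ?B u" for u
    proof -
      have "u \<in> subs ?r" using us that subs_self by auto
      then show ?thesis using Imp.prems good_tree forces_subs by blast
    qed
    then show ?case by simp
  qed (use t in auto)
  have "forces (Imp E F) ?r" if "(E, F) \<in> set X" for E F
  proof -
    have "\<not> forces E ?r" using brk no[of E] that by force
    moreover have "forces (Imp E F) u" if u: "u \<in> subs ?r" "u \<noteq> ?r" for u
      using subs[OF u] \<open>(E, F) \<in> set X\<close> by (auto simp: forces_bigand)
    ultimately show ?thesis using subs_self by (metis forces.simps(6))
  qed
  then have "forces ?B ?r" by (auto simp: forces_bigand)
  moreover have "forces (Imp ?B C) ?r" using assms(2) good_tree by (simp add: robust_def)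
  ultimately have "forces C ?r" using subs_self by auto
  then show False using brk no by auto
qed

definition pres :: "form \<Rightarrow> form \<Rightarrow> bool" where
  "pres A B \<longleftrightarrow> (\<forall>w. prime_th M_ax w \<longrightarrow> robust w A \<longrightarrow> robust w B)"

lemma pres_thm: "deriv M_ax (Imp A B) \<Longrightarrow> pres A B"
  unfolding pres_def by (intro allI impI) (rule robust_mp)

lemma pres_Imp: "pres A B \<Longrightarrow> noi C \<Longrightarrow> pres (Imp C A) (Imp C B)"
  by (simp add: pres_def robust_Imp)

lemma tri0_pres: "tri0 A B \<Longrightarrow> pres A B"
proof (induction rule: tri0.induct)
  case (tri0_thm A B)
  then show ?case by (rule pres_thm[OF iK4_deriv])
next
  case (tri0_Visser X C)
  show ?case unfolding pres_def by (intro allI impI) (rule robust_Visser)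
next
  case (tri0_Imp A B C)
  moreover have "noi C" using tri0_Imp(2) by (cases C) auto
  ultimately show ?case by (intro pres_Imp)
qed (simp_all add: pres_def robust_And robust_Or)

text \<open>Robustness passes from \<open>G\<close> to \<open>star G\<close> by preservation and
  back because \<open>star G\<close> implies \<open>G\<close>; on the NNIL formula
  \<open>star G\<close> it is membership. Hence the arbitrary choice inside \<open>star\<close> does
  not matter.\<close>

lemma star_ok: assumes "prime_th M_ax w" shows "star G \<in> w \<longleftrightarrow> robust w G"
proof -
  have "robust w G \<Longrightarrow> robust w (star G)" using tri0_pres[OF tri0_star] assms by (simp add: pres_def)
  moreover have "robust w (star G) \<Longrightarrow> robust w G" by (rule robust_mp[OF iK4_deriv[OF star_imp]])
  moreover have "robust w (star G) \<longleftrightarrow> star G \<in> w" using nnil_star assms by (rule robust_nn)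
  ultimately show ?thesis by blast
qed

lemma star_imp_star: "deriv M_ax (Imp (star A) (star B)) \<longleftrightarrow> pres A B"
  by (simp add: deriv_Imp star_ok pres_def)

lemma prime_th_Box_star: assumes "prime_th M_ax w" "pres A B" "Box (star A) \<in> w" shows "Box (star B) \<in> w"
proof (rule prime_th_Box_thm[OF assms(1) _ assms(3)])
  show "deriv M_ax (Imp (star A) (star B))" using assms(2) by (simp add: star_imp_star)
qed

lemma star_Box: "deriv M_ax (Imp (Box A) (star (Box A)))"
  by (simp add: deriv_Imp star_ok robust_noi)

text \<open>The set of axioms is a parameter because the lemma serves both \<open>iK4\<close>,
  inside \<open>tri\<close>, and \<open>Hsigma\<close>. The distribution axiom survives since
  robustness is closed under modus ponens.\<close>

lemma tau_deriv:
  assumes "deriv Ax A" "\<And>A. Ax A \<Longrightarrow> deriv M_ax (tau A)"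
  shows "deriv M_ax (tau A)"
  using assms(1)
proof (induction rule: deriv.induct)
  case (ax_extra A)
  then show ?case by (rule assms(2))
next
  case (ax_K A B)
  have "deriv M_ax (Imp (star (Imp (tau A) (tau B))) (Imp (star (tau A)) (star (tau B))))"
  proof -
    have "star (tau B) \<in> v" if v: "star (Imp (tau A) (tau B)) \<in> w" "prime_th M_ax v" "w \<subseteq> v" "star (tau A) \<in> v" for w v
    proof -
      have "robust v (Imp (tau A) (tau B))" "robust v (tau A)" using v star_ok by blast+
      then have "robust v (tau B)" unfolding robust_def using subs_self by fastforce
      then show ?thesis using v(2) star_ok by blast
    qed
    then show ?thesis by (simp add: deriv_Imp prime_th_Imp)
  qed
  note S = this
  have "Imp (Box (star (tau A))) (Box (star (tau B))) \<in> w"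
    if w: "prime_th M_ax w" "Box (star (Imp (tau A) (tau B))) \<in> w" for w
    by (rule prime_th_thm_mp[OF w(1) deriv.ax_K prime_th_Box_thm[OF w(1) S w(2)]])
  then show ?case by (simp add: deriv_Imp)
next
  case (ax_4 A)
  have "Box (star (Box (star (tau A)))) \<in> w" if "prime_th M_ax w" "Box (star (tau A)) \<in> w" for w
    by (rule prime_th_Box_thm[OF that(1) star_Box prime_th_Box4[OF that]])
  then show ?case by (simp add: deriv_Imp)
next
  case (mp A B)
  have "deriv M_ax (Imp (tau A) (tau B))" using mp.IH(1) by simp
  then show ?case using mp.IH(2) by (rule deriv.mp)
next
  case (nec A)
  have "star (tau A) \<in> w" if "prime_th M_ax w" for w
    using that nec.IH by (simp add: star_ok robust_thm)
  then have "deriv M_ax (star (tau A))" by (simp add: deriv_pt)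
  then show ?case by (simp add: deriv.nec)
qed (simp, fact deriv.intros)+

lemma tau_bigand: "tau (bigand As) = bigand (map tau As)"
  by (induction As rule: bigand.induct) (auto simp: Top_def)

lemma tau_bigor: "tau (bigor As) = bigor (map tau As)"
  by (induction As rule: bigor.induct) auto

lemma tau_brk: "tau (brk A B) = brk (tau A) (tau B)"
  by (induction B) auto

text \<open>In case A4, preservation between \<open>tau A\<close> and \<open>tau B\<close> is a
  provable implication between their approximations, and that implication can be boxed.\<close>

lemma tri_pres: "tri A B \<Longrightarrow> pres (tau A) (tau B)"
proof (induction rule: tri.induct)
  case (A1 A B)
  have "deriv M_ax (tau (Imp A B))" using A1 by (rule tau_deriv) simp
  then show ?case by (intro pres_thm) simp
next
  case (A4 A B)
  then show ?case using prime_th_Box_star[OF _ A4.IH] by (simp add: pres_def[of "Box _"] robust_noi)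
next
  case (B2 X C)
  let ?X = "map (\<lambda>(E, F). (tau E, tau F)) X"
  have 1: "map tau (map impl X) = map impl ?X" by auto
  have 2: "map tau (map (brk B) (map fst X @ [C])) = map (brk (tau B)) (map fst ?X @ [tau C])" for B
    by (auto simp: tau_brk)
  show ?case
    unfolding pres_def tau_bigor 2 tau.simps tau_bigand 1
    by (intro allI impI) (rule robust_Visser)
next
  case (B3 A B C)
  moreover have "noi (tau C)" using B3(2) by (cases C) auto
  ultimately show ?case by (simp add: pres_Imp)
qed (simp_all add: pres_def robust_And robust_Or)

text \<open>The disjunction clause of \<open>lt\<close> adds boxes to the disjuncts, and these come
  from \<open>A \<rightarrow> \<box>A\<close>, available at prime theories of
  \<open>C\<close>.\<close>

lemma robust_lt: "prime_th C_ax w \<Longrightarrow> robust w (tau A) \<Longrightarrow> robust w (tau (lt A))"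
proof (induction A arbitrary: w)
  case (And A B)
  then show ?case by (simp add: robust_And)
next
  case (Or A B)
  note w = prime_th_C_M[OF Or.prems(1)]
  have box: "robust w (tau (boxdot (lt D)))" if "robust w (tau (lt D))" for D
  proof -
    have "star (tau (lt D)) \<in> w" using that star_ok[OF w] by blast
    then have "Box (star (tau (lt D))) \<in> w" using prime_th_thm_mp[OF Or.prems(1) C_Box] by blast
    then show ?thesis using that by (simp add: boxdot_def robust_And robust_noi w)
  qed
  then show ?case using Or by (auto simp: robust_Or w)
next
  case (Imp A B)
  note w = prime_th_C_M[OF Imp.prems(1)]
  show ?case
  proof (cases "noi A")
    case True
    then have n: "noi (tau A)" by (induction A) auto
    \<comment> \<open>All theorems of \<open>C\<close> already lie in \<open>w\<close>, so prime
      extensions with respect to \<open>M\<close> are automatically closed under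
      \<open>C\<close>.\<close>
    have "prime_th C_ax v" if "prime_th M_ax v" "w \<subseteq> v" for v
    proof -
      have "A \<in> v" if "cons C_ax v A" for A
        using that
      proof (induction rule: cons.induct)
        case (cons_thm A)
        then show ?case using prime_th_thm[OF Imp.prems(1)] \<open>w \<subseteq> v\<close> by blast
      next
        case (cons_mp A B)
        then show ?case using prime_th_mp[OF \<open>prime_th M_ax v\<close>] by blast
      qed
      then show ?thesis using \<open>prime_th M_ax v\<close> unfolding prime_th_def by blast
    qed
    then show ?thesis using Imp n by (simp add: True robust_Imp w)
  next
    case False
    then show ?thesis using Imp.prems by simp
  qed
qed simp_all

text \<open>Leivant's axiom is verified in \<open>C\<close> and carried under the box by
  \<open>C_imp_M_Box\<close>. For Loeb's axiom, the premise \<open>Box ?S\<close> is NOI, so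
  \<open>robust_Imp\<close> applies to it.\<close>

lemma Hsigma_imp_M: "Hsigma A \<Longrightarrow> deriv M_ax (tau A)"
  unfolding Hsigma_def
proof (erule tau_deriv)
  fix D assume "Hsigma_ax D"
  then consider (Loeb) A where "D = Imp (Box (Imp (Box A) A)) (Box A)"
    | (lt) A where "D = Imp (Box A) (Box (lt A))"
    | (atomic) p where "atomic p" "D = Imp p (Box p)"
    | (tri) A B where "tri A B" "D = Imp (Box A) (Box B)"
    unfolding Hsigma_ax_def by blast
  then show "deriv M_ax (tau D)"
  proof cases
    case Loeb
    let ?S = "star (tau A)"
    have "?S \<in> v" if "prime_th M_ax w" "star (Imp (Box ?S) (tau A)) \<in> w" "prime_th M_ax v" "w \<subseteq> v" "Box ?S \<in> v" for w v
      using that by (auto simp: star_ok robust_Imp)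
    then have "deriv M_ax (Imp (star (Imp (Box ?S) (tau A))) (Imp (Box ?S) ?S))"
      by (auto simp: deriv_Imp prime_th_Imp)
    then have "Box ?S \<in> w" if "prime_th M_ax w" "Box (star (Imp (Box ?S) (tau A))) \<in> w" for w
      by (rule prime_th_thm_mp[OF that(1) M_Loeb prime_th_Box_thm[OF that(1) _ that(2)]])
    then show ?thesis by (simp add: Loeb deriv_Imp)
  next
    case lt
    have "deriv C_ax (Imp (star (tau A)) (star (tau (lt A))))"
      using robust_lt by (simp add: deriv_Imp star_ok prime_th_C_M)
    then have "deriv M_ax (Box (Imp (star (tau A)) (star (tau (lt A)))))" by (rule C_imp_M_Box)
    then show ?thesis using mp[OF ax_K] by (simp add: lt)
  next
    case atomic
    then have p: "tau p = p" "noi p" by (cases p; simp)+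
    then have "deriv M_ax (Imp p (star p))" by (simp add: deriv_Imp star_ok robust_noi)
    then have "Box (star p) \<in> w" if "prime_th M_ax w" "p \<in> w" for w
      by (rule prime_th_Box_thm[OF that(1) _ prime_th_thm_mp[OF that(1) M_atomic[OF atomic(1)] that(2)]])
    then show ?thesis by (simp add: atomic p deriv_Imp)
  next
    case tri
    then show ?thesis using prime_th_Box_star[OF _ tri_pres[OF tri(1)]] by (simp add: deriv_Imp)
  qed
qed

text \<open>For an NNIL formula robustness and membership coincide, so replacing it by its
  approximation changes nothing up to equivalence in \<open>M\<close>.\<close>

lemma M_tau_gd: "nnil_boxes A \<Longrightarrow> prime_th M_ax w \<Longrightarrow> A \<in> w \<longleftrightarrow> tau A \<in> w"
proof (induction A arbitrary: w)
  case (Box A)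
  have "deriv M_ax (Imp A (tau A))" "deriv M_ax (Imp (tau A) A)"
    using Box by (simp_all add: deriv_Imp)
  then have "robust v (tau A) \<longleftrightarrow> robust v A" for v using robust_mp by blast
  then have "star (tau A) \<in> v \<longleftrightarrow> A \<in> v" if "prime_th M_ax v" for v
    using that Box.prems by (simp add: star_ok robust_nn)
  then have "deriv M_ax (Imp A (star (tau A)))" "deriv M_ax (Imp (star (tau A)) A)"
    by (simp_all add: deriv_Imp)
  then show ?case using prime_th_Box_thm[OF Box.prems(2)] by auto
qed (simp_all add: prime_th_simps)

lemma Hsigma_gd_imp_M: "Hsigma A \<Longrightarrow> nnil_boxes A \<Longrightarrow> deriv M_ax A"
  using Hsigma_imp_M M_tau_gd by (simp add: deriv_pt)

section \<open>The box translation\<close>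

fun box_tr :: "form \<Rightarrow> form" where
  "box_tr (Var p) = Var p"
| "box_tr Bot = Bot"
| "box_tr (And A B) = And (box_tr A) (box_tr B)"
| "box_tr (Or A B) = Or (box_tr A) (box_tr B)"
| "box_tr (Imp A B) = boxdot (Imp (box_tr A) (box_tr B))"
| "box_tr (Box A) = Box (box_tr A)"

text \<open>Only the contents of boxes are translated. \<open>M\<close> grants
  \<open>A \<rightarrow> \<box>A\<close> only there, so implications outside all boxes must remain
  plain.\<close>

fun outer_tr :: "form \<Rightarrow> form" where
  "outer_tr (And A B) = And (outer_tr A) (outer_tr B)"
| "outer_tr (Or A B) = Or (outer_tr A) (outer_tr B)"
| "outer_tr (Imp A B) = Imp (outer_tr A) (outer_tr B)"
| "outer_tr A = box_tr A"

abbreviation prime_H :: "form set \<Rightarrow> bool" where "prime_H \<equiv> prime_th Hsigma_ax"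

lemma H_Loeb: "deriv Hsigma_ax (Imp (Box (Imp (Box A) A)) (Box A))"
  and H_lt: "deriv Hsigma_ax (Imp (Box A) (Box (lt A)))"
  and H_atomic: "atomic p \<Longrightarrow> deriv Hsigma_ax (Imp p (Box p))"
  by (rule ax_extra, auto simp: Hsigma_ax_def)+

lemma prime_th_boxdot: "prime_th Ax w \<Longrightarrow> boxdot A \<in> w \<longleftrightarrow> A \<in> w \<and> Box A \<in> w"
  by (simp add: boxdot_def prime_th_And)

lemma prime_th_Box_boxdot: "prime_th Ax w \<Longrightarrow> Box (boxdot A) \<in> w \<longleftrightarrow> Box A \<in> w"
  by (auto simp: boxdot_def prime_th_Box_And prime_th_Box4)

text \<open>This interprets the characteristic axiom of \<open>C\<close>: atoms persist by their
  axiom, boxes by transitivity, and implications because \<open>boxdot\<close> supplies their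
  box.\<close>

lemma box_tr_persist: "prime_H w \<Longrightarrow> box_tr A \<in> w \<Longrightarrow> Box (box_tr A) \<in> w"
proof (induction A arbitrary: w)
  case (Var p)
  show ?case by (rule prime_th_thm_mp[OF Var(1) H_atomic]) (use Var in simp_all)
next
  case Bot
  then show ?case by (simp add: prime_th_Bot)
next
  case (And A B)
  then show ?case by (simp add: prime_th_Box_And prime_th_And)
next
  case (Or A B)
  then show ?case using prime_th_Box_thm[OF Or.prems(1) ax_or1] prime_th_Box_thm[OF Or.prems(1) ax_or2]
    by (auto simp: prime_th_Or)
next
  case (Imp A B)
  then show ?case by (simp add: prime_th_boxdot prime_th_Box_boxdot)
next
  case (Box A)
  then show ?case by (simp add: prime_th_Box4)
qed

text \<open>Introduction rule for translated implications: an implication derived from a context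
  that implies its own box may itself be boxed.\<close>

lemma boxdot_ImpI:
  assumes "prime_H w" "P \<in> w" "\<And>v. prime_H v \<Longrightarrow> P \<in> v \<Longrightarrow> Box P \<in> v"
    and "\<And>v. prime_H v \<Longrightarrow> P \<in> v \<Longrightarrow> A \<in> v \<Longrightarrow> B \<in> v"
  shows "boxdot (Imp A B) \<in> w"
proof -
  have "deriv Hsigma_ax (Imp P (Imp A B))"
    using assms(4) by (auto simp: deriv_Imp prime_th_Imp)
  then show ?thesis
    using prime_th_thm_mp[OF assms(1) _ assms(2)] prime_th_Box_thm[OF assms(1) _ assms(3)[OF assms(1,2)]]
    by (simp add: prime_th_boxdot[OF assms(1)])
qed

lemma boxdot_Imp_deriv:
  assumes "\<And>w. prime_H w \<Longrightarrow> A \<in> w \<Longrightarrow> B \<in> w" shows "deriv Hsigma_ax (boxdot (Imp A B))"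
proof -
  have "deriv Hsigma_ax (Imp A B)" using assms by (simp add: deriv_Imp)
  moreover from this have "deriv Hsigma_ax (Box (Imp A B))" by (rule nec)
  ultimately show ?thesis by (simp add: deriv_pt prime_th_boxdot)
qed

lemma boxdot_mp: "prime_H w \<Longrightarrow> boxdot (Imp A B) \<in> w \<Longrightarrow> A \<in> w \<Longrightarrow> B \<in> w"
  by (rule prime_th_mp[of Hsigma_ax w A B]) (simp_all add: prime_th_boxdot)

lemma boxdot_persist: "prime_H w \<Longrightarrow> boxdot A \<in> w \<Longrightarrow> Box (boxdot A) \<in> w"
  by (simp add: prime_th_boxdot prime_th_Box_boxdot)

lemma boxdot_ImpI2:
  assumes "prime_H w" "boxdot P \<in> w"
    and "\<And>v. prime_H v \<Longrightarrow> boxdot P \<in> v \<Longrightarrow> boxdot Q \<in> v \<Longrightarrow> A \<in> v \<Longrightarrow> B \<in> v"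
  shows "boxdot (Imp (boxdot Q) (boxdot (Imp A B))) \<in> w"
proof (rule boxdot_ImpI[OF assms(1,2) boxdot_persist])
  fix v assume v: "prime_H v" "boxdot P \<in> v" "boxdot Q \<in> v"
  show "boxdot (Imp A B) \<in> v"
  proof (rule boxdot_ImpI[of v "And (boxdot P) (boxdot Q)"])
    show "Box (And (boxdot P) (boxdot Q)) \<in> u" if "prime_H u" "And (boxdot P) (boxdot Q) \<in> u" for u
      using that boxdot_persist by (simp add: prime_th_Box_And prime_th_And)
  qed (use v assms(3) in \<open>simp_all add: prime_th_And\<close>)
qed

lemma Box_boxdot_mp: "prime_H w \<Longrightarrow> Box (boxdot (Imp A B)) \<in> w \<Longrightarrow> Box A \<in> w \<Longrightarrow> Box B \<in> w"
  by (rule prime_th_Box_mp[of Hsigma_ax w A B]) (simp_all add: prime_th_Box_boxdot)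

lemma C_bt: "deriv C_ax A \<Longrightarrow> deriv Hsigma_ax (box_tr A)"
proof (induction rule: deriv.induct)
  case (ax_extra A)
  then consider B where "A = Imp (Box (Imp (Box B) B)) (Box B)" | B where "A = Imp B (Box B)"
    unfolding C_ax_def by blast
  then show ?case
  proof cases
    case 1
    have "Box (box_tr B) \<in> w" if "prime_H w" "Box (boxdot (Imp (Box (box_tr B)) (box_tr B))) \<in> w" for w
    proof (rule prime_th_thm_mp[OF that(1) H_Loeb])
      show "Box (Imp (Box (box_tr B)) (box_tr B)) \<in> w" using that by (simp add: prime_th_Box_boxdot)
    qed
    then show ?thesis unfolding 1 box_tr.simps by (rule boxdot_Imp_deriv)
  next
    case 2
    show ?thesis unfolding 2 box_tr.simps by (rule boxdot_Imp_deriv) (rule box_tr_persist)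
  qed
next
  case (ax_k1 A B)
  show ?case unfolding box_tr.simps
    by (rule boxdot_Imp_deriv, erule (1) boxdot_ImpI) (simp_all add: box_tr_persist)
next
  case (ax_s A B C)
  show ?case unfolding box_tr.simps
  proof (rule boxdot_Imp_deriv, erule (1) boxdot_ImpI2)
    fix v assume v: "prime_H v" "boxdot (Imp (box_tr A) (boxdot (Imp (box_tr B) (box_tr C)))) \<in> v"
      "boxdot (Imp (box_tr A) (box_tr B)) \<in> v" "box_tr A \<in> v"
    show "box_tr C \<in> v"
      using boxdot_mp[OF v(1) boxdot_mp[OF v(1,2,4)] boxdot_mp[OF v(1,3,4)]] .
  qed
next
  case (ax_andI A B)
  show ?case unfolding box_tr.simps
    by (rule boxdot_Imp_deriv, erule (1) boxdot_ImpI) (simp_all add: box_tr_persist prime_th_And)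
next
  case (ax_orE A C B)
  show ?case unfolding box_tr.simps
  proof (rule boxdot_Imp_deriv, erule (1) boxdot_ImpI2)
    fix v assume v: "prime_H v" "boxdot (Imp (box_tr A) (box_tr C)) \<in> v" "boxdot (Imp (box_tr B) (box_tr C)) \<in> v"
      "Or (box_tr A) (box_tr B) \<in> v"
    show "box_tr C \<in> v" using v boxdot_mp[OF v(1,2)] boxdot_mp[OF v(1,3)] by (auto simp: prime_th_Or)
  qed
next
  case (ax_K A B)
  show ?case unfolding box_tr.simps
  proof (rule boxdot_Imp_deriv, erule (1) boxdot_ImpI)
    show "Box B' \<in> v \<Longrightarrow> prime_H v \<Longrightarrow> Box (Box B') \<in> v" for B' v by (rule prime_th_Box4)
  qed (rule Box_boxdot_mp)
next
  case (mp A B)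
  then have "deriv Hsigma_ax (Imp (box_tr A) (box_tr B))"
    by (simp add: deriv_pt prime_th_boxdot)
  then show ?case using mp.IH(2) by (rule deriv.mp)
next
  case (nec A)
  show ?case unfolding box_tr.simps using nec.IH by (rule deriv.nec)
qed (unfold box_tr.simps, (rule boxdot_Imp_deriv, simp add: prime_th_And prime_th_Or prime_th_Bot prime_th_Box4)+)

lemma M_be: "deriv M_ax A \<Longrightarrow> deriv Hsigma_ax (outer_tr A)"
proof (induction rule: deriv.induct)
  case (ax_extra A)
  then consider B where "A = Imp (Box (Imp (Box B) B)) (Box B)"
    | p where "atomic p" "A = Imp p (Box p)" | B where "A = Box (Imp B (Box B))"
    unfolding M_ax_def by blast
  then show ?case
  proof cases
    case 1
    have "Box (box_tr B) \<in> w" if "prime_H w" "Box (boxdot (Imp (Box (box_tr B)) (box_tr B))) \<in> w" for w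
    proof (rule prime_th_thm_mp[OF that(1) H_Loeb])
      show "Box (Imp (Box (box_tr B)) (box_tr B)) \<in> w" using that by (simp add: prime_th_Box_boxdot)
    qed
    then show ?thesis by (simp add: 1 deriv_Imp)
  next
    case 2
    then show ?thesis using H_atomic by (cases p) auto
  next
    case 3
    show ?thesis unfolding 3 outer_tr.simps box_tr.simps
      by (rule nec, rule boxdot_Imp_deriv, rule box_tr_persist)
  qed
next
  case (ax_K A B)
  have "Box (box_tr B) \<in> v" if "prime_H v" "w \<subseteq> v" "Box (boxdot (Imp (box_tr A) (box_tr B))) \<in> w" "Box (box_tr A) \<in> v" for w v
    using Box_boxdot_mp[OF that(1) subsetD[OF that(2,3)] that(4)] .
  then show ?case by (auto simp: deriv_Imp prime_th_Imp)
next
  case (mp A B)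
  have "deriv Hsigma_ax (Imp (outer_tr A) (outer_tr B))" using mp.IH(1) by simp
  then show ?case using mp.IH(2) by (rule deriv.mp)
next
  case (nec A)
  \<comment> \<open>Necessitation enters a box, so the induction hypothesis on
    \<open>outer_tr\<close> gives way to the translation of \<open>A\<close> as a theorem of the
    stronger \<open>C\<close>.\<close>
  have "deriv C_ax A" using nec.hyps M_C by (rule deriv_mono)
  then show ?case by (simp add: deriv.nec C_bt)
qed (unfold outer_tr.simps box_tr.simps, (fact deriv.intros)+)

lemma noi_bt: "noi A \<Longrightarrow> box_tr A = outer_tr A"
  by (induction A) auto

text \<open>The three claims are proved together, since equivalence at a box uses the other two for
  its content: \<open>Box A\<close> gives \<open>Box (lt A)\<close> by Leivant's axiom, hence
  \<open>Box (boxdot (lt A))\<close>, hence \<open>Box (box_tr A)\<close>, and this gives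
  \<open>Box A\<close> back.\<close>

lemma nnil_boxes_be:
  assumes "nnil_boxes A" "prime_H w"
  shows "A \<in> w \<longleftrightarrow> outer_tr A \<in> w"
    and "nnil A \<Longrightarrow> box_tr A \<in> w \<Longrightarrow> A \<in> w"
    and "nnil A \<Longrightarrow> boxdot (lt A) \<in> w \<Longrightarrow> box_tr A \<in> w"
proof -
  have "(A \<in> w \<longleftrightarrow> outer_tr A \<in> w) \<and> (nnil A \<longrightarrow> (box_tr A \<in> w \<longrightarrow> A \<in> w) \<and> (boxdot (lt A) \<in> w \<longrightarrow> box_tr A \<in> w))"
    using assms
  proof (induction A arbitrary: w)
    case (And A B)
    then show ?case by (auto simp: prime_th_And prime_th_boxdot prime_th_Box_And)
  next
    case (Or A B)
    then show ?case by (auto simp: prime_th_Or prime_th_boxdot)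
  next
    case (Imp A B)
    note w = Imp.prems(2)
    have A: "A \<in> v \<longleftrightarrow> outer_tr A \<in> v" and B: "B \<in> v \<longleftrightarrow> outer_tr B \<in> v" if "prime_H v" for v
      using Imp that by auto
    have "box_tr (Imp A B) \<in> w \<longrightarrow> Imp A B \<in> w" if nnil: "nnil (Imp A B)"
    proof -
      have "B \<in> v" if v: "prime_H v" "w \<subseteq> v" "A \<in> v" "Imp (box_tr A) (box_tr B) \<in> w" for v
      proof -
        have "box_tr A \<in> v" using A[OF v(1)] v(3) nnil by (simp add: noi_bt)
        then have "box_tr B \<in> v" using prime_th_mp[OF v(1)] v(2,4) by blast
        then show ?thesis using Imp.IH(2)[OF _ v(1)] Imp.prems(1) nnil by auto
      qed
      then show ?thesis using w by (auto simp: prime_th_boxdot prime_th_Imp[of _ w A B])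
    qed
    moreover have "box_tr (Imp A B) \<in> w" if nnil: "nnil (Imp A B)" and l: "boxdot (lt (Imp A B)) \<in> w"
    proof -
      have noi: "noi A" "box_tr A = outer_tr A" using nnil by (simp_all add: noi_bt)
      have bA: "deriv Hsigma_ax (Imp (box_tr A) A)" using A noi by (simp add: deriv_Imp)
      show ?thesis unfolding box_tr.simps
      \<comment> \<open>The persistent context is \<open>boxdot (lt (Imp A B))\<close>. The NOI
        premise \<open>A\<close> has equal inner and outer translations, so \<open>box_tr A\<close>
        yields both \<open>A\<close> and \<open>Box A\<close>, and with the context
        \<open>boxdot (lt B)\<close>.\<close>
      proof (rule boxdot_ImpI[OF w l boxdot_persist])
        fix v assume v: "prime_H v" "boxdot (lt (Imp A B)) \<in> v" "box_tr A \<in> v"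
        have "A \<in> v" using A[OF v(1)] noi v(3) by simp
        moreover have "Box A \<in> v" using prime_th_Box_thm[OF v(1) bA] box_tr_persist[OF v(1,3)] by blast
        moreover have "Imp A (lt B) \<in> v" "Box (Imp A (lt B)) \<in> v"
          using v noi by (simp_all add: prime_th_boxdot)
        ultimately have "boxdot (lt B) \<in> v"
          using prime_th_mp[OF v(1), of A "lt B"] prime_th_Box_mp[OF v(1), of A "lt B"] by (simp add: prime_th_boxdot[OF v(1)])
        then show "box_tr B \<in> v" using Imp.IH(2)[OF _ v(1)] Imp.prems(1) nnil by simp
      qed
    qed
    ultimately show ?case using A B w by (simp add: prime_th_Imp)
  next
    case (Box A)
    note w = Box.prems(2)
    have 1: "deriv Hsigma_ax (Imp (box_tr A) A)" "deriv Hsigma_ax (Imp (boxdot (lt A)) (box_tr A))"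
    proof -
      have "box_tr A \<in> v \<Longrightarrow> A \<in> v" "boxdot (lt A) \<in> v \<Longrightarrow> box_tr A \<in> v" if "prime_H v" for v
        using Box.IH[OF _ that] Box.prems(1) by auto
      then show "deriv Hsigma_ax (Imp (box_tr A) A)" "deriv Hsigma_ax (Imp (boxdot (lt A)) (box_tr A))"
        by (simp_all add: deriv_Imp)
    qed
    have "Box A \<in> w \<longleftrightarrow> Box (box_tr A) \<in> w"
    proof
      assume "Box A \<in> w"
      then have "Box (lt A) \<in> w" by (rule prime_th_thm_mp[OF w H_lt])
      then have "Box (boxdot (lt A)) \<in> w" using w by (simp add: prime_th_Box_boxdot)
      then show "Box (box_tr A) \<in> w" by (rule prime_th_Box_thm[OF w 1(2)])
    qed (rule prime_th_Box_thm[OF w 1(1)])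
    then show ?case using w by (auto simp: prime_th_boxdot)
  qed (simp_all add: prime_th_boxdot)
  then show "A \<in> w \<longleftrightarrow> outer_tr A \<in> w" "nnil A \<Longrightarrow> box_tr A \<in> w \<Longrightarrow> A \<in> w"
    "nnil A \<Longrightarrow> boxdot (lt A) \<in> w \<Longrightarrow> box_tr A \<in> w" by blast+
qed

lemma M_gd_imp_Hsigma: "deriv M_ax A \<Longrightarrow> nnil_boxes A \<Longrightarrow> Hsigma A"
proof -
  assume A: "deriv M_ax A" "nnil_boxes A"
  have "A \<in> w" if w: "prime_H w" for w
    using nnil_boxes_be(1)[OF A(2) w] prime_th_thm[OF w M_be[OF A(1)]] by blast
  then show "Hsigma A" by (simp add: Hsigma_def deriv_pt)
qed

text \<open>The witness is \<open>tau A\<close>. Quantifying over \<open>B\<close> hides it, and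
  each of the three conditions on \<open>B\<close> can be confirmed by a search.\<close>

lemma not_Hsigma_iff: "\<not> Hsigma A \<longleftrightarrow> (\<exists>B. nnil_boxes B \<and> Hsigma (Imp A B) \<and> \<not> deriv M_ax B)"
proof
  assume A: "\<not> Hsigma A"
  have "Hsigma (Imp A (tau A))" "Hsigma (Imp (tau A) A)"
    unfolding Hsigma_def deriv_Imp by (simp_all add: Hsigma_tau[symmetric])
  moreover have "\<not> deriv M_ax (tau A)"
  proof
    assume "deriv M_ax (tau A)"
    then have "Hsigma (tau A)" using nnil_boxes_tau by (rule M_gd_imp_Hsigma)
    with calculation(2) have "Hsigma A" unfolding Hsigma_def by (rule mp)
    with A show False ..
  qed
  ultimately show "\<exists>B. nnil_boxes B \<and> Hsigma (Imp A B) \<and> \<not> deriv M_ax B" using nnil_boxes_tau by blast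
next
  assume "\<exists>B. nnil_boxes B \<and> Hsigma (Imp A B) \<and> \<not> deriv M_ax B"
  then obtain B where B: "nnil_boxes B" "Hsigma (Imp A B)" "\<not> deriv M_ax B" by blast
  have "Hsigma B" if "Hsigma A"
    using B(2) that unfolding Hsigma_def by (rule mp)
  then show "\<not> Hsigma A" using B Hsigma_gd_imp_M by blast
qed

section \<open>Finite models\<close>

fun kripke :: "'w set \<Rightarrow> ('w \<Rightarrow> 'w \<Rightarrow> bool) \<Rightarrow> ('w \<Rightarrow> 'w \<Rightarrow> bool) \<Rightarrow> ('w \<Rightarrow> nat \<Rightarrow> bool) \<Rightarrow> 'w \<Rightarrow> form \<Rightarrow> bool" where
  "kripke W L R V w (Var p) \<longleftrightarrow> V w p"
| "kripke W L R V w Bot \<longleftrightarrow> False"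
| "kripke W L R V w (And A B) \<longleftrightarrow> kripke W L R V w A \<and> kripke W L R V w B"
| "kripke W L R V w (Or A B) \<longleftrightarrow> kripke W L R V w A \<or> kripke W L R V w B"
| "kripke W L R V w (Imp A B) \<longleftrightarrow> (\<forall>v\<in>W. L w v \<longrightarrow> kripke W L R V v A \<longrightarrow> kripke W L R V v B)"
| "kripke W L R V w (Box A) \<longleftrightarrow> (\<forall>v\<in>W. R w v \<longrightarrow> kripke W L R V v A)"

text \<open>The hypothesis \<open>inner\<close> is what \<open>M\<close> asks beyond the usual frame
  conditions: at an \<open>L\<close>-extension of an \<open>R\<close>-successor, further
  \<open>R\<close>-successors are also \<open>L\<close>-successors, so truth persists to them. The
  measure \<open>\<mu>\<close> gives Loeb's axiom.\<close>

lemma kripke_sound: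
  fixes W :: "'w set" and \<mu> :: "'w \<Rightarrow> nat"
  assumes "deriv M_ax A" "w \<in> W"
    and L_refl: "\<And>w. L w w"
    and L_trans: "\<And>u v w. L u v \<Longrightarrow> L v w \<Longrightarrow> L u w"
    and L_R: "\<And>u v w. L u v \<Longrightarrow> R v w \<Longrightarrow> R u w"
    and R_trans: "\<And>u v w. R u v \<Longrightarrow> R v w \<Longrightarrow> R u w"
    and R_wf: "\<And>u v. R u v \<Longrightarrow> \<mu> v < \<mu> u"
    and L_V: "\<And>u v p. L u v \<Longrightarrow> V u p \<Longrightarrow> V v p"
    and R_V: "\<And>u v p. R u v \<Longrightarrow> V u p \<Longrightarrow> V v p"
    and inner: "\<And>u v w x. R u v \<Longrightarrow> L v w \<Longrightarrow> R w x \<Longrightarrow> L w x"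
  shows "kripke W L R V w A"
proof -
  let ?f = "kripke W L R V"
  have persist: "?f v A" if "?f u A" "L u v" for u v A
    using that
  proof (induction A)
    case (Imp A B)
    then show ?case using L_trans[OF Imp.prems(2)] by simp
  next
    case (Box A)
    then show ?case using L_R[OF Box.prems(2)] by simp
  qed (auto dest: L_V)
  show ?thesis using assms(1,2)
  proof (induction arbitrary: w rule: deriv.induct)
    case (ax_extra A)
    then consider B where "A = Imp (Box (Imp (Box B) B)) (Box B)"
      | p where "atomic p" "A = Imp p (Box p)" | B where "A = Box (Imp B (Box B))"
      unfolding M_ax_def by blast
    then show ?case
    proof cases
      case 1
      have "?f u B" if "u \<in> W" "R v u" "\<forall>u\<in>W. R v u \<longrightarrow> ?f u (Imp (Box B) B)" for u v
        using that
      proof (induction "\<mu> u" arbitrary: u rule: less_induct)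
        case less
        have "?f x B" if "x \<in> W" "R u x" for x
          using less.hyps[OF R_wf[OF that(2)] that(1) R_trans[OF less.prems(2) that(2)] less.prems(3)] .
        then have "?f u (Box B)" by simp
        moreover have "?f u (Imp (Box B) B)" using less.prems by blast
        ultimately show ?case using L_refl[of u] less.prems(1) by simp
      qed
      then show ?thesis unfolding 1 by (simp only: kripke.simps(5,6)) blast
    next
      case 2
      then show ?thesis using R_V by (cases p) auto
    next
      case 3
      have "?f x B" if "R w v" "L v u" "?f u B" "R u x" for u v x
        using persist[OF that(3) inner[OF that(1,2,4)]] .
      then show ?thesis unfolding 3 by simp
    qed
  next
    case (ax_k1 A B)
    show ?case using persist[of _ A] by simp
  next
    case (ax_s A B C)
    have "?f x C" if "u \<in> W" "\<forall>v\<in>W. L u v \<longrightarrow> ?f v A \<longrightarrow> (\<forall>x\<in>W. L v x \<longrightarrow> ?f x B \<longrightarrow> ?f x C)"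
      "v \<in> W" "L u v" "\<forall>x\<in>W. L v x \<longrightarrow> ?f x A \<longrightarrow> ?f x B" "x \<in> W" "L v x" "?f x A" for u v x
    proof -
      have "?f x B" using that(5-8) by simp
      then show ?thesis using that(2,6,8) L_trans[OF that(4,7)] L_refl[of x] by simp
    qed
    then show ?case by simp
  next
    case (ax_andI A B)
    show ?case using persist[of _ A] by simp
  next
    case (ax_orE A C B)
    have "?f x C" if "\<forall>v\<in>W. L u v \<longrightarrow> ?f v A \<longrightarrow> ?f v C" "x \<in> W" "L u v" "L v x" "?f x A" for u v x A
      using that(1,2,5) L_trans[OF that(3,4)] by simp
    then show ?case by simp
  next
    case (ax_K A B)
    have "?f x B" if "\<forall>v\<in>W. R u v \<longrightarrow> (\<forall>x\<in>W. L v x \<longrightarrow> ?f x A \<longrightarrow> ?f x B)" "L u v"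
      "\<forall>x\<in>W. R v x \<longrightarrow> ?f x A" "x \<in> W" "R v x" for u v x
      using that(1,3-5) L_R[OF that(2,5)] L_refl[of x] by simp
    then show ?case by simp
  next
    case (ax_4 A)
    have "?f x A" if "\<forall>v\<in>W. R u v \<longrightarrow> ?f v A" "R u v" "x \<in> W" "R v x" for u v x
      using that(1,3) R_trans[OF that(2,4)] by simp
    then show ?case by simp
  next
    case (mp A B)
    have "?f w (Imp A B)" "?f w A" using mp.IH mp.prems by blast+
    then show ?case using L_refl[of w] mp.prems by simp
  qed simp_all
qed

section \<open>Coded finite models\<close>

abbreviation cVar :: "nat \<Rightarrow> nat" where "cVar p \<equiv> prod_encode (0, p)"
abbreviation cBot :: nat where "cBot \<equiv> prod_encode (1, 0)"
abbreviation cAnd :: "nat \<Rightarrow> nat \<Rightarrow> nat" where "cAnd a d \<equiv> prod_encode (2, prod_encode (a, d))"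
abbreviation cOr :: "nat \<Rightarrow> nat \<Rightarrow> nat" where "cOr a d \<equiv> prod_encode (3, prod_encode (a, d))"
abbreviation cImp :: "nat \<Rightarrow> nat \<Rightarrow> nat" where "cImp a d \<equiv> prod_encode (4, prod_encode (a, d))"
abbreviation cBox :: "nat \<Rightarrow> nat" where "cBox a \<equiv> prod_encode (5, a)"

lemma prod_encode_ge: "k + m \<le> prod_encode (k, m)"
proof -
  have le: "n \<le> triangle n" for n by (induction n) auto
  show ?thesis using le[of "k + m"] by (simp add: prod_encode_def)
qed

lemma p2_less: "p1 n \<noteq> 0 \<Longrightarrow> p2 n < n"
  using prod_encode_ge[of "p1 n" "p2 n"] by simp

lemma p1_le: "p1 n \<le> n" and p2_le: "p2 n \<le> n"
  using prod_encode_ge[of "p1 n" "p2 n"] by simp_all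

lemma p1_p2_less: "p1 n \<noteq> 0 \<Longrightarrow> p1 (p2 n) < n" and p2_p2_less: "p1 n \<noteq> 0 \<Longrightarrow> p2 (p2 n) < n"
  using p2_less[of n] p1_le[of "p2 n"] p2_le[of "p2 n"] by simp_all

text \<open>A total left inverse of \<open>code\<close>; numbers that are not codes are read as arbitrary formulas.\<close>

function dec :: "nat \<Rightarrow> form" where
  "dec n =
    (if p1 n = 0 then Var (p2 n) else if p1 n = 1 then Bot
    else if p1 n = 2 then And (dec (p1 (p2 n))) (dec (p2 (p2 n)))
    else if p1 n = 3 then Or (dec (p1 (p2 n))) (dec (p2 (p2 n)))
    else if p1 n = 4 then Imp (dec (p1 (p2 n))) (dec (p2 (p2 n)))
    else Box (dec (p2 n)))"
  by pat_completeness simp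
termination
proof (relation "measure id")
qed (simp_all add: p2_less p1_p2_less p2_p2_less)

declare dec.simps [simp del]

lemma dec_simps [simp]:
  "dec (cVar p) = Var p" "dec (prod_encode (1, m)) = Bot" "dec (cAnd a d) = And (dec a) (dec d)"
  "dec (cOr a d) = Or (dec a) (dec d)" "dec (cImp a d) = Imp (dec a) (dec d)" "dec (cBox a) = Box (dec a)"
  by (subst dec.simps; simp)+

lemma dec_Bot [simp]: "dec (prod_encode (Suc 0, m)) = Bot"
  using dec_simps(2) by simp

lemma dec_code [simp]: "dec (code A) = A"
  by (induction A) simp_all

lemma cAnd_ge: "a \<le> prod_encode (k, prod_encode (a, d))" "d \<le> prod_encode (k, prod_encode (a, d))"
  using prod_encode_ge[of k "prod_encode (a, d)"] prod_encode_ge[of a d] by linarith+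

lemma cBox_ge: "a \<le> prod_encode (k, a)"
  using prod_encode_ge[of k a] by linarith

text \<open>A world is coded as a pair of a flag, which is 1 for the worlds that validate \<open>A \<rightarrow> \<box>A\<close>, and
  the finite set of codes up to a bound \<open>b\<close> that it forces.\<close>

definition ft :: "nat \<Rightarrow> nat \<Rightarrow> bool" where "ft w c \<longleftrightarrow> c \<in> set_decode (p2 w)"

definition wle :: "nat \<Rightarrow> nat \<Rightarrow> nat \<Rightarrow> bool" where
  "wle b w v \<longleftrightarrow> p1 w = p1 v \<and> (\<forall>c<Suc b. ft w c \<longrightarrow> ft v c)"

text \<open>The canonical accessibility relation for Loeb's axiom, restricted to codes up to
  \<open>b\<close>. The new boxed formula required at \<open>v\<close> forces termination, and the
  last clause makes \<open>wR\<close> part of the intuitionistic order at flagged worlds.\<close>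

definition wR :: "nat \<Rightarrow> nat \<Rightarrow> nat \<Rightarrow> bool" where
  "wR b w v \<longleftrightarrow> p1 v = 1 \<and> (\<forall>a<Suc b. cBox a \<le> b \<longrightarrow> ft w (cBox a) \<longrightarrow> ft v a \<and> ft v (cBox a))
    \<and> (\<forall>p<Suc b. cVar p \<le> b \<longrightarrow> ft w (cVar p) \<longrightarrow> ft v (cVar p))
    \<and> (\<exists>a<Suc b. cBox a \<le> b \<and> ft v (cBox a) \<and> \<not> ft w (cBox a))
    \<and> (p1 w = 1 \<longrightarrow> (\<forall>c<Suc b. ft w c \<longrightarrow> ft v c))"

text \<open>The recorded set must obey the truth clauses of the model whose worlds are the members
  of \<open>h\<close>. Checking a countermodel thus becomes bounded arithmetic, without evaluating
  formulas recursively.\<close>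

definition world :: "nat \<Rightarrow> nat \<Rightarrow> nat \<Rightarrow> bool" where
  "world b h w \<longleftrightarrow> \<not> (cBot \<le> b \<and> ft w cBot) \<and> (\<forall>a<Suc b. \<forall>d<Suc b.
    (cAnd a d \<le> b \<longrightarrow> (ft w (cAnd a d) \<longleftrightarrow> ft w a \<and> ft w d)) \<and>
    (cOr a d \<le> b \<longrightarrow> (ft w (cOr a d) \<longleftrightarrow> ft w a \<or> ft w d)) \<and>
    (cImp a d \<le> b \<longrightarrow> (ft w (cImp a d) \<longleftrightarrow>
      (\<forall>v<h. v \<in> set_decode h \<longrightarrow> wle b w v \<longrightarrow> ft v a \<longrightarrow> ft v d))) \<and>
    (cBox a \<le> b \<longrightarrow> (ft w (cBox a) \<longleftrightarrow> (\<forall>v<h. v \<in> set_decode h \<longrightarrow> wR b w v \<longrightarrow> ft v a))))"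

text \<open>The code of the refuted formula is also the bound, since subformulas never have larger
  codes than the formula itself.\<close>

definition refut :: "nat \<Rightarrow> bool" where
  "refut b \<longleftrightarrow> (\<exists>h. (\<forall>w<h. w \<in> set_decode h \<longrightarrow> world b h w) \<and> (\<exists>w<h. w \<in> set_decode h \<and> \<not> ft w b))"

lemma bounded_mem: "(\<forall>v<h. v \<in> set_decode h \<longrightarrow> P v) \<longleftrightarrow> (\<forall>v\<in>set_decode h. P v)"
  using set_decode_less[of _ h] by auto

lemma wR_trans:
  assumes "wR b u v" "wR b v w" shows "wR b u w"
proof -
  obtain a where a: "a < Suc b" "cBox a \<le> b" "ft w (cBox a)" "\<not> ft v (cBox a)"
    using assms(2) unfolding wR_def by blast
  then have "\<not> ft u (cBox a)" using assms(1) unfolding wR_def by blast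
  with a have "\<exists>a<Suc b. cBox a \<le> b \<and> ft w (cBox a) \<and> \<not> ft u (cBox a)" by blast
  then show ?thesis using assms unfolding wR_def by simp
qed

lemma wle_wR:
  assumes "wle b u v" "wR b v w" shows "wR b u w"
proof -
  have le: "ft v c" if "c \<le> b" "ft u c" for c using assms(1) that by (simp add: wle_def)
  obtain a where a: "a < Suc b" "cBox a \<le> b" "ft w (cBox a)" "\<not> ft v (cBox a)"
    using assms(2) unfolding wR_def by blast
  then have "\<not> ft u (cBox a)" using le by blast
  with a have "\<exists>a<Suc b. cBox a \<le> b \<and> ft w (cBox a) \<and> \<not> ft u (cBox a)" by blast
  moreover have "p1 u = p1 v" using assms(1) by (simp add: wle_def)
  ultimately show ?thesis using assms(2) le unfolding wR_def by simp
qed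

lemma refut_sound:
  assumes "refut (code B)" shows "\<not> deriv M_ax B"
proof
  assume B: "deriv M_ax B"
  let ?b = "code B"
  obtain h w where h: "\<And>w. w \<in> set_decode h \<Longrightarrow> world ?b h w"
    and w: "w \<in> set_decode h" "\<not> ft w ?b"
    using assms set_decode_less unfolding refut_def by blast
  let ?W = "set_decode h" and ?V = "\<lambda>w p. cVar p \<le> ?b \<and> ft w (cVar p)"
  let ?f = "kripke ?W (wle ?b) (wR ?b) ?V"
  \<comment> \<open>Along \<open>wR\<close> no boxed formula below the bound is lost and at least
    one is gained, so the number of missing ones drops.\<close>
  let ?\<mu> = "\<lambda>w. card {a. a < Suc ?b \<and> cBox a \<le> ?b \<and> \<not> ft w (cBox a)}"
  have "?f w B"
  proof (rule kripke_sound[OF B w(1), where \<mu> = ?\<mu>])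
    show "wle ?b w w" for w by (simp add: wle_def)
    show "wle ?b u v \<Longrightarrow> wle ?b v w \<Longrightarrow> wle ?b u w" for u v w by (simp add: wle_def)
    show "wle ?b u v \<Longrightarrow> wR ?b v w \<Longrightarrow> wR ?b u w" for u v w by (rule wle_wR)
    show "wR ?b u v \<Longrightarrow> wR ?b v w \<Longrightarrow> wR ?b u w" for u v w by (rule wR_trans)
    show "?\<mu> v < ?\<mu> u" if uv: "wR ?b u v" for u v
    proof (rule psubset_card_mono)
      have "{a. a < Suc ?b \<and> cBox a \<le> ?b \<and> \<not> ft v (cBox a)} \<subseteq> {a. a < Suc ?b \<and> cBox a \<le> ?b \<and> \<not> ft u (cBox a)}"
        using uv unfolding wR_def by blast
      moreover obtain a where "a < Suc ?b" "cBox a \<le> ?b" "ft v (cBox a)" "\<not> ft u (cBox a)"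
        using uv unfolding wR_def by blast
      ultimately show "{a. a < Suc ?b \<and> cBox a \<le> ?b \<and> \<not> ft v (cBox a)} \<subset> {a. a < Suc ?b \<and> cBox a \<le> ?b \<and> \<not> ft u (cBox a)}"
        by blast
    qed simp
    show "?V v p" if "wle ?b u v" "?V u p" for u v p using that by (simp add: wle_def)
    show "?V v p" if "wR ?b u v" "?V u p" for u v p
      using that le_trans[OF cBox_ge] less_Suc_eq_le unfolding wR_def by blast
    show "wle ?b w x" if "wR ?b u v" "wle ?b v w" "wR ?b w x" for u v w x
      using that by (simp add: wR_def wle_def)
  qed
  moreover have "?f v A \<longleftrightarrow> ft v (code A)" if "code A \<le> ?b" "v \<in> ?W" for A v
    using that
  proof (induction A arbitrary: v)
    case Bot
    then show ?case using h[OF Bot(2)] by (simp add: world_def)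
  next
    case (And A D)
    have b: "code A \<le> ?b" "code D \<le> ?b"
      using And.prems(1) cAnd_ge[of "code A" 2 "code D"] cAnd_ge(2)[of "code D" 2 "code A"] by simp_all
    then show ?case using And h[OF And.prems(2)] unfolding world_def by (simp add: less_Suc_eq_le)
  next
    case (Or A D)
    have b: "code A \<le> ?b" "code D \<le> ?b"
      using Or.prems(1) cAnd_ge[of "code A" 3 "code D"] cAnd_ge(2)[of "code D" 3 "code A"] by simp_all
    then show ?case using Or h[OF Or.prems(2)] unfolding world_def by (simp add: less_Suc_eq_le)
  next
    case (Imp A D)
    have b: "code A \<le> ?b" "code D \<le> ?b"
      using Imp.prems(1) cAnd_ge[of "code A" 4 "code D"] cAnd_ge(2)[of "code D" 4 "code A"] by simp_all
    then show ?case using Imp h[OF Imp.prems(2)] unfolding world_def bounded_mem by (simp add: less_Suc_eq_le)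
  next
    case (Box A)
    have b: "code A \<le> ?b" using Box.prems(1) cBox_ge[of "code A" 5] by simp
    have "ft v (cBox (code A)) \<longleftrightarrow> (\<forall>u\<in>set_decode h. wR ?b v u \<longrightarrow> ft u (code A))"
      using h[OF Box.prems(2)] b Box.prems(1) unfolding world_def bounded_mem by (auto simp: less_Suc_eq_le)
    then show ?case using Box.IH b by simp
  qed simp
  ultimately show False using w by simp
qed

lemma cons_C_Box:
  assumes "prime_th M_ax w" "cons C_ax {X. Box X \<in> w} Y" shows "Box Y \<in> w"
  using assms(2)
proof induction
  case (cons_thm A)
  then show ?case using prime_th_thm[OF assms(1) C_imp_M_Box] by blast
next
  case (cons_mp A B)
  show ?case using prime_th_Box_mp[OF assms(1) cons_mp.IH] .
qed simp

text \<open>If the contents of the boxes in \<open>w\<close> together with \<open>Box A\<close>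
  derived \<open>A\<close> in \<open>C\<close>, Loeb's axiom would put \<open>Box A\<close> into
  \<open>w\<close>. Working in \<open>C\<close> is sound because its theorems are boxed theorems of
  \<open>M\<close>.\<close>

lemma M_successor:
  assumes w: "prime_th M_ax w" "Box A \<notin> w"
  obtains v where "prime_th C_ax v" "A \<notin> v" "Box A \<in> v" "\<And>X. Box X \<in> w \<Longrightarrow> X \<in> v \<and> Box X \<in> v"
    "\<And>p. Var p \<in> w \<Longrightarrow> Var p \<in> v" "prime_th C_ax w \<Longrightarrow> w \<subseteq> v"
proof -
  have "\<not> cons C_ax (insert (Box A) {X. Box X \<in> w}) A"
  proof
    assume "cons C_ax (insert (Box A) {X. Box X \<in> w}) A"
    then have "Box (Imp (Box A) A) \<in> w" by (intro cons_C_Box[OF w(1)] cons_ded)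
    then have "Box A \<in> w" by (rule prime_th_thm_mp[OF w(1) M_Loeb])
    with w(2) show False ..
  qed
  then obtain v where v: "prime_th C_ax v" "insert (Box A) {X. Box X \<in> w} \<subseteq> v" "A \<notin> v" by (rule Lindenbaum)
  show thesis
  proof (rule that[OF v(1,3)])
    show "Box A \<in> v" using v(2) by blast
    show "X \<in> v \<and> Box X \<in> v" if "Box X \<in> w" for X
      using v(2) that prime_th_Box4[OF w(1) that] by blast
    show "Var p \<in> v" if "Var p \<in> w" for p
      using v(2) prime_th_thm_mp[OF w(1) M_atomic that] by auto
    show "w \<subseteq> v" if "prime_th C_ax w"
      using v(2) prime_th_thm_mp[OF that C_Box] by blast
  qed
qed

text \<open>Filtration of the canonical model: a prime theory is cut down to the codes up to
  \<open>b\<close> that it satisfies, leaving finitely many worlds. \<open>wle\<close> and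
  \<open>wR\<close> inspect only these codes and the flag, so the truth clauses survive the
  cut.\<close>

lemma refut_complete:
  assumes "\<not> deriv M_ax B" shows "refut (code B)"
proof -
  define b where "b = code B"
  define enc where "enc k w = prod_encode (k, set_encode {c. c \<le> b \<and> dec c \<in> w})" for k w
  \<comment> \<open>A local notion, distinct from robustness in trees: flag 0 marks prime theories
    of \<open>M\<close>, flag 1 those of \<open>C\<close>.\<close>
  define robust where "robust k w \<longleftrightarrow> (k = 0 \<and> prime_th M_ax w) \<or> (k = Suc 0 \<and> prime_th C_ax w)" for k w
  define W where "W = {enc k w |k w. robust k w}"
  have "W \<subseteq> prod_encode ` ({0, 1} \<times> set_encode ` Pow {..b})"
    unfolding W_def enc_def robust_def by auto
  then have "finite W" by (rule finite_subset) simp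
  then obtain h where h: "set_decode h = W" using set_encode_inverse by blast
  have ft: "ft (enc k w) c \<longleftrightarrow> c \<le> b \<and> dec c \<in> w" for k w c
  proof -
    have "finite {c. c \<le> b \<and> dec c \<in> w}" by (rule finite_subset[of _ "{..b}"]) auto
    then have "set_decode (p2 (enc k w)) = {c. c \<le> b \<and> dec c \<in> w}"
      unfolding enc_def p2_encode by (rule set_encode_inverse)
    then show ?thesis by (simp add: ft_def)
  qed
  have p1: "p1 (enc k w) = k" for k w by (simp add: enc_def)
  have ptM: "prime_th M_ax w" if "robust k w" for k w using that prime_th_C_M unfolding robust_def by blast
  have all_W: "(\<forall>v\<in>W. P v) \<longleftrightarrow> (\<forall>k v. robust k v \<longrightarrow> P (enc k v))" for P unfolding W_def by blast
  have "world b h w" if w: "w \<in> W" for w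
  proof -
    obtain k u where u: "w = enc k u" "robust k u" using w unfolding W_def by blast
    note prime_th = ptM[OF u(2)]
    have cand: "ft w (cAnd a d) \<longleftrightarrow> ft w a \<and> ft w d" if "cAnd a d \<le> b" for a d
      using that le_trans[OF cAnd_ge(1) that] le_trans[OF cAnd_ge(2) that] by (simp add: u ft prime_th_And[OF prime_th])
    have cor: "ft w (cOr a d) \<longleftrightarrow> ft w a \<or> ft w d" if "cOr a d \<le> b" for a d
      using that le_trans[OF cAnd_ge(1) that] le_trans[OF cAnd_ge(2) that] by (simp add: u ft prime_th_Or[OF prime_th])
    have cimp: "ft w (cImp a d) \<longleftrightarrow> (\<forall>v\<in>W. wle b w v \<longrightarrow> ft v a \<longrightarrow> ft v d)" if "cImp a d \<le> b" for a d
    proof -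
      have le: "a \<le> b" "d \<le> b" using le_trans[OF cAnd_ge(1) that] le_trans[OF cAnd_ge(2) that] .
      show ?thesis
      proof
        assume *: "ft w (cImp a d)"
        have "ft (enc j v) d" if "robust j v" "wle b w (enc j v)" "ft (enc j v) a" for j v
        proof -
          have "ft (enc j v) (cImp a d)" using * \<open>cImp a d \<le> b\<close> that(2) by (simp add: wle_def)
          then show ?thesis using that(3) prime_th_mp[OF ptM[OF that(1)], of "dec a" "dec d"] le by (simp add: ft)
        qed
        then show "\<forall>v\<in>W. wle b w v \<longrightarrow> ft v a \<longrightarrow> ft v d" by (simp add: all_W)
      next
        assume *: "\<forall>v\<in>W. wle b w v \<longrightarrow> ft v a \<longrightarrow> ft v d"
        have "dec d \<in> v" if "robust k v" "u \<subseteq> v" "dec a \<in> v" for v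
        proof -
          have "wle b w (enc k v)" using that(2) by (auto simp: wle_def u p1 ft)
          moreover have "ft (enc k v) a" using that(3) le by (simp add: ft)
          moreover have "enc k v \<in> W" using that(1) unfolding W_def by blast
          ultimately have "ft (enc k v) d" using * by blast
          then show ?thesis by (simp add: ft)
        qed
        \<comment> \<open>The extension is taken in the logic named by the flag, so it stays among
          worlds comparable under \<open>wle\<close>.\<close>
        then have "Imp (dec a) (dec d) \<in> u" using u(2) unfolding robust_def by (auto simp: prime_th_Imp)
        then show "ft w (cImp a d)" using \<open>cImp a d \<le> b\<close> by (simp add: u ft)
      qed
    qed
    have cbox: "ft w (cBox a) \<longleftrightarrow> (\<forall>v\<in>W. wR b w v \<longrightarrow> ft v a)" if "cBox a \<le> b" for a
    proof
      have le: "a \<le> b" using le_trans[OF cBox_ge that] .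
      show "ft w (cBox a) \<Longrightarrow> \<forall>v\<in>W. wR b w v \<longrightarrow> ft v a"
        using le that by (auto simp: wR_def less_Suc_eq_le)
      assume *: "\<forall>v\<in>W. wR b w v \<longrightarrow> ft v a"
      show "ft w (cBox a)"
      proof (rule ccontr)
        assume "\<not> ft w (cBox a)"
        then have n: "Box (dec a) \<notin> u" using that by (simp add: u ft)
        obtain v where v: "prime_th C_ax v" "dec a \<notin> v" "Box (dec a) \<in> v"
          "\<And>X. Box X \<in> u \<Longrightarrow> X \<in> v \<and> Box X \<in> v" "\<And>p. Var p \<in> u \<Longrightarrow> Var p \<in> v"
          "prime_th C_ax u \<Longrightarrow> u \<subseteq> v"
          using M_successor[OF prime_th n] by blast
        have "wR b w (enc 1 v)" unfolding wR_def
        proof (intro conjI allI impI)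
          show "\<exists>a<Suc b. cBox a \<le> b \<and> ft (enc 1 v) (cBox a) \<and> \<not> ft w (cBox a)"
            using le that v(3) n by (intro exI[of _ a]) (simp add: u ft)
          show "ft (enc 1 v) c" if "p1 w = 1" "ft w c" for c
            using that u v(6) by (auto simp: p1 ft robust_def)
        qed (use v(4,5) in \<open>auto simp: u p1 ft\<close>)
        moreover have "enc 1 v \<in> W" using v(1) unfolding W_def robust_def by auto
        ultimately have "ft (enc 1 v) a" using * by blast
        then show False using v(2) by (simp add: ft)
      qed
    qed
    have "\<not> ft w cBot" using prime_th_Bot[OF prime_th] by (simp add: u ft)
    then show ?thesis unfolding world_def bounded_mem unfolding h
      by (intro conjI allI impI) (blast, erule cand, erule cor, erule cimp, erule cbox)
  qed
  moreover obtain w where "prime_th M_ax w" "B \<notin> w" using assms unfolding deriv_pt by blast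
  then have "enc 0 w \<in> W" "\<not> ft (enc 0 w) b" unfolding W_def robust_def by (auto simp: ft b_def)
  ultimately have "(\<forall>w<h. w \<in> set_decode h \<longrightarrow> world b h w) \<and> (\<exists>w<h. w \<in> set_decode h \<and> \<not> ft w b)"
    using set_decode_less h by blast
  then show ?thesis unfolding refut_def b_def by blast
qed

section \<open>Semidecidability of derivability and of refutability\<close>

lemma semidecidable_eq: "computable f \<Longrightarrow> computable g \<Longrightarrow> semidecidable (\<lambda>x. f x = g x)"
  by (rule semidecidable_cdp[OF decidable_eq])

lemmas semidecidable_intros = semidecidable_ex semidecidable_conj semidecidable_disj semidecidable_eq computable_const computable_id computable_p1 computable_p2 computable_encode

text \<open>\<open>lfpr\<close> knows only rules with two premises; a rule with one premise uses it
  twice.\<close>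

lemma lfpr_rule1: "R x y y \<Longrightarrow> lfpr A R y \<Longrightarrow> lfpr A R x"
  by (rule lfpr_rule)

section \<open>Syntactic classes and functions as inductive sets of codes\<close>

definition noiN :: "nat \<Rightarrow> bool" where
  "noiN = lfpr (\<lambda>x. (\<exists>p. x = cVar p) \<or> x = cBot \<or> (\<exists>a. x = cBox a))
    (\<lambda>x y z. x = cAnd y z \<or> x = cOr y z)"

lemma semidecidable_noiN: "semidecidable noiN"
  unfolding noiN_def by (rule semidecidable_lfpr) (intro semidecidable_intros)+

lemma noiN_sound: "noiN x \<Longrightarrow> noi (dec x)"
  unfolding noiN_def by (induction rule: lfpr.induct) auto

lemma noiN_complete: "noi A \<Longrightarrow> noiN (code A)"
  unfolding noiN_def
proof (induction A)
  case (And A B)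
  then show ?case by - (rule lfpr_rule[of _ _ "code A" "code B"], auto)
next
  case (Or A B)
  then show ?case by - (rule lfpr_rule[of _ _ "code A" "code B"], auto)
qed (simp_all add: lfpr_ax)

text \<open>The failure of \<open>noi\<close> is defined positively because \<open>lt\<close>
  branches on it and semidecidability is not preserved by negation.\<close>

definition nnoiN :: "nat \<Rightarrow> bool" where
  "nnoiN = lfpr (\<lambda>x. \<exists>a d. x = cImp a d)
    (\<lambda>x y z. \<exists>a. x = cAnd y a \<or> x = cAnd a y \<or> x = cOr y a \<or> x = cOr a y)"

lemma semidecidable_nnoiN: "semidecidable nnoiN"
  unfolding nnoiN_def by (rule semidecidable_lfpr) (intro semidecidable_intros)+

lemma nnoiN_sound: "nnoiN x \<Longrightarrow> \<not> noi (dec x)"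
  unfolding nnoiN_def by (induction rule: lfpr.induct) auto

lemma nnoiN_complete: "\<not> noi A \<Longrightarrow> nnoiN (code A)"
  unfolding nnoiN_def
proof (induction A)
  case (And A B)
  then consider "\<not> noi A" | "\<not> noi B" by auto
  then show ?case
  proof cases
    case 1
    then show ?thesis using And.IH(1) by - (rule lfpr_rule1[of _ _ "code A"], auto)
  next
    case 2
    then show ?thesis using And.IH(2) by - (rule lfpr_rule1[of _ _ "code B"], auto)
  qed
next
  case (Or A B)
  then consider "\<not> noi A" | "\<not> noi B" by auto
  then show ?case
  proof cases
    case 1
    then show ?thesis using Or.IH(1) by - (rule lfpr_rule1[of _ _ "code A"], auto)
  next
    case 2
    then show ?thesis using Or.IH(2) by - (rule lfpr_rule1[of _ _ "code B"], auto)
  qed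
qed (simp_all add: lfpr_ax)

definition nnN :: "nat \<Rightarrow> bool" where
  "nnN = lfpr (\<lambda>x. (\<exists>p. x = cVar p) \<or> x = cBot \<or> (\<exists>a. x = cBox a))
    (\<lambda>x y z. x = cAnd y z \<or> x = cOr y z \<or> (\<exists>a. noiN a \<and> x = cImp a y))"

lemma semidecidable_nnN: "semidecidable nnN"
  unfolding nnN_def by (rule semidecidable_lfpr) (intro semidecidable_intros semidecidable_sub[OF semidecidable_noiN])+

lemma nnN_sound: "nnN x \<Longrightarrow> nnil (dec x)"
  unfolding nnN_def by (induction rule: lfpr.induct) (auto dest: noiN_sound)

lemma nnN_complete: "nnil A \<Longrightarrow> nnN (code A)"
  unfolding nnN_def
proof (induction A)
  case (And A B)
  then show ?case by - (rule lfpr_rule[of _ _ "code A" "code B"], auto)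
next
  case (Or A B)
  then show ?case by - (rule lfpr_rule[of _ _ "code A" "code B"], auto)
next
  case (Imp A B)
  then show ?case using noiN_complete[of A] by - (rule lfpr_rule1[of _ _ "code B"], auto)
qed (simp_all add: lfpr_ax)

definition gdN :: "nat \<Rightarrow> bool" where
  "gdN = lfpr (\<lambda>x. (\<exists>p. x = cVar p) \<or> x = cBot)
    (\<lambda>x y z. x = cAnd y z \<or> x = cOr y z \<or> x = cImp y z \<or> (nnN y \<and> x = cBox y))"

lemma semidecidable_gdN: "semidecidable gdN"
  unfolding gdN_def by (rule semidecidable_lfpr) (intro semidecidable_intros semidecidable_sub[OF semidecidable_nnN])+

text \<open>A genuine code is demanded here, whereas the other soundness lemmas speak of
  \<open>dec x\<close>: \<open>refut\<close> depends on the number itself and is known to be sound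
  for codes.\<close>

lemma gdN_sound: "gdN x \<Longrightarrow> \<exists>A. x = code A \<and> nnil_boxes A"
  unfolding gdN_def
proof (induction rule: lfpr.induct)
  case (lfpr_ax x)
  then show ?case
  proof (elim disjE exE)
    fix p assume "x = cVar p"
    then show ?thesis by (intro exI[of _ "Var p"]) simp
  next
    assume "x = cBot"
    then show ?thesis by (intro exI[of _ Bot]) simp
  qed
next
  case (lfpr_rule x y z)
  then obtain A B where AB: "y = code A" "nnil_boxes A" "z = code B" "nnil_boxes B" by blast
  from lfpr_rule(1) show ?case
  proof (elim disjE conjE)
    assume "x = cAnd y z"
    then show ?thesis using AB by (intro exI[of _ "And A B"]) simp
  next
    assume "x = cOr y z"
    then show ?thesis using AB by (intro exI[of _ "Or A B"]) simp
  next
    assume "x = cImp y z"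
    then show ?thesis using AB by (intro exI[of _ "Imp A B"]) simp
  next
    assume "nnN y" "x = cBox y"
    then show ?thesis using AB nnN_sound[of y] by (intro exI[of _ "Box A"]) simp
  qed
qed

lemma gdN_complete: "nnil_boxes A \<Longrightarrow> gdN (code A)"
  unfolding gdN_def
proof (induction A)
  case (And A B)
  then show ?case by - (rule lfpr_rule[of _ _ "code A" "code B"], auto)
next
  case (Or A B)
  then show ?case by - (rule lfpr_rule[of _ _ "code A" "code B"], auto)
next
  case (Imp A B)
  then show ?case by - (rule lfpr_rule[of _ _ "code A" "code B"], auto)
next
  case (Box A)
  then show ?case using nnN_complete[of A] by - (rule lfpr_rule1[of _ _ "code A"], auto)
qed (simp_all add: lfpr_ax)

definition ltN :: "nat \<Rightarrow> bool" where
  "ltN = lfpr (\<lambda>x. (\<exists>p. x = prod_encode (cVar p, cVar p)) \<or> x = prod_encode (cBot, cBot)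
      \<or> (\<exists>a. x = prod_encode (cBox a, cBox a))
      \<or> (\<exists>a d. nnoiN a \<and> x = prod_encode (cImp a d, cImp a d)))
    (\<lambda>x y z. x = prod_encode (cAnd (p1 y) (p1 z), cAnd (p2 y) (p2 z))
      \<or> x = prod_encode (cOr (p1 y) (p1 z), cOr (cAnd (p2 y) (cBox (p2 y))) (cAnd (p2 z) (cBox (p2 z))))
      \<or> (\<exists>a. noiN a \<and> x = prod_encode (cImp a (p1 y), cImp a (p2 y))))"

lemma semidecidable_ltN: "semidecidable ltN"
  unfolding ltN_def by (rule semidecidable_lfpr) (intro semidecidable_intros semidecidable_sub[OF semidecidable_noiN] semidecidable_sub[OF semidecidable_nnoiN])+

lemma ltN_sound: "ltN x \<Longrightarrow> dec (p2 x) = lt (dec (p1 x))"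
  unfolding ltN_def by (induction rule: lfpr.induct) (auto simp: boxdot_def dest: noiN_sound nnoiN_sound)

lemma ltN_complete: "ltN (prod_encode (code A, code (lt A)))"
  unfolding ltN_def
proof (induction A)
  case (And A B)
  then show ?case
    by - (rule lfpr_rule[of _ _ "prod_encode (code A, code (lt A))" "prod_encode (code B, code (lt B))"], auto)
next
  case (Or A B)
  then show ?case
    by - (rule lfpr_rule[of _ _ "prod_encode (code A, code (lt A))" "prod_encode (code B, code (lt B))"], (auto simp: boxdot_def))
next
  case (Imp A B)
  show ?case
  proof (cases "noi A")
    case True
    then show ?thesis using Imp noiN_complete[OF True]
      by - (rule lfpr_rule1[of _ _ "prod_encode (code B, code (lt B))"], auto)
  next
    case False
    then show ?thesis using nnoiN_complete[OF False] by (intro lfpr_ax) auto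
  qed
qed (simp_all add: lfpr_ax)

definition brkN :: "nat \<Rightarrow> bool" where
  "brkN = lfpr (\<lambda>x. \<exists>b. (\<exists>p. x = prod_encode (b, prod_encode (cVar p, cVar p)))
      \<or> x = prod_encode (b, prod_encode (cBot, cBot))
      \<or> (\<exists>a. x = prod_encode (b, prod_encode (cBox a, cBox a)))
      \<or> (\<exists>a d. x = prod_encode (b, prod_encode (cImp a d, cImp b (cImp a d)))))
    (\<lambda>x y z. p1 y = p1 z \<and>
      (x = prod_encode (p1 y, prod_encode (cAnd (p1 (p2 y)) (p1 (p2 z)), cAnd (p2 (p2 y)) (p2 (p2 z))))
      \<or> x = prod_encode (p1 y, prod_encode (cOr (p1 (p2 y)) (p1 (p2 z)), cOr (p2 (p2 y)) (p2 (p2 z))))))"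

lemma semidecidable_brkN: "semidecidable brkN"
  unfolding brkN_def by (rule semidecidable_lfpr) (intro semidecidable_intros)+

lemma brkN_sound: "brkN x \<Longrightarrow> dec (p2 (p2 x)) = brk (dec (p1 x)) (dec (p1 (p2 x)))"
  unfolding brkN_def by (induction rule: lfpr.induct) auto

lemma brkN_sound': "brkN (prod_encode (b, prod_encode (e, d))) \<Longrightarrow> dec d = brk (dec b) (dec e)"
  using brkN_sound[of "prod_encode (b, prod_encode (e, d))"] by simp

lemma brkN_complete: "brkN (prod_encode (code B, prod_encode (code E, code (brk B E))))"
  unfolding brkN_def
proof (induction E)
  case (And A D)
  then show ?case
    by - (rule lfpr_rule[of _ _ "prod_encode (code B, prod_encode (code A, code (brk B A)))"
        "prod_encode (code B, prod_encode (code D, code (brk B D)))"], auto)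
next
  case (Or A D)
  then show ?case
    by - (rule lfpr_rule[of _ _ "prod_encode (code B, prod_encode (code A, code (brk B A)))"
        "prod_encode (code B, prod_encode (code D, code (brk B D)))"], auto)
qed (simp_all add: lfpr_ax)

text \<open>\<open>visN\<close> holds of the tuple \<open>(B, C, k, d)\<close> if, for some nonempty list \<open>X\<close> of implications, \<open>k\<close>
  is the conjunction of \<open>X\<close> and \<open>d\<close> is the disjunction in rule B2, with \<open>B\<close> in place of
  \<open>k\<close>.\<close>

definition visN :: "nat \<Rightarrow> bool" where
  "visN = lfpr (\<lambda>x. \<exists>b c e f e' c'. brkN (prod_encode (b, prod_encode (e, e')))
      \<and> brkN (prod_encode (b, prod_encode (c, c')))
      \<and> x = prod_encode (prod_encode (b, c), prod_encode (cImp e f, cOr e' c')))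
    (\<lambda>x y z. \<exists>e f e'. brkN (prod_encode (p1 (p1 y), prod_encode (e, e')))
      \<and> x = prod_encode (p1 y, prod_encode (cAnd (cImp e f) (p1 (p2 y)), cOr e' (p2 (p2 y)))))"

lemma semidecidable_visN: "semidecidable visN"
  unfolding visN_def by (rule semidecidable_lfpr) (intro semidecidable_intros semidecidable_sub[OF semidecidable_brkN])+

lemma visN_sound:
  "visN x \<Longrightarrow> \<exists>X. X \<noteq> [] \<and> dec (p1 (p2 x)) = bigand (map impl X)
    \<and> dec (p2 (p2 x)) = bigor (map (brk (dec (p1 (p1 x)))) (map fst X @ [dec (p2 (p1 x))]))"
  unfolding visN_def
proof (induction rule: lfpr.induct)
  case (lfpr_ax x)
  then obtain b c e f e' c' where *: "brkN (prod_encode (b, prod_encode (e, e')))"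
    "brkN (prod_encode (b, prod_encode (c, c')))"
    "x = prod_encode (prod_encode (b, c), prod_encode (cImp e f, cOr e' c'))" by blast
  then show ?case by (intro exI[of _ "[(dec e, dec f)]"]) (simp add: brkN_sound')
next
  case (lfpr_rule x y z)
  then obtain e f e' where *: "brkN (prod_encode (p1 (p1 y), prod_encode (e, e')))"
    "x = prod_encode (p1 y, prod_encode (cAnd (cImp e f) (p1 (p2 y)), cOr e' (p2 (p2 y))))" by blast
  obtain X where X: "X \<noteq> []" "dec (p1 (p2 y)) = bigand (map impl X)"
    "dec (p2 (p2 y)) = bigor (map (brk (dec (p1 (p1 y)))) (map fst X @ [dec (p2 (p1 y))]))"
    using lfpr_rule.IH(1) by blast
  obtain u Y where Y: "X = u # Y" using X(1) by (cases X) auto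
  have "bigand (map impl ((dec e, dec f) # X)) = And (Imp (dec e) (dec f)) (bigand (map impl X))"
    by (simp add: Y)
  moreover have "bigor (map B (map fst ((dec e, dec f) # X) @ [C])) = Or (B (dec e)) (bigor (map B (map fst X @ [C])))" for B C
    by (simp add: Y)
  ultimately show ?case using X *(2) brkN_sound'[OF *(1)]
    by (intro exI[of _ "(dec e, dec f) # X"]) simp
qed

lemma visN_complete:
  assumes "X \<noteq> []"
  shows "visN (prod_encode (prod_encode (code B, code C), prod_encode (code (bigand (map impl X)),
    code (bigor (map (brk B) (map fst X @ [C]))))))"
  using assms
proof (induction X rule: list_nonempty_induct)
  case (single x)
  obtain E F where x: "x = (E, F)" by (cases x)
  show ?case unfolding visN_def
    using brkN_complete[of B E] brkN_complete[of B C] by (intro lfpr_ax) (auto simp: x)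
next
  case (cons x X)
  obtain E F where x: "x = (E, F)" by (cases x)
  obtain u Y where Y: "X = u # Y" using cons(1) by (cases X) auto
  have 1: "bigand (map impl (x # X)) = And (Imp E F) (bigand (map impl X))"
    by (simp add: Y x)
  have 2: "bigor (map B' (map fst (x # X) @ [C])) = Or (B' E) (bigor (map B' (map fst X @ [C])))" for B'
    by (simp add: Y x)
  show ?case unfolding 1 2 code.simps
    using cons.IH brkN_complete[of B E] unfolding visN_def
    by - (rule lfpr_rule1[of _ _ "prod_encode (prod_encode (code B, code C), prod_encode (code (bigand (map impl X)),
      code (bigor (map (brk B) (map fst X @ [C])))))"], auto)
qed

abbreviation cTop :: nat where "cTop \<equiv> cImp cBot cBot"

section \<open>Derivations, the relation \<open>tri\<close> and the axioms of
  \<open>Hsigma\<close>\<close>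

definition dN :: "(nat \<Rightarrow> bool) \<Rightarrow> nat \<Rightarrow> bool" where
  "dN E = lfpr (\<lambda>x. E x
      \<or> (\<exists>a b. x = cImp a (cImp b a))
      \<or> (\<exists>a b c. x = cImp (cImp a (cImp b c)) (cImp (cImp a b) (cImp a c)))
      \<or> (\<exists>a b. x = cImp (cAnd a b) a)
      \<or> (\<exists>a b. x = cImp (cAnd a b) b)
      \<or> (\<exists>a b. x = cImp a (cImp b (cAnd a b)))
      \<or> (\<exists>a b. x = cImp a (cOr a b))
      \<or> (\<exists>a b. x = cImp b (cOr a b))
      \<or> (\<exists>a b c. x = cImp (cImp a c) (cImp (cImp b c) (cImp (cOr a b) c)))
      \<or> (\<exists>a. x = cImp cBot a)
      \<or> (\<exists>a b. x = cImp (cBox (cImp a b)) (cImp (cBox a) (cBox b)))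
      \<or> (\<exists>a. x = cImp (cBox a) (cBox (cBox a))))
    (\<lambda>x y z. y = cImp z x \<or> x = cBox y)"

lemma semidecidable_dN: assumes "semidecidable E" shows "semidecidable (dN E)"
  unfolding dN_def by (rule semidecidable_lfpr) (intro semidecidable_intros assms)+

lemma dN_sound:
  assumes "dN E x" "\<And>x. E x \<Longrightarrow> Ax (dec x)" shows "deriv Ax (dec x)"
  using assms(1) unfolding dN_def
proof (induction rule: lfpr.induct)
  case (lfpr_ax x)
  then show ?case
    by (elim disjE exE) (simp_all add: assms(2) deriv.intros(1-12))
next
  case (lfpr_rule x y z)
  from lfpr_rule(1) show ?case
  proof
    assume "y = cImp z x"
    then show ?thesis using mp[OF _ lfpr_rule.IH(2)] lfpr_rule.IH(1) by simp
  next
    assume "x = cBox y"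
    then show ?thesis using nec[OF lfpr_rule.IH(1)] by simp
  qed
qed

lemma dN_complete:
  assumes "deriv Ax A" "\<And>A. Ax A \<Longrightarrow> E (code A)" shows "dN E (code A)"
  using assms(1) unfolding dN_def
proof (induction rule: deriv.induct)
  case (mp A B)
  show ?case by (rule lfpr_rule[OF _ mp.IH]) simp
next
  case (nec A)
  show ?case by (rule lfpr_rule1[OF _ nec.IH]) simp
qed (rule lfpr_ax, simp add: assms(2); blast)+

text \<open>Rule B2 takes two clauses. In the first, the free parameter of \<open>visN\<close> is
  identified with the conjunction that was built. The second is the empty list, whose conjunction is
  \<open>Top\<close>; since \<open>bigand [A] = A\<close>, nonempty conjunctions do not arise from
  it by adding conjuncts.\<close>

definition triN :: "nat \<Rightarrow> bool" where
  "triN = lfpr (\<lambda>x. dN (\<lambda>_. False) (cImp (p1 x) (p2 x))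
      \<or> (\<exists>b c d. x = prod_encode (cImp b c, d) \<and> (visN (prod_encode (prod_encode (b, c), prod_encode (b, d)))
          \<or> (b = cTop \<and> brkN (prod_encode (b, prod_encode (c, d)))))))
    (\<lambda>x y z. (p2 y = p1 z \<and> x = prod_encode (p1 y, p2 z))
      \<or> (p1 y = p1 z \<and> x = prod_encode (p1 y, cAnd (p2 y) (p2 z)))
      \<or> x = prod_encode (cBox (p1 y), cBox (p2 y))
      \<or> (p2 y = p2 z \<and> x = prod_encode (cOr (p1 y) (p1 z), p2 y))
      \<or> (\<exists>c. ((\<exists>p. c = cVar p) \<or> c = cBot \<or> (\<exists>a. c = cBox a))
          \<and> x = prod_encode (cImp c (p1 y), cImp c (p2 y))))"

lemma semidecidable_False: "semidecidable (\<lambda>_. False)"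
  by (rule reI[of "\<lambda>x. 0 = Suc 0"], (rule decidable_eq computable_const)+, simp)

lemma semidecidable_triN: "semidecidable triN"
  unfolding triN_def
  by (rule semidecidable_lfpr)
    (intro semidecidable_intros semidecidable_sub[OF semidecidable_dN[OF semidecidable_False]] semidecidable_sub[OF semidecidable_visN] semidecidable_sub[OF semidecidable_brkN])+

lemma triN_sound: "triN x \<Longrightarrow> tri (dec (p1 x)) (dec (p2 x))"
  unfolding triN_def
proof (induction rule: lfpr.induct)
  case (lfpr_ax x)
  then show ?case
  proof (elim disjE exE conjE)
    assume "dN (\<lambda>_. False) (cImp (p1 x) (p2 x))"
    then have "iK4 (dec (cImp (p1 x) (p2 x)))" by (rule dN_sound)
    then show ?thesis unfolding dec_simps by (rule tri.A1)
  next
    fix b c d assume x: "x = prod_encode (cImp b c, d)"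
      and "visN (prod_encode (prod_encode (b, c), prod_encode (b, d)))"
    then obtain X where "dec b = bigand (map impl X)" "dec d = bigor (map (brk (dec b)) (map fst X @ [dec c]))"
      using visN_sound by fastforce
    then show ?thesis using tri.B2[of X "dec c"] by (simp add: x)
  next
    fix b c d assume x: "x = prod_encode (cImp b c, d)" "b = cTop"
      and "brkN (prod_encode (b, prod_encode (c, d)))"
    then have "dec d = brk Top (dec c)" using brkN_sound' by (fastforce simp: Top_def)
    then show ?thesis using tri.B2[of "[]" "dec c"] by (simp add: x Top_def)
  qed
next
  case (lfpr_rule x y z)
  from lfpr_rule(1) show ?case
  proof (elim disjE exE conjE)
    assume "p2 y = p1 z" "x = prod_encode (p1 y, p2 z)"
    then show ?thesis using tri.A2[of "dec (p1 y)" "dec (p2 y)" "dec (p2 z)"] lfpr_rule.IH by simp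
  next
    assume "p1 y = p1 z" "x = prod_encode (p1 y, cAnd (p2 y) (p2 z))"
    then show ?thesis using lfpr_rule.IH by (simp add: tri.A3)
  next
    assume "x = prod_encode (cBox (p1 y), cBox (p2 y))"
    then show ?thesis using lfpr_rule.IH by (simp add: tri.A4)
  next
    assume "p2 y = p2 z" "x = prod_encode (cOr (p1 y) (p1 z), p2 y)"
    then show ?thesis using lfpr_rule.IH by (simp add: tri.B1)
  qed (use lfpr_rule.IH in \<open>simp_all add: tri.B3\<close>)
qed

lemma triN_complete: "tri A B \<Longrightarrow> triN (prod_encode (code A, code B))"
  unfolding triN_def
proof (induction rule: tri.induct)
  case (A1 A B)
  have "dN (\<lambda>_. False) (code (Imp A B))" using A1 by (rule dN_complete)
  then show ?case by (intro lfpr_ax) simp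
next
  case (A2 A B C)
  show ?case by (rule lfpr_rule[OF _ A2.IH]) simp
next
  case (A3 C A B)
  show ?case by (rule lfpr_rule[OF _ A3.IH]) simp
next
  case (A4 A B)
  show ?case by (rule lfpr_rule1[OF _ A4.IH]) simp
next
  case (B1 A C B)
  show ?case by (rule lfpr_rule[OF _ B1.IH]) simp
next
  case (B2 X C)
  show ?case
  proof (rule lfpr_ax, rule disjI2, intro exI conjI)
    let ?B = "bigand (map impl X)"
    show "prod_encode (code (Imp ?B C), code (bigor (map (brk ?B) (map fst X @ [C])))) =
      prod_encode (cImp (code ?B) (code C), code (bigor (map (brk ?B) (map fst X @ [C]))))"
      by simp
    show "visN (prod_encode (prod_encode (code ?B, code C), prod_encode (code ?B, code (bigor (map (brk ?B) (map fst X @ [C])))))) \<or>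
      (code ?B = cTop \<and> brkN (prod_encode (code ?B, prod_encode (code C, code (bigor (map (brk ?B) (map fst X @ [C])))))))"
    proof (cases "X = []")
      case True
      then show ?thesis using brkN_complete[of Top C] by (simp add: Top_def)
    next
      case False
      then show ?thesis using visN_complete[of X ?B C] by blast
    qed
  qed
next
  case (B3 A B C)
  have "(\<exists>p. code C = cVar p) \<or> code C = cBot \<or> (\<exists>a. code C = cBox a)"
    using B3(2) by (cases C) auto
  then show ?case by - (rule lfpr_rule1[OF _ B3.IH], auto)
qed

definition HN :: "nat \<Rightarrow> bool" where
  "HN = (\<lambda>x. (\<exists>a. x = cImp (cBox (cImp (cBox a) a)) (cBox a))
    \<or> (\<exists>a b. ltN (prod_encode (a, b)) \<and> x = cImp (cBox a) (cBox b))
    \<or> (\<exists>p. x = cImp (cVar p) (cBox (cVar p))) \<or> x = cImp cBot (cBox cBot)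
    \<or> (\<exists>a b. triN (prod_encode (a, b)) \<and> x = cImp (cBox a) (cBox b)))"

lemma semidecidable_HN: "semidecidable HN"
  unfolding HN_def by (intro semidecidable_intros semidecidable_sub[OF semidecidable_ltN] semidecidable_sub[OF semidecidable_triN])

lemma HN_sound: "HN x \<Longrightarrow> Hsigma_ax (dec x)"
  unfolding HN_def
proof (elim disjE exE conjE)
  fix a b assume "ltN (prod_encode (a, b))" "x = cImp (cBox a) (cBox b)"
  then show ?thesis using ltN_sound[of "prod_encode (a, b)"] by (simp add: Hsigma_ax_def)
next
  fix a b assume "triN (prod_encode (a, b))" "x = cImp (cBox a) (cBox b)"
  then show ?thesis using triN_sound[of "prod_encode (a, b)"] by (simp add: Hsigma_ax_def)
qed (simp_all add: Hsigma_ax_def)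

lemma HN_complete: "Hsigma_ax A \<Longrightarrow> HN (code A)"
  unfolding Hsigma_ax_def
proof (elim disjE exE conjE)
  fix B assume "A = Imp (Box B) (Box (lt B))"
  then show ?thesis using ltN_complete[of B] by (auto simp: HN_def)
next
  fix p assume "atomic p" "A = Imp p (Box p)"
  then show ?thesis by (cases p) (auto simp: HN_def)
next
  fix B C assume "tri B C" "A = Imp (Box B) (Box C)"
  then show ?thesis using triN_complete[of B C] by (auto simp: HN_def)
qed (auto simp: HN_def)

lemma Hsigma_dN: "dN HN (code A) \<longleftrightarrow> Hsigma A"
  unfolding Hsigma_def
  using dN_sound[of HN "code A" Hsigma_ax] dN_complete[of Hsigma_ax A HN] HN_sound HN_complete by auto

lemmas decidable_intros = decidable_ball decidable_bex decidable_conj decidable_disj decidable_imp decidable_iff decidable_not decidable_le decidable_eq decidable_mem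
  computable_const computable_id computable_p1 computable_p2 computable_encode computable_Suc

lemma semidecidable_refut: "semidecidable refut"
proof -
  have "semidecidable (\<lambda>b. \<exists>h. (\<forall>w<h. w \<in> set_decode h \<longrightarrow> world b h w) \<and> (\<exists>w<h. w \<in> set_decode h \<and> \<not> ft w b))"
    unfolding world_def wle_def wR_def ft_def by (rule semidecidable_ex, rule semidecidable_cdp) (intro decidable_intros)
  then show ?thesis unfolding refut_def[abs_def] .
qed

theorem theorem6p5:
  shows "\<exists>r. \<forall>A. ev r [code A] (if Hsigma A then 1 else 0)"
proof -
  let ?Q = "\<lambda>x. \<exists>y. gdN y \<and> dN HN (cImp x y) \<and> refut y"
  have dN: "dN HN (cImp (code A) (code B)) \<longleftrightarrow> Hsigma (Imp A B)" for A B
    using Hsigma_dN[of "Imp A B"] by simp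
  \<comment> \<open>The conjuncts of \<open>?Q\<close> are those of \<open>not_Hsigma_iff\<close>;
    \<open>gdN\<close> excludes numbers that are not codes.\<close>
  have Q: "?Q (code A) \<longleftrightarrow> \<not> Hsigma A" for A
  proof
    assume "?Q (code A)"
    then obtain y where y: "gdN y" "dN HN (cImp (code A) y)" "refut y" by blast
    obtain B where "y = code B" "nnil_boxes B" using gdN_sound[OF y(1)] by blast
    then show "\<not> Hsigma A" using y dN refut_sound not_Hsigma_iff by blast
  next
    assume "\<not> Hsigma A"
    then obtain B where "nnil_boxes B" "Hsigma (Imp A B)" "\<not> deriv M_ax B" using not_Hsigma_iff by blast
    then have "gdN (code B)" "dN HN (cImp (code A) (code B))" "refut (code B)"
      using gdN_complete dN refut_complete by blast+
    then show "?Q (code A)" by blast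
  qed
  have "semidecidable ?Q"
    by (intro semidecidable_intros semidecidable_sub[OF semidecidable_gdN] semidecidable_sub[OF semidecidable_dN[OF semidecidable_HN]] semidecidable_sub[OF semidecidable_refut])
  \<comment> \<open>Complementarity is established on codes of formulas, hence the restriction to
    \<open>range code\<close>.\<close>
  with semidecidable_dN[OF semidecidable_HN] have "\<exists>r. \<forall>x\<in>range code. ev r [x] (if dN HN x then 1 else 0)"
    by (rule semidecidable_Post) (use Q Hsigma_dN in auto)
  then show ?thesis by (simp add: Hsigma_dN)
qed

end
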